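(* The theory $\mathsf{RCA}_0$ proves the following: every $\mathsf{WPO}$-dilator $W$ is monotone, i.e. for any partial orders $X,Y$ and any quasi embeddings $f,g:X\to Y$ with $f(x)\leq_Y g(x)$ for all $x\in X$, we have $W(f)(\sigma)\leq_{W(Y)}W(g)(\sigma)$ for all $\sigma\in W(X)$.
   Context: A function $f:X\to Y$ between partial orders is a quasi embedding if $f(x)\leq_Y f(x')$ implies $x\leq_X x'$; it is an embedding if the converse implication holds as well. $\mathsf{PO}$ is the category of partial orders with quasi embeddings as morphisms. A functor $W:\mathsf{PO}\to\mathsf{PO}$ preserves embeddings if $W(f)$ is an embedding whenever $f$ is. $[X]^{<\omega}$ is the set of finite subsets of $X$, and $[f]^{<\omega}(a)=\{f(x)\mid x\in a\}$. A partial order $X$ is a well partial order if every infinite sequence $x_0,x_1,\ldots$ in $X$ admits $i<j$ with $x_i\leq_X x_j$. A $\mathsf{PO}$-dilator consists of a functor $W:\mathsf{PO}\to\mathsf{PO}$ that preserves embeddings and a natural transformation $\operatorname{supp}:W\Rightarrow[\cdot]^{<\omega}$ such that, for every embedding $f:X\to Y$ and every $\sigma\in W(Y)$, $\operatorname{supp}_Y(\sigma)\subseteq\operatorname{rng}(f)$ implies $\sigma\in\operatorname{rng}(W(f))$. It is a $\mathsf{WPO}$-dilator if $W(X)$ is a well partial order whenever $X$ is. Formalization in second order arithmetic: Let $\mathsf{PO}_0\subseteq\mathsf{PO}$ be the full subcategory containing exactly one representative of each isomorphism class of finite partial orders. For each finite partial order $a$ fix an isomorphism $\operatorname{en}_a:|a|\to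 a$ with $|a|\in\mathsf{PO}_0$. A $\mathsf{PO}$-dilator is determined up to isomorphism by its restriction to $\mathsf{PO}_0$, and it is coded by (a subset of $\mathbb N$ representing) this restriction. Its trace is $\operatorname{Tr}(W)=\{(c,\rho)\mid c\in\mathsf{PO}_0,\ \rho\in W(c),\ \operatorname{supp}_c(\rho)=c\}$. For a countable partial order $X$, the elements of $W(X)$ are represented by pairs $(a,\sigma)$ with $a\in[X]^{<\omega}$ (with the induced order) and $(|a|,\sigma)\in\operatorname{Tr}(W)$; the pair stands for the element $W(\operatorname{en}_a^X)(\sigma)$ with support $a$, where $\operatorname{en}^X_a:|a|\to X$ is $\operatorname{en}_a$ followed by the inclusion. Pairs $(a,\sigma),(b,\tau)$ are compared by comparing, in $W(|a\cup b|)$, the images of $\sigma$ and $\tau$ under the morphisms $|a|\to|a\cup b|$ and $|b|\to|a\cup b|$ induced by the inclusions; a quasi embedding $f:X\to Y$ acts by restricting it to $a\to f[a]$ and applying $W$ to the induced morphism $|a|\to|f[a]|$. *)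

theory Defs
  imports Main
begin

section \<open>Second order arithmetic: language and derivability\<close>

text \<open>
  Both sorts use de Bruijn indices, with separate index spaces for number variables and set
  variables; set variables are the only set terms. Equality of sets is not primitive.
\<close>

datatype tm = Var nat | Zero | One | Plus tm tm | Times tm tm

datatype fm =
    Eq tm tm
  | Less tm tm
  | Mem tm nat
  | Fls
  | Imp fm fm
  | AllN fm
  | AllS fm

abbreviation "Neg p \<equiv> Imp p Fls"
abbreviation "Conj p q \<equiv> Neg (Imp p (Neg q))"
abbreviation "Disj p q \<equiv> Imp (Neg p) q"
abbreviation "Iff p q \<equiv> Conj (Imp p q) (Imp q p)"
abbreviation "ExN p \<equiv> Neg (AllN (Neg p))"
abbreviation "ExS p \<equiv> Neg (AllS (Neg p))"

primrec tsub :: "(nat \<Rightarrow> tm) \<Rightarrow> tm \<Rightarrow> tm" where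
  "tsub s (Var i) = s i"
| "tsub s Zero = Zero"
| "tsub s One = One"
| "tsub s (Plus t u) = Plus (tsub s t) (tsub s u)"
| "tsub s (Times t u) = Times (tsub s t) (tsub s u)"

abbreviation lift_tm :: "tm \<Rightarrow> tm" where
  "lift_tm \<equiv> tsub (\<lambda>i. Var (Suc i))"

text \<open>Simultaneous substitution of terms for number variables and set variables for set variables.\<close>

primrec fsub :: "(nat \<Rightarrow> tm) \<Rightarrow> (nat \<Rightarrow> nat) \<Rightarrow> fm \<Rightarrow> fm" where
  "fsub s r (Eq t u) = Eq (tsub s t) (tsub s u)"
| "fsub s r (Less t u) = Less (tsub s t) (tsub s u)"
| "fsub s r (Mem t X) = Mem (tsub s t) (r X)"
| "fsub s r Fls = Fls"
| "fsub s r (Imp p q) = Imp (fsub s r p) (fsub s r q)"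
| "fsub s r (AllN p) = AllN (fsub (case_nat (Var 0) (\<lambda>i. lift_tm (s i))) r p)"
| "fsub s r (AllS p) = AllS (fsub s (case_nat 0 (\<lambda>i. Suc (r i))) p)"

definition instN :: "tm \<Rightarrow> fm \<Rightarrow> fm" where
  "instN t = fsub (case_nat t Var) (\<lambda>i. i)"

definition instS :: "nat \<Rightarrow> fm \<Rightarrow> fm" where
  "instS X = fsub Var (case_nat X (\<lambda>i. i))"

definition liftN :: "fm \<Rightarrow> fm" where
  "liftN = fsub (\<lambda>i. Var (Suc i)) (\<lambda>i. i)"

definition liftS :: "fm \<Rightarrow> fm" where
  "liftS = fsub Var Suc"

text \<open>Natural deduction for two-sorted classical logic with equality on numbers.\<close>

inductive derives :: "fm set \<Rightarrow> fm \<Rightarrow> bool" (infix "\<turnstile>" 50) where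
  Assm: "p \<in> \<Gamma> \<Longrightarrow> \<Gamma> \<turnstile> p"
| ImpI: "insert p \<Gamma> \<turnstile> q \<Longrightarrow> \<Gamma> \<turnstile> Imp p q"
| ImpE: "\<Gamma> \<turnstile> Imp p q \<Longrightarrow> \<Gamma> \<turnstile> p \<Longrightarrow> \<Gamma> \<turnstile> q"
| Contr: "insert (Neg p) \<Gamma> \<turnstile> Fls \<Longrightarrow> \<Gamma> \<turnstile> p"
| AllNI: "liftN ` \<Gamma> \<turnstile> p \<Longrightarrow> \<Gamma> \<turnstile> AllN p"
| AllNE: "\<Gamma> \<turnstile> AllN p \<Longrightarrow> \<Gamma> \<turnstile> instN t p"
| AllSI: "liftS ` \<Gamma> \<turnstile> p \<Longrightarrow> \<Gamma> \<turnstile> AllS p"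
| AllSE: "\<Gamma> \<turnstile> AllS p \<Longrightarrow> \<Gamma> \<turnstile> instS X p"
| EqRefl: "\<Gamma> \<turnstile> Eq t t"
| EqSubst: "\<Gamma> \<turnstile> Eq t u \<Longrightarrow> \<Gamma> \<turnstile> instN t p \<Longrightarrow> \<Gamma> \<turnstile> instN u p"


section \<open>The theory RCA0\<close>

text \<open>All free indices of a term or formula lie below the following bounds.\<close>

primrec bound_tm :: "tm \<Rightarrow> nat" where
  "bound_tm (Var i) = Suc i"
| "bound_tm Zero = 0"
| "bound_tm One = 0"
| "bound_tm (Plus t u) = max (bound_tm t) (bound_tm u)"
| "bound_tm (Times t u) = max (bound_tm t) (bound_tm u)"

primrec boundN :: "fm \<Rightarrow> nat" where
  "boundN (Eq t u) = max (bound_tm t) (bound_tm u)"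
| "boundN (Less t u) = max (bound_tm t) (bound_tm u)"
| "boundN (Mem t X) = bound_tm t"
| "boundN Fls = 0"
| "boundN (Imp p q) = max (boundN p) (boundN q)"
| "boundN (AllN p) = boundN p - 1"
| "boundN (AllS p) = boundN p"

primrec boundS :: "fm \<Rightarrow> nat" where
  "boundS (Eq t u) = 0"
| "boundS (Less t u) = 0"
| "boundS (Mem t X) = Suc X"
| "boundS Fls = 0"
| "boundS (Imp p q) = max (boundS p) (boundS q)"
| "boundS (AllN p) = boundS p"
| "boundS (AllS p) = boundS p - 1"

definition universal_closure :: "fm \<Rightarrow> fm" where
  "universal_closure p = (AllN ^^ boundN p) ((AllS ^^ boundS p) p)"

inductive bounded_fm :: "fm \<Rightarrow> bool" where
  "bounded_fm (Eq t u)"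
| "bounded_fm (Less t u)"
| "bounded_fm (Mem t X)"
| "bounded_fm Fls"
| "bounded_fm p \<Longrightarrow> bounded_fm q \<Longrightarrow> bounded_fm (Imp p q)"
| "bounded_fm p \<Longrightarrow> bounded_fm (AllN (Imp (Less (Var 0) (lift_tm t)) p))"
| "bounded_fm p \<Longrightarrow> bounded_fm (ExN (Conj (Less (Var 0) (lift_tm t)) p))"

definition Sigma01 :: "fm \<Rightarrow> bool" where
  "Sigma01 p \<longleftrightarrow> (\<exists>q. bounded_fm q \<and> p = ExN q)"

definition Pi01 :: "fm \<Rightarrow> bool" where
  "Pi01 p \<longleftrightarrow> (\<exists>q. bounded_fm q \<and> p = AllN q)"

definition basic_axioms :: "fm set" where
  "basic_axioms = universal_closure ` {
     Neg (Eq (Plus (Var 0) One) Zero),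
     Imp (Eq (Plus (Var 0) One) (Plus (Var 1) One)) (Eq (Var 0) (Var 1)),
     Eq (Plus (Var 0) Zero) (Var 0),
     Eq (Plus (Var 0) (Plus (Var 1) One)) (Plus (Plus (Var 0) (Var 1)) One),
     Eq (Times (Var 0) Zero) Zero,
     Eq (Times (Var 0) (Plus (Var 1) One)) (Plus (Times (Var 0) (Var 1)) (Var 0)),
     Neg (Less (Var 0) Zero),
     Iff (Less (Var 0) (Plus (Var 1) One)) (Disj (Less (Var 0) (Var 1)) (Eq (Var 0) (Var 1)))}"

text \<open>In both schemes the distinguished number variable has index 0; all others are parameters.\<close>

definition induction_axiom :: "fm \<Rightarrow> fm" where
  "induction_axiom p = universal_closure
     (Imp (Conj (instN Zero p)
                (AllN (Imp p (fsub (case_nat (Plus (Var 0) One) (\<lambda>i. Var (Suc i))) (\<lambda>i. i) p))))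
          (AllN p))"

definition comprehension_axiom :: "fm \<Rightarrow> fm \<Rightarrow> fm" where
  "comprehension_axiom p q = universal_closure
     (Imp (AllN (Iff p q)) (ExS (AllN (Iff (Mem (Var 0) 0) (liftS p)))))"

definition RCA0 :: "fm set" where
  "RCA0 = basic_axioms
     \<union> {induction_axiom p | p. Sigma01 p}
     \<union> {comprehension_axiom p q | p q. Sigma01 p \<and> Pi01 q}"


section \<open>Notation for writing formulas\<close>

text \<open>
  Terms and formulas of the object language are given as functions of the numbers of number and
  set quantifiers they stand under. This allows object-level variables to be bound by
  abstractions of the meta-language: a variable introduced under \<open>m\<close> quantifiers has index
  \<open>m' - Suc m\<close> under \<open>m'\<close> quantifiers of its sort. A closed formula is obtained at depth \<open>0 0\<close>.
  Connectives and quantifiers of the object language are set in bold type.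
\<close>

type_synonym nterm = "nat \<Rightarrow> tm"
type_synonym sterm = "nat \<Rightarrow> nat"
type_synonym form = "nat \<Rightarrow> nat \<Rightarrow> fm"

text \<open>A class is a formula with a distinguished number variable.\<close>

type_synonym cls = "nterm \<Rightarrow> form"

definition sentence :: "form \<Rightarrow> fm" where
  "sentence F = F 0 0"

definition f_eq :: "nterm \<Rightarrow> nterm \<Rightarrow> form" (infix "\<^bold>=" 50) where
  "(t \<^bold>= u) = (\<lambda>m k. Eq (t m) (u m))"

definition f_less :: "nterm \<Rightarrow> nterm \<Rightarrow> form" (infix "\<^bold><" 50) where
  "(t \<^bold>< u) = (\<lambda>m k. Less (t m) (u m))"

definition f_mem :: "nterm \<Rightarrow> sterm \<Rightarrow> form" (infix "\<^bold>\<in>" 50) where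
  "(t \<^bold>\<in> X) = (\<lambda>m k. Mem (t m) (X k))"

definition f_not :: "form \<Rightarrow> form" ("\<^bold>\<not> _" [40] 40) where
  "(\<^bold>\<not> F) = (\<lambda>m k. Neg (F m k))"

definition f_and :: "form \<Rightarrow> form \<Rightarrow> form" (infixr "\<^bold>\<and>" 35) where
  "(F \<^bold>\<and> G) = (\<lambda>m k. Conj (F m k) (G m k))"

definition f_imp :: "form \<Rightarrow> form \<Rightarrow> form" (infixr "\<^bold>\<longrightarrow>" 25) where
  "(F \<^bold>\<longrightarrow> G) = (\<lambda>m k. Imp (F m k) (G m k))"

definition f_or :: "form \<Rightarrow> form \<Rightarrow> form" (infixr "\<^bold>\<or>" 30) where
  "(F \<^bold>\<or> G) = (\<lambda>m k. Disj (F m k) (G m k))"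

definition f_iff :: "form \<Rightarrow> form \<Rightarrow> form" (infixr "\<^bold>\<longleftrightarrow>" 25) where
  "(F \<^bold>\<longleftrightarrow> G) = (\<lambda>m k. Iff (F m k) (G m k))"

definition f_all :: "(nterm \<Rightarrow> form) \<Rightarrow> form" (binder "\<^bold>\<forall>" 10) where
  "f_all F = (\<lambda>m k. AllN (F (\<lambda>m'. Var (m' - Suc m)) (Suc m) k))"

definition f_ex :: "(nterm \<Rightarrow> form) \<Rightarrow> form" (binder "\<^bold>\<exists>" 10) where
  "f_ex F = (\<lambda>m k. ExN (F (\<lambda>m'. Var (m' - Suc m)) (Suc m) k))"

definition f_all_set :: "(sterm \<Rightarrow> form) \<Rightarrow> form" (binder "\<^bold>\<forall>\<^sub>S" 10) where
  "f_all_set F = (\<lambda>m k. AllS (F (\<lambda>k'. k' - Suc k) m (Suc k)))"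

definition nt_zero :: nterm ("\<^bold>0") where
  "\<^bold>0 = (\<lambda>m. Zero)"

definition nt_one :: nterm ("\<^bold>1") where
  "\<^bold>1 = (\<lambda>m. One)"

definition nt_plus :: "nterm \<Rightarrow> nterm \<Rightarrow> nterm" (infixl "\<^bold>+" 65) where
  "t \<^bold>+ u = (\<lambda>m. Plus (t m) (u m))"

definition nt_times :: "nterm \<Rightarrow> nterm \<Rightarrow> nterm" (infixl "\<^bold>*" 70) where
  "t \<^bold>* u = (\<lambda>m. Times (t m) (u m))"


section \<open>Finite sets, functions and partial orders in second order arithmetic\<close>

definition pair :: "nterm \<Rightarrow> nterm \<Rightarrow> nterm" ("\<^bold>\<langle>_, _\<^bold>\<rangle>") where
  "\<^bold>\<langle>x, y\<^bold>\<rangle> = (x \<^bold>+ y) \<^bold>* (x \<^bold>+ y) \<^bold>+ x"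

definition set_cls :: "sterm \<Rightarrow> cls" where
  "set_cls X = (\<lambda>x. x \<^bold>\<in> X)"

text \<open>
  Simpson's coding of finite sets: \<open>((k, m), n)\<close> codes the set of all \<open>i < k\<close> such that
  \<open>m (i + 1) + 1\<close> divides \<open>n\<close>. To make codes unique, only the least code of each set is used.
\<close>

definition code_cls :: "nterm \<Rightarrow> cls" where
  "code_cls c = (\<lambda>i. \<^bold>\<exists>k m n q. c \<^bold>= \<^bold>\<langle>\<^bold>\<langle>k, m\<^bold>\<rangle>, n\<^bold>\<rangle> \<^bold>\<and> i \<^bold>< k \<^bold>\<and> n \<^bold>= q \<^bold>* (m \<^bold>* (i \<^bold>+ \<^bold>1) \<^bold>+ \<^bold>1))"

definition is_finset :: "nterm \<Rightarrow> form" where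
  "is_finset c = (\<^bold>\<forall>c'. c' \<^bold>< c \<^bold>\<longrightarrow> \<^bold>\<not> (\<^bold>\<forall>i. code_cls c' i \<^bold>\<longleftrightarrow> code_cls c i))"

definition subset_cls :: "cls \<Rightarrow> cls \<Rightarrow> form" where
  "subset_cls A B = (\<^bold>\<forall>x. A x \<^bold>\<longrightarrow> B x)"

definition same_cls :: "cls \<Rightarrow> cls \<Rightarrow> form" where
  "same_cls A B = (\<^bold>\<forall>x. A x \<^bold>\<longleftrightarrow> B x)"

definition Top_cls :: cls where
  "Top_cls = (\<lambda>x. x \<^bold>= x)"

definition Union_cls :: "cls \<Rightarrow> cls \<Rightarrow> cls" where
  "Union_cls A B = (\<lambda>x. A x \<^bold>\<or> B x)"

definition Fin_cls :: "cls \<Rightarrow> cls" where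
  "Fin_cls A = (\<lambda>a. is_finset a \<^bold>\<and> subset_cls (code_cls a) A)"

text \<open>Functions are classes of pairs.\<close>

definition is_function :: "cls \<Rightarrow> cls \<Rightarrow> cls \<Rightarrow> form" where
  "is_function F A B =
     ((\<^bold>\<forall>t. F t \<^bold>\<longrightarrow> (\<^bold>\<exists>x y. t \<^bold>= \<^bold>\<langle>x, y\<^bold>\<rangle> \<^bold>\<and> A x \<^bold>\<and> B y)) \<^bold>\<and>
      (\<^bold>\<forall>x. A x \<^bold>\<longrightarrow> (\<^bold>\<exists>y. F \<^bold>\<langle>x, y\<^bold>\<rangle>)) \<^bold>\<and>
      (\<^bold>\<forall>x y z. F \<^bold>\<langle>x, y\<^bold>\<rangle> \<^bold>\<and> F \<^bold>\<langle>x, z\<^bold>\<rangle> \<^bold>\<longrightarrow> y \<^bold>= z))"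

definition Id_cls :: "cls \<Rightarrow> cls" where
  "Id_cls A = (\<lambda>t. \<^bold>\<exists>x. t \<^bold>= \<^bold>\<langle>x, x\<^bold>\<rangle> \<^bold>\<and> A x)"

definition comp_cls :: "cls \<Rightarrow> cls \<Rightarrow> cls" where
  "comp_cls G F = (\<lambda>t. \<^bold>\<exists>x y z. t \<^bold>= \<^bold>\<langle>x, z\<^bold>\<rangle> \<^bold>\<and> F \<^bold>\<langle>x, y\<^bold>\<rangle> \<^bold>\<and> G \<^bold>\<langle>y, z\<^bold>\<rangle>)"

definition converse_cls :: "cls \<Rightarrow> cls" where
  "converse_cls F = (\<lambda>t. \<^bold>\<exists>x y. t \<^bold>= \<^bold>\<langle>y, x\<^bold>\<rangle> \<^bold>\<and> F \<^bold>\<langle>x, y\<^bold>\<rangle>)"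

definition Image_cls :: "cls \<Rightarrow> cls \<Rightarrow> cls" where
  "Image_cls F A = (\<lambda>y. \<^bold>\<exists>x. A x \<^bold>\<and> F \<^bold>\<langle>x, y\<^bold>\<rangle>)"

text \<open>
  A partial order is identified with its (reflexive) order relation, a class of pairs, from
  which the underlying set is recovered as the field.
\<close>

definition field :: "cls \<Rightarrow> cls" where
  "field R = (\<lambda>x. R \<^bold>\<langle>x, x\<^bold>\<rangle>)"

definition partial_order :: "cls \<Rightarrow> form" where
  "partial_order R =
     ((\<^bold>\<forall>t. R t \<^bold>\<longrightarrow> (\<^bold>\<exists>x y. t \<^bold>= \<^bold>\<langle>x, y\<^bold>\<rangle> \<^bold>\<and> field R x \<^bold>\<and> field R y)) \<^bold>\<and>
      (\<^bold>\<forall>x y. R \<^bold>\<langle>x, y\<^bold>\<rangle> \<^bold>\<and> R \<^bold>\<langle>y, x\<^bold>\<rangle> \<^bold>\<longrightarrow> x \<^bold>= y) \<^bold>\<and>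
      (\<^bold>\<forall>x y z. R \<^bold>\<langle>x, y\<^bold>\<rangle> \<^bold>\<and> R \<^bold>\<langle>y, z\<^bold>\<rangle> \<^bold>\<longrightarrow> R \<^bold>\<langle>x, z\<^bold>\<rangle>))"

definition quasi_embedding :: "cls \<Rightarrow> cls \<Rightarrow> cls \<Rightarrow> form" where
  "quasi_embedding F R Q =
     (is_function F (field R) (field Q) \<^bold>\<and>
      (\<^bold>\<forall>x x' y y'. F \<^bold>\<langle>x, y\<^bold>\<rangle> \<^bold>\<and> F \<^bold>\<langle>x', y'\<^bold>\<rangle> \<^bold>\<and> Q \<^bold>\<langle>y, y'\<^bold>\<rangle> \<^bold>\<longrightarrow> R \<^bold>\<langle>x, x'\<^bold>\<rangle>))"

definition embedding :: "cls \<Rightarrow> cls \<Rightarrow> cls \<Rightarrow> form" where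
  "embedding F R Q =
     (quasi_embedding F R Q \<^bold>\<and>
      (\<^bold>\<forall>x x' y y'. F \<^bold>\<langle>x, y\<^bold>\<rangle> \<^bold>\<and> F \<^bold>\<langle>x', y'\<^bold>\<rangle> \<^bold>\<and> R \<^bold>\<langle>x, x'\<^bold>\<rangle> \<^bold>\<longrightarrow> Q \<^bold>\<langle>y, y'\<^bold>\<rangle>))"

definition isomorphism :: "cls \<Rightarrow> cls \<Rightarrow> cls \<Rightarrow> form" where
  "isomorphism F R Q =
     (embedding F R Q \<^bold>\<and> (\<^bold>\<forall>y. field Q y \<^bold>\<longrightarrow> (\<^bold>\<exists>x. F \<^bold>\<langle>x, y\<^bold>\<rangle>)))"

text \<open>
  The condition on infinite sequences that makes a partial order with underlying class \<open>A\<close> and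
  order \<open>L\<close> a well partial order. The sequences range over sets, i.e. over the functions
  available in the model under consideration.
\<close>

definition sequences_good :: "cls \<Rightarrow> (nterm \<Rightarrow> nterm \<Rightarrow> form) \<Rightarrow> form" where
  "sequences_good A L =
     (\<^bold>\<forall>\<^sub>S s. is_function (set_cls s) Top_cls A \<^bold>\<longrightarrow>
        (\<^bold>\<exists>i j x y. i \<^bold>< j \<^bold>\<and> \<^bold>\<langle>i, x\<^bold>\<rangle> \<^bold>\<in> s \<^bold>\<and> \<^bold>\<langle>j, y\<^bold>\<rangle> \<^bold>\<in> s \<^bold>\<and> L x y))"

definition well_partial_order :: "sterm \<Rightarrow> form" where
  "well_partial_order X =
     (partial_order (set_cls X) \<^bold>\<and>
      sequences_good (field (set_cls X)) (\<lambda>x y. \<^bold>\<langle>x, y\<^bold>\<rangle> \<^bold>\<in> X))"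


section \<open>Coded dilators\<close>

definition finite_po :: "nterm \<Rightarrow> form" where
  "finite_po a = (is_finset a \<^bold>\<and> partial_order (code_cls a))"

text \<open>
  The choices made in the definition of PO0 and of the isomorphisms \<open>en\<close> are set parameters:
  \<open>P\<close> is the set of objects of PO0 and \<open>E\<close> consists of the triples \<open>((a, c), h)\<close> where \<open>a\<close> is a
  finite partial order, \<open>c = |a|\<close>, and \<open>h : c \<rightarrow> a\<close> is the isomorphism assigned to \<open>a\<close>. That suitable
  \<open>P\<close> and \<open>E\<close> exist is provable in RCA0 (take least codes); the theorem concerns an arbitrary choice.
\<close>

definition representatives :: "sterm \<Rightarrow> sterm \<Rightarrow> form" where
  "representatives P E =
     ((\<^bold>\<forall>c. c \<^bold>\<in> P \<^bold>\<longrightarrow> finite_po c) \<^bold>\<and>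
      (\<^bold>\<forall>c d h. c \<^bold>\<in> P \<^bold>\<and> d \<^bold>\<in> P \<^bold>\<and> is_finset h \<^bold>\<and>
         isomorphism (code_cls h) (code_cls c) (code_cls d) \<^bold>\<longrightarrow> c \<^bold>= d) \<^bold>\<and>
      (\<^bold>\<forall>a. finite_po a \<^bold>\<longrightarrow>
         (\<^bold>\<exists>c h. \<^bold>\<langle>\<^bold>\<langle>a, c\<^bold>\<rangle>, h\<^bold>\<rangle> \<^bold>\<in> E \<^bold>\<and> c \<^bold>\<in> P \<^bold>\<and> is_finset h \<^bold>\<and>
            isomorphism (code_cls h) (code_cls c) (code_cls a) \<^bold>\<and>
            (\<^bold>\<forall>c' h'. \<^bold>\<langle>\<^bold>\<langle>a, c'\<^bold>\<rangle>, h'\<^bold>\<rangle> \<^bold>\<in> E \<^bold>\<longrightarrow> c' \<^bold>= c \<^bold>\<and> h' \<^bold>= h))))"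

definition morphism :: "sterm \<Rightarrow> nterm \<Rightarrow> nterm \<Rightarrow> nterm \<Rightarrow> form" where
  "morphism P h c d =
     (c \<^bold>\<in> P \<^bold>\<and> d \<^bold>\<in> P \<^bold>\<and> is_finset h \<^bold>\<and> quasi_embedding (code_cls h) (code_cls c) (code_cls d))"

text \<open>
  The restriction of \<open>W\<close> to PO0 is coded by one set with three parts, tagged 0, 1 and 2: the order
  relations of the \<open>W(c)\<close>, the graphs of \<open>W(h)\<close> for \<open>h : c \<rightarrow> d\<close>, and the graphs of the \<open>supp\<^sub>c\<close>.
\<close>

definition W_ord :: "sterm \<Rightarrow> nterm \<Rightarrow> cls" where
  "W_ord W c = (\<lambda>t. \<^bold>\<langle>\<^bold>0, \<^bold>\<langle>c, t\<^bold>\<rangle>\<^bold>\<rangle> \<^bold>\<in> W)"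

definition W_mor :: "sterm \<Rightarrow> nterm \<Rightarrow> nterm \<Rightarrow> nterm \<Rightarrow> cls" where
  "W_mor W h c d = (\<lambda>t. \<^bold>\<langle>\<^bold>1, \<^bold>\<langle>\<^bold>\<langle>\<^bold>\<langle>c, d\<^bold>\<rangle>, h\<^bold>\<rangle>, t\<^bold>\<rangle>\<^bold>\<rangle> \<^bold>\<in> W)"

definition W_supp :: "sterm \<Rightarrow> nterm \<Rightarrow> cls" where
  "W_supp W c = (\<lambda>t. \<^bold>\<langle>\<^bold>1 \<^bold>+ \<^bold>1, \<^bold>\<langle>c, t\<^bold>\<rangle>\<^bold>\<rangle> \<^bold>\<in> W)"

definition PO_functor :: "sterm \<Rightarrow> sterm \<Rightarrow> form" where
  "PO_functor P W =
     ((\<^bold>\<forall>c. c \<^bold>\<in> P \<^bold>\<longrightarrow> partial_order (W_ord W c)) \<^bold>\<and>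
      (\<^bold>\<forall>c d h. morphism P h c d \<^bold>\<longrightarrow>
         quasi_embedding (W_mor W h c d) (W_ord W c) (W_ord W d)) \<^bold>\<and>
      (\<^bold>\<forall>c h. morphism P h c c \<^bold>\<and> same_cls (code_cls h) (Id_cls (field (code_cls c))) \<^bold>\<longrightarrow>
         same_cls (W_mor W h c c) (Id_cls (field (W_ord W c)))) \<^bold>\<and>
      (\<^bold>\<forall>c d e h k l. morphism P h c d \<^bold>\<and> morphism P k d e \<^bold>\<and> morphism P l c e \<^bold>\<and>
         same_cls (code_cls l) (comp_cls (code_cls k) (code_cls h)) \<^bold>\<longrightarrow>
         same_cls (W_mor W l c e) (comp_cls (W_mor W k d e) (W_mor W h c d))))"

definition preserves_embeddings :: "sterm \<Rightarrow> sterm \<Rightarrow> form" where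
  "preserves_embeddings P W =
     (\<^bold>\<forall>c d h. morphism P h c d \<^bold>\<and> embedding (code_cls h) (code_cls c) (code_cls d) \<^bold>\<longrightarrow>
        embedding (W_mor W h c d) (W_ord W c) (W_ord W d))"

definition supp_natural :: "sterm \<Rightarrow> sterm \<Rightarrow> form" where
  "supp_natural P W =
     ((\<^bold>\<forall>c. c \<^bold>\<in> P \<^bold>\<longrightarrow>
         is_function (W_supp W c) (field (W_ord W c)) (Fin_cls (field (code_cls c)))) \<^bold>\<and>
      (\<^bold>\<forall>c d h r s a b. morphism P h c d \<^bold>\<and> W_mor W h c d \<^bold>\<langle>r, s\<^bold>\<rangle> \<^bold>\<and>
         W_supp W c \<^bold>\<langle>r, a\<^bold>\<rangle> \<^bold>\<and> W_supp W d \<^bold>\<langle>s, b\<^bold>\<rangle> \<^bold>\<longrightarrow>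
         same_cls (code_cls b) (Image_cls (code_cls h) (code_cls a))))"

definition support_condition :: "sterm \<Rightarrow> sterm \<Rightarrow> form" where
  "support_condition P W =
     (\<^bold>\<forall>c d h s b. morphism P h c d \<^bold>\<and> embedding (code_cls h) (code_cls c) (code_cls d) \<^bold>\<and>
        W_supp W d \<^bold>\<langle>s, b\<^bold>\<rangle> \<^bold>\<and>
        subset_cls (code_cls b) (Image_cls (code_cls h) (field (code_cls c))) \<^bold>\<longrightarrow>
        (\<^bold>\<exists>r. W_mor W h c d \<^bold>\<langle>r, s\<^bold>\<rangle>))"

definition PO_dilator :: "sterm \<Rightarrow> sterm \<Rightarrow> form" where
  "PO_dilator P W =
     (PO_functor P W \<^bold>\<and> preserves_embeddings P W \<^bold>\<and> supp_natural P W \<^bold>\<and> support_condition P W)"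

definition trace :: "sterm \<Rightarrow> sterm \<Rightarrow> nterm \<Rightarrow> nterm \<Rightarrow> form" where
  "trace P W c r =
     (c \<^bold>\<in> P \<^bold>\<and> field (W_ord W c) r \<^bold>\<and>
      (\<^bold>\<exists>a. W_supp W c \<^bold>\<langle>r, a\<^bold>\<rangle> \<^bold>\<and> same_cls (code_cls a) (field (code_cls c))))"

text \<open>For a finite subset \<open>a\<close> of \<open>X\<close> with the induced order: \<open>c = |a|\<close> and \<open>h = en\<^sub>a\<close>.\<close>

definition enumerates :: "sterm \<Rightarrow> sterm \<Rightarrow> nterm \<Rightarrow> nterm \<Rightarrow> nterm \<Rightarrow> form" where
  "enumerates E X a c h =
     (\<^bold>\<exists>q. is_finset q \<^bold>\<and>
        same_cls (code_cls q)
          (\<lambda>t. \<^bold>\<exists>x y. t \<^bold>= \<^bold>\<langle>x, y\<^bold>\<rangle> \<^bold>\<and> code_cls a x \<^bold>\<and> code_cls a y \<^bold>\<and> \<^bold>\<langle>x, y\<^bold>\<rangle> \<^bold>\<in> X) \<^bold>\<and>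
        \<^bold>\<langle>\<^bold>\<langle>q, c\<^bold>\<rangle>, h\<^bold>\<rangle> \<^bold>\<in> E)"

text \<open>
  \<open>m : |a| \<rightarrow> |b|\<close> is the morphism induced by \<open>F : a \<rightarrow> b\<close>, where \<open>h = en\<^sub>a\<close> and \<open>k = en\<^sub>b\<close>, i.e.
  the composition of \<open>h\<close>, \<open>F\<close> and the inverse of \<open>k\<close>.
\<close>

definition induced :: "nterm \<Rightarrow> nterm \<Rightarrow> cls \<Rightarrow> nterm \<Rightarrow> form" where
  "induced m h F k =
     (is_finset m \<^bold>\<and>
      same_cls (code_cls m)
        (comp_cls (converse_cls (code_cls k)) (comp_cls F (code_cls h))))"

text \<open>The underlying class, the order and the action on morphisms of the extension of \<open>W\<close>.\<close>

definition D_elem :: "sterm \<Rightarrow> sterm \<Rightarrow> sterm \<Rightarrow> sterm \<Rightarrow> cls" where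
  "D_elem P E W X = (\<lambda>p. \<^bold>\<exists>a \<sigma> c h. p \<^bold>= \<^bold>\<langle>a, \<sigma>\<^bold>\<rangle> \<^bold>\<and>
     Fin_cls (field (set_cls X)) a \<^bold>\<and> enumerates E X a c h \<^bold>\<and> trace P W c \<sigma>)"

definition D_le :: "sterm \<Rightarrow> sterm \<Rightarrow> sterm \<Rightarrow> sterm \<Rightarrow> nterm \<Rightarrow> nterm \<Rightarrow> form" where
  "D_le P E W X p q =
     (D_elem P E W X p \<^bold>\<and> D_elem P E W X q \<^bold>\<and>
      (\<^bold>\<exists>a \<sigma> b \<tau> e c h d k l n m m' \<sigma>' \<tau>'.
         p \<^bold>= \<^bold>\<langle>a, \<sigma>\<^bold>\<rangle> \<^bold>\<and> q \<^bold>= \<^bold>\<langle>b, \<tau>\<^bold>\<rangle> \<^bold>\<and>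
         is_finset e \<^bold>\<and> same_cls (code_cls e) (Union_cls (code_cls a) (code_cls b)) \<^bold>\<and>
         enumerates E X a c h \<^bold>\<and> enumerates E X b d k \<^bold>\<and> enumerates E X e l n \<^bold>\<and>
         induced m h (Id_cls (code_cls a)) n \<^bold>\<and> induced m' k (Id_cls (code_cls b)) n \<^bold>\<and>
         W_mor W m c l \<^bold>\<langle>\<sigma>, \<sigma>'\<^bold>\<rangle> \<^bold>\<and> W_mor W m' d l \<^bold>\<langle>\<tau>, \<tau>'\<^bold>\<rangle> \<^bold>\<and>
         W_ord W l \<^bold>\<langle>\<sigma>', \<tau>'\<^bold>\<rangle>))"

definition D_map :: "sterm \<Rightarrow> sterm \<Rightarrow> sterm \<Rightarrow> sterm \<Rightarrow> sterm \<Rightarrow> sterm \<Rightarrow> nterm \<Rightarrow> nterm \<Rightarrow> form" where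
  "D_map P E W X Y f p q =
     (D_elem P E W X p \<^bold>\<and> D_elem P E W Y q \<^bold>\<and>
      (\<^bold>\<exists>a \<sigma> b \<tau> c h d k m.
         p \<^bold>= \<^bold>\<langle>a, \<sigma>\<^bold>\<rangle> \<^bold>\<and> q \<^bold>= \<^bold>\<langle>b, \<tau>\<^bold>\<rangle> \<^bold>\<and>
         same_cls (code_cls b) (Image_cls (set_cls f) (code_cls a)) \<^bold>\<and>
         enumerates E X a c h \<^bold>\<and> enumerates E Y b d k \<^bold>\<and>
         induced m h (set_cls f) k \<^bold>\<and> W_mor W m c d \<^bold>\<langle>\<sigma>, \<tau>\<^bold>\<rangle>))"

text \<open>
  That the extension of a PO-dilator takes partial orders to partial orders is automatic, so only
  the condition on sequences is required of it.
\<close>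

definition WPO_dilator :: "sterm \<Rightarrow> sterm \<Rightarrow> sterm \<Rightarrow> form" where
  "WPO_dilator P E W =
     (PO_dilator P W \<^bold>\<and>
      (\<^bold>\<forall>\<^sub>S X. well_partial_order X \<^bold>\<longrightarrow> sequences_good (D_elem P E W X) (D_le P E W X)))"

definition monotone_dilator :: "sterm \<Rightarrow> sterm \<Rightarrow> sterm \<Rightarrow> form" where
  "monotone_dilator P E W =
     (\<^bold>\<forall>\<^sub>S X. \<^bold>\<forall>\<^sub>S Y. \<^bold>\<forall>\<^sub>S f. \<^bold>\<forall>\<^sub>S g.
        partial_order (set_cls X) \<^bold>\<and> partial_order (set_cls Y) \<^bold>\<and>
        quasi_embedding (set_cls f) (set_cls X) (set_cls Y) \<^bold>\<and>
        quasi_embedding (set_cls g) (set_cls X) (set_cls Y) \<^bold>\<and>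
        (\<^bold>\<forall>x y z. \<^bold>\<langle>x, y\<^bold>\<rangle> \<^bold>\<in> f \<^bold>\<and> \<^bold>\<langle>x, z\<^bold>\<rangle> \<^bold>\<in> g \<^bold>\<longrightarrow> \<^bold>\<langle>y, z\<^bold>\<rangle> \<^bold>\<in> Y) \<^bold>\<longrightarrow>
        (\<^bold>\<forall>p. D_elem P E W X p \<^bold>\<longrightarrow>
           (\<^bold>\<exists>q r. D_map P E W X Y f p q \<^bold>\<and> D_map P E W X Y g p r \<^bold>\<and> D_le P E W Y q r)))"

end

theory Submission
  imports Defs "HOL-Library.Countable"
begin

text \<open>
  By a completeness theorem for the calculus it suffices to work inside an arbitrary model of RCA0.
  Let \<open>f, g : X \<rightarrow> Y\<close> be quasi embeddings with \<open>f \<le> g\<close>, and let \<open>\<sigma> \<in> W(X)\<close> have the finite support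
  \<open>a\<close>. Suppose first that \<open>f x = g x'\<close> with \<open>x, x' \<in> a\<close> implies \<open>x = x'\<close>. Let \<open>Z\<close> be the sum of
  copies of \<open>\<omega>\<close>, one for each \<open>x \<in> a\<close>, each cut down to its first point when \<open>f x = g x\<close>. As \<open>Z\<close>
  is a well partial order (by the pigeonhole principle), the embeddings \<open>h\<^sub>i\<close> of the antichain \<open>a\<close>
  at level \<open>i\<close> satisfy \<open>W(h\<^sub>i)(\<sigma>) \<le> W(h\<^sub>j)(\<sigma>)\<close> for some \<open>i < j\<close>. Now \<open>f x \<mapsto> h\<^sub>i x\<close> and
  \<open>g x \<mapsto> h\<^sub>j x\<close> define a quasi embedding of \<open>f[a] \<union> g[a]\<close> into \<open>Z\<close>, along which the inequality is
  reflected. In general, extend \<open>Y\<close> by new points strictly between \<open>f x\<close> and \<open>g x\<close> wherever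
  \<open>f x \<noteq> g x\<close>. The special case applies to \<open>f\<close> and the interpolating map, and to the latter and \<open>g\<close>.
\<close>

section \<open>Substitution and derivability\<close>

text \<open>Sending \<open>F x\<close> to level i and \<open>G x\<close> to level j is a map only if
  no point receives two values. A collision \<open>F x = G x'\<close> with distinct x and x' would
  put one point into two chains, hence the special case; a coincidence \<open>F x = G x\<close> asks
  levels i and j of one chain to agree, hence the chains of length one. Interpolation removes all
  collisions of the first kind, since a new point is a value of the middle map only. The other
  obstacle is the weakness of the base theory. That the sum of chains is a well partial order is
  usually seen by choosing a chain that a sequence visits infinitely often; for an arbitrary finite
  number of chains, which may be nonstandard, this principle goes beyond RCA0. Instead, a bad
  sequence is shown to take, from some point on, pairwise distinct values below a fixed bound,
  against the pigeonhole principle for bounded sets. Likewise every set, map and sequence that is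
  used must be shown to belong to the model; this is the reason for the rules on definability and
  for pairing functions of the logic with graphs in the model.\<close>

lemma tsub_tsub: "tsub s (tsub s' t) = tsub (\<lambda>i. tsub s (s' i)) t"
  by (induction t) auto

lemma tsub_Var [simp]: "tsub Var t = t"
  by (induction t) auto

lemma tsub_cong: "(\<And>i. i < bound_tm t \<Longrightarrow> s i = s' i) \<Longrightarrow> tsub s t = tsub s' t"
  by (induction t) auto

lemma fsub_fsub: "fsub s r (fsub s' r' p) = fsub (\<lambda>i. tsub s (s' i)) (\<lambda>i. r (r' i)) p"
proof (induction p arbitrary: s r s' r')
  case (AllN p)
  have "(\<lambda>i. tsub (case_nat (Var 0) (\<lambda>i. lift_tm (s i))) (case_nat (Var 0) (\<lambda>i. lift_tm (s' i)) i)) =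
      case_nat (Var 0) (\<lambda>i. lift_tm (tsub s (s' i)))"
    by (auto simp: fun_eq_iff tsub_tsub split: nat.split)
  with AllN show ?case by simp
next
  case (AllS p)
  have "(\<lambda>i. case_nat 0 (\<lambda>i. Suc (r i)) (case_nat 0 (\<lambda>i. Suc (r' i)) i)) =
      case_nat 0 (\<lambda>i. Suc (r (r' i)))"
    by (auto simp: fun_eq_iff split: nat.split)
  with AllS show ?case by simp
qed (auto simp: tsub_tsub)

text \<open>The link between the bounds and substitution: it makes closed formulas invariant and
  makes an index at the bound fresh.\<close>

lemma fsub_cong:
  "(\<And>i. i < boundN p \<Longrightarrow> s i = s' i) \<Longrightarrow> (\<And>i. i < boundS p \<Longrightarrow> r i = r' i) \<Longrightarrow> fsub s r p = fsub s' r' p"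
proof (induction p arbitrary: s r s' r')
  case (AllN p)
  have "fsub (case_nat (Var 0) (\<lambda>i. lift_tm (s i))) r p = fsub (case_nat (Var 0) (\<lambda>i. lift_tm (s' i))) r' p"
    by (rule AllN.IH) (use AllN.prems in \<open>auto split: nat.split\<close>)
  then show ?case by simp
next
  case (AllS p)
  have "fsub s (case_nat 0 (\<lambda>i. Suc (r i))) p = fsub s' (case_nat 0 (\<lambda>i. Suc (r' i))) p"
    by (rule AllS.IH) (use AllS.prems in \<open>auto split: nat.split\<close>)
  then show ?case by simp
next
  case (Imp p q)
  have "fsub s r p = fsub s' r' p" "fsub s r q = fsub s' r' q"
    by (rule Imp.IH; use Imp.prems in auto)+
  then show ?case by simp
qed (auto intro: tsub_cong)

lemma fsub_id [simp]: "fsub Var (\<lambda>i. i) p = p"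
proof -
  have *: "case_nat (Var 0) (\<lambda>i. Var (Suc i)) = Var" "case_nat 0 Suc = (\<lambda>i. i)"
    by (auto simp: fun_eq_iff split: nat.split)
  show ?thesis by (induction p) (auto simp: *)
qed

lemma fsub_closed: "boundN p = 0 \<Longrightarrow> boundS p = 0 \<Longrightarrow> fsub s r p = p"
  using fsub_cong[of p s Var r "\<lambda>i. i"] by simp

lemma fsub_instN: "fsub s r (instN t p) = instN (tsub s t) (fsub (case_nat (Var 0) (\<lambda>i. lift_tm (s i))) r p)"
  unfolding instN_def fsub_fsub by (rule fsub_cong) (auto simp: tsub_tsub split: nat.split)

lemma fsub_instS: "fsub s r (instS X p) = instS (r X) (fsub s (case_nat 0 (\<lambda>i. Suc (r i))) p)"
  unfolding instS_def fsub_fsub by (rule fsub_cong) (auto split: nat.split)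

lemma fsub_liftN: "fsub (case_nat (Var 0) (\<lambda>i. lift_tm (s i))) r (liftN p) = liftN (fsub s r p)"
  unfolding liftN_def fsub_fsub by (rule fsub_cong) auto

lemma fsub_liftS: "fsub s (case_nat 0 (\<lambda>i. Suc (r i))) (liftS p) = liftS (fsub s r p)"
  unfolding liftS_def fsub_fsub by (rule fsub_cong) auto

text \<open>The form in which the quantifier case of the truth lemma arises: instantiating the body
  of a substituted quantifier extends the substitution by the instance.\<close>

lemma instN_fsub: "instN t (fsub (case_nat (Var 0) (\<lambda>i. lift_tm (s i))) r p) = fsub (case_nat t s) r p"
  unfolding instN_def fsub_fsub by (rule fsub_cong) (auto simp: tsub_tsub split: nat.split)

lemma instS_fsub: "instS X (fsub s (case_nat 0 (\<lambda>i. Suc (r i))) p) = fsub s (case_nat X r) p"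
  unfolding instS_def fsub_fsub by (rule fsub_cong) (auto split: nat.split)

section \<open>Structural properties of derivability\<close>

lemma derives_fsub: "\<Gamma> \<turnstile> p \<Longrightarrow> fsub s r ` \<Gamma> \<turnstile> fsub s r p"
proof (induction arbitrary: s r rule: derives.induct)
  case (ImpI p \<Gamma> q)
  then show ?case by (auto intro: derives.ImpI)
next
  case (Contr p \<Gamma>)
  from Contr.IH[of s r] show ?case by (auto intro: derives.Contr)
next
  case (AllNI \<Gamma> p)
  let ?s = "case_nat (Var 0) (\<lambda>i. lift_tm (s i))"
  have "fsub ?s r ` liftN ` \<Gamma> = liftN ` fsub s r ` \<Gamma>"
    by (auto simp: fsub_liftN image_iff)
  with AllNI.IH[of ?s r] show ?case by (auto intro: derives.AllNI)
next
  case (AllSI \<Gamma> p)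
  let ?r = "case_nat 0 (\<lambda>i. Suc (r i))"
  have "fsub s ?r ` liftS ` \<Gamma> = liftS ` fsub s r ` \<Gamma>"
    by (auto simp: fsub_liftS image_iff)
  with AllSI.IH[of s ?r] show ?case by (auto intro: derives.AllSI)
next
  case (AllNE \<Gamma> p t)
  from derives.AllNE[OF AllNE.IH[of s r, simplified]] show ?case
    by (simp add: fsub_instN)
next
  case (AllSE \<Gamma> p X)
  from derives.AllSE[OF AllSE.IH[of s r, simplified]] show ?case
    by (simp add: fsub_instS)
next
  case (ImpE \<Gamma> p q)
  from ImpE.IH[of s r] show ?case by (auto intro: derives.ImpE)
next
  case (EqSubst \<Gamma> t u p)
  then show ?case
    using derives.EqSubst[OF EqSubst.IH(1)[of s r, simplified]] by (simp add: fsub_instN)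
qed (auto intro: derives.intros)

lemma derives_mono: "\<Gamma> \<turnstile> p \<Longrightarrow> \<Gamma> \<subseteq> \<Delta> \<Longrightarrow> \<Delta> \<turnstile> p"
proof (induction arbitrary: \<Delta> rule: derives.induct)
  case (ImpI p \<Gamma> q)
  then show ?case by (metis derives.ImpI insert_mono)
next
  case (Contr p \<Gamma>)
  then show ?case by (metis derives.Contr insert_mono)
next
  case (AllNI \<Gamma> p)
  then show ?case by (metis derives.AllNI image_mono)
next
  case (AllSI \<Gamma> p)
  then show ?case by (metis derives.AllSI image_mono)
qed (blast intro: derives.intros)+

lemma derives_compact: "\<Gamma> \<turnstile> p \<Longrightarrow> \<exists>\<Delta>\<subseteq>\<Gamma>. finite \<Delta> \<and> \<Delta> \<turnstile> p"
proof (induction rule: derives.induct)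
  case (Assm p \<Gamma>)
  then show ?case by (intro exI[of _ "{p}"]) (auto intro: derives.Assm)
next
  case (ImpI p \<Gamma> q)
  then obtain \<Delta> where \<Delta>: "\<Delta> \<subseteq> insert p \<Gamma>" "finite \<Delta>" "\<Delta> \<turnstile> q" by auto
  moreover have "\<Delta> - {p} \<turnstile> Imp p q"
    by (rule derives.ImpI, rule derives_mono[OF \<Delta>(3)]) (use \<Delta> in blast)
  ultimately show ?case by (intro exI[of _ "\<Delta> - {p}"]) blast
next
  case (ImpE \<Gamma> p q)
  then obtain \<Delta> \<Delta>' where "\<Delta> \<subseteq> \<Gamma>" "finite \<Delta>" "\<Delta> \<turnstile> Imp p q" "\<Delta>' \<subseteq> \<Gamma>" "finite \<Delta>'" "\<Delta>' \<turnstile> p" by auto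
  then show ?case
    by (intro exI[of _ "\<Delta> \<union> \<Delta>'"]) (auto intro: derives.ImpE derives_mono)
next
  case (Contr p \<Gamma>)
  then obtain \<Delta> where \<Delta>: "\<Delta> \<subseteq> insert (Neg p) \<Gamma>" "finite \<Delta>" "\<Delta> \<turnstile> Fls" by auto
  moreover have "\<Delta> - {Neg p} \<turnstile> p"
    by (rule derives.Contr, rule derives_mono[OF \<Delta>(3)]) (use \<Delta> in blast)
  ultimately show ?case by (intro exI[of _ "\<Delta> - {Neg p}"]) blast
next
  case (AllNI \<Gamma> p)
  then obtain \<Delta> where "\<Delta> \<subseteq> liftN ` \<Gamma>" "finite \<Delta>" "\<Delta> \<turnstile> p" by auto
  then show ?case by (metis derives.AllNI finite_subset_image)
next
  case (AllSI \<Gamma> p)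
  then obtain \<Delta> where "\<Delta> \<subseteq> liftS ` \<Gamma>" "finite \<Delta>" "\<Delta> \<turnstile> p" by auto
  then show ?case by (metis derives.AllSI finite_subset_image)
next
  case (EqRefl \<Gamma> t)
  then show ?case by (intro exI[of _ "{}"]) (auto intro: derives.EqRefl)
next
  case (EqSubst \<Gamma> t u p)
  then obtain \<Delta> \<Delta>' where "\<Delta> \<subseteq> \<Gamma>" "finite \<Delta>" "\<Delta> \<turnstile> Eq t u" "\<Delta>' \<subseteq> \<Gamma>" "finite \<Delta>'" "\<Delta>' \<turnstile> instN t p" by auto
  then show ?case
    by (intro exI[of _ "\<Delta> \<union> \<Delta>'"]) (auto intro: derives.EqSubst derives_mono)
qed (blast intro: derives.intros)+

lemma derives_cut: "insert p \<Gamma> \<turnstile> q \<Longrightarrow> \<Gamma> \<turnstile> p \<Longrightarrow> \<Gamma> \<turnstile> q"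
  by (blast intro: derives.intros)

lemma derives_Fls: "\<Gamma> \<turnstile> Fls \<Longrightarrow> \<Gamma> \<turnstile> p"
  by (rule derives.Contr) (auto intro: derives_mono)

text \<open>The rule \<open>AllNI\<close> shifts the context where a calculus with named variables
  would ask for a fresh one. The fresh form is needed for Henkin witnesses and is recovered by a
  renaming of the derivation.\<close>

lemma derives_AllNI_fresh:
  assumes "\<Gamma> \<turnstile> instN (Var y) q" and "\<And>p. p \<in> \<Gamma> \<Longrightarrow> boundN p \<le> y" and "boundN q \<le> Suc y"
  shows "\<Gamma> \<turnstile> AllN q"
proof -
  \<comment> \<open>The renaming sends y to 0 and shifts everything else: on formulas without y it
    is \<open>liftN\<close>, and it undoes the instantiation by y because the body has no index
    above y.\<close>
  define s where "s = (\<lambda>i. if i = y then Var 0 else Var (Suc i))"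
  have "fsub s (\<lambda>i. i) p = liftN p" if "p \<in> \<Gamma>" for p
    unfolding liftN_def by (rule fsub_cong) (use assms(2)[OF that] in \<open>auto simp: s_def\<close>)
  then have "fsub s (\<lambda>i. i) ` \<Gamma> = liftN ` \<Gamma>" by (auto simp: image_iff)
  moreover have "fsub s (\<lambda>i. i) (instN (Var y) q) = fsub Var (\<lambda>i. i) q"
    unfolding instN_def fsub_fsub by (rule fsub_cong) (use assms(3) in \<open>auto simp: s_def split: nat.split\<close>)
  ultimately have "liftN ` \<Gamma> \<turnstile> q" using derives_fsub[OF assms(1), of s "\<lambda>i. i"] by simp
  then show ?thesis by (rule derives.AllNI)
qed

lemma derives_AllSI_fresh:
  assumes "\<Gamma> \<turnstile> instS y q" and "\<And>p. p \<in> \<Gamma> \<Longrightarrow> boundS p \<le> y" and "boundS q \<le> Suc y"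
  shows "\<Gamma> \<turnstile> AllS q"
proof -
  define r where "r = (\<lambda>i. if i = y then 0 else Suc i)"
  have "fsub Var r p = liftS p" if "p \<in> \<Gamma>" for p
    unfolding liftS_def by (rule fsub_cong) (use assms(2)[OF that] in \<open>auto simp: r_def\<close>)
  then have "fsub Var r ` \<Gamma> = liftS ` \<Gamma>" by (auto simp: image_iff)
  moreover have "fsub Var r (instS y q) = fsub Var (\<lambda>i. i) q"
    unfolding instS_def fsub_fsub by (rule fsub_cong) (use assms(3) in \<open>auto simp: r_def split: nat.split\<close>)
  ultimately have "liftS ` \<Gamma> \<turnstile> q" using derives_fsub[OF assms(1), of Var r] by simp
  then show ?thesis by (rule derives.AllSI)
qed


section \<open>Henkin theories\<close>

instance tm :: countable by countable_datatype
instance fm :: countable by countable_datatype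

definition consistent :: "fm set \<Rightarrow> bool" where
  "consistent \<Gamma> \<longleftrightarrow> \<not> \<Gamma> \<turnstile> Fls"

definition henkin :: "fm set \<Rightarrow> bool" where
  "henkin H \<longleftrightarrow> consistent H \<and> (\<forall>p. p \<in> H \<or> Neg p \<in> H) \<and>
     (\<forall>q. (\<forall>t. instN t q \<in> H) \<longrightarrow> AllN q \<in> H) \<and> (\<forall>q. (\<forall>X. instS X q \<in> H) \<longrightarrow> AllS q \<in> H)"

lemma consistent_insert_Neg: "consistent \<Gamma> \<Longrightarrow> consistent (insert p \<Gamma>) \<or> consistent (insert (Neg p) \<Gamma>)"
  unfolding consistent_def by (metis derives.Contr derives_cut)

text \<open>Variables serve as Henkin witnesses, so the language stays the same. Only a negated
  universal formula calls for a counterexample; for any other p the set is empty.\<close>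

definition witnesses :: "nat \<Rightarrow> fm \<Rightarrow> fm set" where
  "witnesses y p = {Neg (instN (Var y) q) | q. p = Neg (AllN q)} \<union> {Neg (instS y q) | q. p = Neg (AllS q)}"

lemma witnesses_simps:
  "witnesses y (Neg (AllN q)) = {Neg (instN (Var y) q)}"
  "witnesses y (Neg (AllS q)) = {Neg (instS y q)}"
  by (auto simp: witnesses_def)

lemma consistent_witnesses:
  assumes "consistent \<Gamma>" "p \<in> \<Gamma>" "\<And>q. q \<in> \<Gamma> \<Longrightarrow> boundN q \<le> y \<and> boundS q \<le> y"
  shows "consistent (\<Gamma> \<union> witnesses y p)"
proof -
  consider q where "p = Neg (AllN q)" | q where "p = Neg (AllS q)" | "witnesses y p = {}"
    by (auto simp: witnesses_def)
  then show ?thesis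
  proof cases
    case 1
    have "\<not> insert (Neg (instN (Var y) q)) \<Gamma> \<turnstile> Fls"
    proof
      assume "insert (Neg (instN (Var y) q)) \<Gamma> \<turnstile> Fls"
      then have "\<Gamma> \<turnstile> AllN q"
        by (rule derives_AllNI_fresh[OF derives.Contr]) (use assms(2) assms(3)[OF assms(2)] assms(3) 1 in auto)
      moreover have "\<Gamma> \<turnstile> Neg (AllN q)" using assms(2) 1 by (auto intro: derives.Assm)
      ultimately show False using assms(1) by (auto simp: consistent_def intro: derives.ImpE)
    qed
    then show ?thesis by (simp add: 1 witnesses_simps consistent_def)
  next
    case 2
    have "\<not> insert (Neg (instS y q)) \<Gamma> \<turnstile> Fls"
    proof
      assume "insert (Neg (instS y q)) \<Gamma> \<turnstile> Fls"
      then have "\<Gamma> \<turnstile> AllS q"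
        by (rule derives_AllSI_fresh[OF derives.Contr]) (use assms(2) assms(3)[OF assms(2)] assms(3) 2 in auto)
      moreover have "\<Gamma> \<turnstile> Neg (AllS q)" using assms(2) 2 by (auto intro: derives.Assm)
      ultimately show False using assms(1) by (auto simp: consistent_def intro: derives.ImpE)
    qed
    then show ?thesis by (simp add: 2 witnesses_simps consistent_def)
  qed (use assms(1) in simp)
qed

fun henkin_chain :: "fm set \<Rightarrow> nat \<Rightarrow> fm set" where
  "henkin_chain T 0 = {}"
| "henkin_chain T (Suc n) = (let A = insert (from_nat n) (henkin_chain T n) in
     if consistent (T \<union> A) then A \<union> witnesses (Max (boundN ` A \<union> boundS ` A)) (from_nat n)
     else henkin_chain T n)"

lemma finite_henkin_chain: "finite (henkin_chain T n)"
proof (induction n)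
  case (Suc n)
  have "finite (witnesses y p)" for y p
    by (cases "\<exists>q. p = Neg (AllN q) \<or> p = Neg (AllS q)") (auto simp: witnesses_def)
  with Suc show ?case by (auto simp: Let_def)
qed simp

lemma consistent_henkin_chain:
  assumes "consistent T" "\<And>p. p \<in> T \<Longrightarrow> boundN p = 0 \<and> boundS p = 0"
  shows "consistent (T \<union> henkin_chain T n)"
proof (induction n)
  case 0
  then show ?case using assms by simp
next
  case (Suc n)
  let ?A = "insert (from_nat n) (henkin_chain T n)"
  let ?B = "boundN ` ?A \<union> boundS ` ?A"
  have fin: "finite ?B" using finite_henkin_chain[of T n] by blast
  show ?case
  proof (cases "consistent (T \<union> ?A)")
    case True
    then have "consistent (T \<union> ?A \<union> witnesses (Max ?B) (from_nat n))"
    proof (rule consistent_witnesses)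
      show "boundN q \<le> Max ?B \<and> boundS q \<le> Max ?B" if "q \<in> T \<union> ?A" for q
      proof (cases "q \<in> T")
        case False
        with that have "boundN q \<in> ?B" "boundS q \<in> ?B" by auto
        then show ?thesis using Max_ge[OF fin] by blast
      qed (use assms(2) in simp)
    qed simp
    with True show ?thesis by (simp add: Let_def Un_assoc)
  qed (use Suc in simp)
qed

theorem henkin_extension:
  assumes "consistent T" "\<And>p. p \<in> T \<Longrightarrow> boundN p = 0 \<and> boundS p = 0"
  obtains H where "T \<subseteq> H" "henkin H"
proof -
  define H where "H = T \<union> (\<Union>n. henkin_chain T n)"
  have step: "henkin_chain T n \<subseteq> henkin_chain T (Suc n)" for n by (auto simp: Let_def)
  then have mono: "henkin_chain T m \<subseteq> henkin_chain T n" if "m \<le> n" for m n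
    using lift_Suc_mono_le[of "henkin_chain T"] that by blast
  have cons: "consistent H"
  proof (rule ccontr)
    assume "\<not> consistent H"
    then obtain \<Delta> where \<Delta>: "\<Delta> \<subseteq> H" "finite \<Delta>" "\<Delta> \<turnstile> Fls"
      unfolding consistent_def using derives_compact by blast
    have "\<exists>n. \<Delta> \<subseteq> T \<union> henkin_chain T n" using \<Delta>(2,1)
    proof (induction \<Delta> rule: finite_induct)
      case (insert p \<Delta>)
      then obtain n m where "\<Delta> \<subseteq> T \<union> henkin_chain T n" "p \<in> T \<union> henkin_chain T m"
        by (auto simp: H_def)
      with mono[of n "max n m"] mono[of m "max n m"] show ?case
        by (intro exI[of _ "max n m"]) auto
    qed simp
    with \<Delta>(3) consistent_henkin_chain[OF assms] show False
      by (auto simp: consistent_def dest: derives_mono)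
  qed
  \<comment> \<open>Consistency with the limit implies consistency with the earlier stage at which p
    was considered, so p and its witness were put in there.\<close>
  have added: "p \<in> H \<and> witnesses (Max (boundN ` insert p A \<union> boundS ` insert p A)) p \<subseteq> H"
    if "consistent (insert p H)" "A = henkin_chain T (to_nat p)" for p A
  proof -
    have "consistent (T \<union> insert p A)"
      using that by (auto simp: consistent_def H_def dest: derives_mono[of _ _ "insert p H"])
    then have "insert p (witnesses (Max (boundN ` insert p A \<union> boundS ` insert p A)) p) \<subseteq> henkin_chain T (Suc (to_nat p))"
      unfolding that(2) by (auto simp add: Let_def)
    then show ?thesis unfolding H_def by blast
  qed
  have compl: "p \<in> H \<or> Neg p \<in> H" for p
    using consistent_insert_Neg[OF cons, of p] added by blast
  have notboth: "\<not> (p \<in> H \<and> Neg p \<in> H)" for p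
    using cons unfolding consistent_def by (meson derives.Assm derives.ImpE)
  have "AllN q \<in> H" if "\<forall>t. instN t q \<in> H" for q
  proof (rule ccontr)
    assume "AllN q \<notin> H"
    then have "Neg (AllN q) \<in> H" using compl by blast
    then have "consistent (insert (Neg (AllN q)) H)" using cons by (simp add: insert_absorb)
    from added[OF this refl] obtain y where "Neg (instN (Var y) q) \<in> H" by (auto simp: witnesses_simps)
    with that notboth show False by blast
  qed
  moreover have "AllS q \<in> H" if "\<forall>X. instS X q \<in> H" for q
  proof (rule ccontr)
    assume "AllS q \<notin> H"
    then have "Neg (AllS q) \<in> H" using compl by blast
    then have "consistent (insert (Neg (AllS q)) H)" using cons by (simp add: insert_absorb)
    from added[OF this refl] obtain y where "Neg (instS y q) \<in> H" by (auto simp: witnesses_simps)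
    with that notboth show False by blast
  qed
  ultimately have "henkin H" using cons compl by (simp add: henkin_def)
  moreover have "T \<subseteq> H" by (simp add: H_def)
  ultimately show ?thesis using that by blast
qed

lemma henkin_closed:
  assumes "henkin H" "H \<turnstile> p"
  shows "p \<in> H"
  using assms unfolding henkin_def consistent_def by (meson derives.Assm derives.ImpE)

section \<open>Truth conditions inside a Henkin theory\<close>

lemma henkin_Imp: "henkin H \<Longrightarrow> Imp p q \<in> H \<longleftrightarrow> (p \<in> H \<longrightarrow> q \<in> H)"
proof
  assume H: "henkin H" and *: "p \<in> H \<longrightarrow> q \<in> H"
  show "Imp p q \<in> H"
  proof (cases "p \<in> H")
    case True
    with * have "insert p H \<turnstile> q" by (auto intro: derives.Assm)
    then show ?thesis by (intro henkin_closed[OF H] derives.ImpI)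
  next
    case False
    then have "Neg p \<in> H" using H by (auto simp: henkin_def)
    then have "insert p H \<turnstile> Fls" by (meson derives.Assm derives.ImpE insertCI)
    then show ?thesis by (intro henkin_closed[OF H] derives.ImpI) (rule derives_Fls)
  qed
qed (meson derives.Assm derives.ImpE henkin_closed)

lemma henkin_Fls: "henkin H \<Longrightarrow> Fls \<notin> H"
  by (auto simp: henkin_def consistent_def intro: derives.Assm)

lemma henkin_AllN: "henkin H \<Longrightarrow> AllN q \<in> H \<longleftrightarrow> (\<forall>t. instN t q \<in> H)"
  by (metis derives.AllNE derives.Assm henkin_closed henkin_def)

lemma henkin_AllS: "henkin H \<Longrightarrow> AllS q \<in> H \<longleftrightarrow> (\<forall>X. instS X q \<in> H)"
  by (metis derives.AllSE derives.Assm henkin_closed henkin_def)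

lemma henkin_Eq_refl: "henkin H \<Longrightarrow> Eq t t \<in> H"
  by (auto intro: henkin_closed derives.EqRefl)

text \<open>The substitution is displayed so that simplification can evaluate it. Each congruence
  below picks a formula with \<open>Var 0\<close> at the position to be rewritten and lifted terms
  elsewhere.\<close>

lemma henkin_Eq_subst: "henkin H \<Longrightarrow> Eq t u \<in> H \<Longrightarrow> fsub (case_nat t Var) (\<lambda>i. i) p \<in> H \<Longrightarrow> fsub (case_nat u Var) (\<lambda>i. i) p \<in> H"
  using derives.EqSubst[of H t u p] by (auto simp: instN_def intro: henkin_closed derives.Assm)

lemma tsub_case_nat_lift [simp]: "tsub (case_nat t Var) (lift_tm u) = u"
  by (simp add: tsub_tsub)

lemma henkin_Eq_sym: "henkin H \<Longrightarrow> Eq t u \<in> H \<Longrightarrow> Eq u t \<in> H"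
  using henkin_Eq_subst[of H t u "Eq (Var 0) (lift_tm t)"] by (simp add: henkin_Eq_refl)

lemma henkin_Eq_trans: "henkin H \<Longrightarrow> Eq t u \<in> H \<Longrightarrow> Eq u v \<in> H \<Longrightarrow> Eq t v \<in> H"
  using henkin_Eq_subst[of H u v "Eq (lift_tm t) (Var 0)"] by simp

lemma henkin_Eq_Plus: "henkin H \<Longrightarrow> Eq t t' \<in> H \<Longrightarrow> Eq u u' \<in> H \<Longrightarrow> Eq (Plus t u) (Plus t' u') \<in> H"
  using henkin_Eq_subst[of H t t' "Eq (lift_tm (Plus t u)) (Plus (Var 0) (lift_tm u))"]
    henkin_Eq_subst[of H u u' "Eq (lift_tm (Plus t u)) (Plus (lift_tm t') (Var 0))"]
  by (simp add: henkin_Eq_refl)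

lemma henkin_Eq_Times: "henkin H \<Longrightarrow> Eq t t' \<in> H \<Longrightarrow> Eq u u' \<in> H \<Longrightarrow> Eq (Times t u) (Times t' u') \<in> H"
  using henkin_Eq_subst[of H t t' "Eq (lift_tm (Times t u)) (Times (Var 0) (lift_tm u))"]
    henkin_Eq_subst[of H u u' "Eq (lift_tm (Times t u)) (Times (lift_tm t') (Var 0))"]
  by (simp add: henkin_Eq_refl)

lemma henkin_Less_cong: "henkin H \<Longrightarrow> Eq t t' \<in> H \<Longrightarrow> Eq u u' \<in> H \<Longrightarrow> Less t u \<in> H \<Longrightarrow> Less t' u' \<in> H"
  using henkin_Eq_subst[of H t t' "Less (Var 0) (lift_tm u)"]
    henkin_Eq_subst[of H u u' "Less (lift_tm t') (Var 0)"] by simp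

lemma henkin_Mem_cong: "henkin H \<Longrightarrow> Eq t t' \<in> H \<Longrightarrow> Mem t X \<in> H \<Longrightarrow> Mem t' X \<in> H"
  using henkin_Eq_subst[of H t t' "Mem (Var 0) X"] by simp

section \<open>Semantics\<close>

primrec tval :: "(nat \<Rightarrow> 'a::{zero,one,plus,times}) \<Rightarrow> tm \<Rightarrow> 'a" where
  "tval e (Var i) = e i"
| "tval e Zero = 0"
| "tval e One = 1"
| "tval e (Plus t u) = tval e t + tval e u"
| "tval e (Times t u) = tval e t * tval e u"

primrec holds :: "'a::{zero,one,plus,times,ord} set set \<Rightarrow> (nat \<Rightarrow> 'a) \<Rightarrow> (nat \<Rightarrow> 'a set) \<Rightarrow> fm \<Rightarrow> bool" where
  "holds S e r (Eq t u) \<longleftrightarrow> tval e t = tval e u"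
| "holds S e r (Less t u) \<longleftrightarrow> tval e t < tval e u"
| "holds S e r (Mem t X) \<longleftrightarrow> tval e t \<in> r X"
| "holds S e r Fls \<longleftrightarrow> False"
| "holds S e r (Imp p q) \<longleftrightarrow> (holds S e r p \<longrightarrow> holds S e r q)"
| "holds S e r (AllN p) \<longleftrightarrow> (\<forall>x. holds S (case_nat x e) r p)"
| "holds S e r (AllS p) \<longleftrightarrow> (\<forall>X\<in>S. holds S e (case_nat X r) p)"

lemma tval_tsub: "tval e (tsub s t) = tval (\<lambda>i. tval e (s i)) t"
  by (induction t) auto

lemma holds_fsub: "holds S e r (fsub s r' p) \<longleftrightarrow> holds S (\<lambda>i. tval e (s i)) (\<lambda>i. r (r' i)) p"
proof (induction p arbitrary: e r s r')
  case (AllN p)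
  have "(\<lambda>i. tval (case_nat x e) (case_nat (Var 0) (\<lambda>i. lift_tm (s i)) i)) = case_nat x (\<lambda>i. tval e (s i))" for x
    by (auto simp: fun_eq_iff tval_tsub split: nat.split)
  with AllN show ?case by simp
next
  case (AllS p)
  have "(\<lambda>i. case_nat X r (case_nat 0 (\<lambda>i. Suc (r' i)) i)) = case_nat X (\<lambda>i. r (r' i))" for X
    by (auto simp: fun_eq_iff split: nat.split)
  with AllS show ?case by simp
qed (auto simp: tval_tsub)

lemma holds_instN [simp]: "holds S e r (instN t p) \<longleftrightarrow> holds S (case_nat (tval e t) e) r p"
proof -
  have "(\<lambda>i. tval e (case_nat t Var i)) = case_nat (tval e t) e"
    by (auto simp: fun_eq_iff split: nat.split)
  then show ?thesis by (simp add: instN_def holds_fsub)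
qed

lemma holds_instS [simp]: "holds S e r (instS X p) \<longleftrightarrow> holds S e (case_nat (r X) r) p"
proof -
  have "(\<lambda>i. r (case_nat X (\<lambda>i. i) i)) = case_nat (r X) r"
    by (auto simp: fun_eq_iff split: nat.split)
  then show ?thesis by (simp add: instS_def holds_fsub)
qed

lemma holds_liftN [simp]: "holds S (case_nat x e) r (liftN p) \<longleftrightarrow> holds S e r p"
  by (simp add: liftN_def holds_fsub)

lemma holds_liftS [simp]: "holds S e (case_nat X r) (liftS p) \<longleftrightarrow> holds S e r p"
  by (simp add: liftS_def holds_fsub)

lemma range_case_nat: "X \<in> S \<Longrightarrow> range r \<subseteq> S \<Longrightarrow> range (case_nat X r) \<subseteq> S"
  by (fastforce split: nat.split)

text \<open>Set quantifiers range over S only, while \<open>AllSE\<close> instantiates them by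
  arbitrary set variables; hence all values of r must lie in S.\<close>

theorem soundness:
  "\<Gamma> \<turnstile> p \<Longrightarrow> range r \<subseteq> S \<Longrightarrow> (\<And>q. q \<in> \<Gamma> \<Longrightarrow> holds S e r q) \<Longrightarrow> holds S e r p"
proof (induction arbitrary: e r rule: derives.induct)
  case (ImpI p \<Gamma> q)
  have "holds S e r q" if "holds S e r p"
    by (rule ImpI.IH[OF ImpI.prems(1)]) (use ImpI.prems(2) that in blast)
  then show ?case by simp
next
  case (Contr p \<Gamma>)
  have "holds S e r Fls" if "holds S e r (Neg p)"
    by (rule Contr.IH[OF Contr.prems(1)]) (use Contr.prems(2) that in blast)
  then show ?case by auto
next
  case (AllNI \<Gamma> p)
  have "holds S (case_nat x e) r p" for x
    by (rule AllNI.IH[OF AllNI.prems(1)]) (use AllNI.prems(2) in auto)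
  then show ?case by simp
next
  case (AllNE \<Gamma> p t)
  from AllNE.IH[OF AllNE.prems] show ?case by simp
next
  case (AllSI \<Gamma> p)
  have "holds S e (case_nat X r) p" if "X \<in> S" for X
    by (rule AllSI.IH) (use that AllSI.prems range_case_nat[of X S r] in auto)
  then show ?case by simp
next
  case (AllSE \<Gamma> p X)
  from AllSE.IH[OF AllSE.prems] AllSE.prems show ?case by auto
next
  case (EqSubst \<Gamma> t u p)
  from EqSubst.IH[OF EqSubst.prems] show ?case by simp
qed auto

section \<open>Universal closures, validity and the consistency of RCA0\<close>

lemma holds_funpow_AllN: "(\<forall>e. holds S e r ((AllN ^^ n) p)) \<longleftrightarrow> (\<forall>e. holds S e r p)"
proof (induction n)
  case (Suc n)
  have "(\<forall>e x. holds S (case_nat x e) r q) \<longleftrightarrow> (\<forall>e. holds S e r q)" for q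
  proof -
    have "e = case_nat (e 0) (\<lambda>i. e (Suc i))" for e :: "nat \<Rightarrow> 'a" by (auto simp: fun_eq_iff split: nat.split)
    then show ?thesis by metis
  qed
  with Suc show ?case by simp
qed simp

lemma holds_funpow_AllS:
  "(\<forall>r. range r \<subseteq> S \<longrightarrow> holds S e r ((AllS ^^ n) p)) \<longleftrightarrow> (\<forall>r. range r \<subseteq> S \<longrightarrow> holds S e r p)"
proof (induction n)
  case (Suc n)
  have "(\<forall>r. range r \<subseteq> S \<longrightarrow> (\<forall>X\<in>S. holds S e (case_nat X r) q)) \<longleftrightarrow> (\<forall>r. range r \<subseteq> S \<longrightarrow> holds S e r q)" for q
  proof -
    have "r = case_nat (r 0) (\<lambda>i. r (Suc i))" for r :: "nat \<Rightarrow> 'a set" by (auto simp: fun_eq_iff split: nat.split)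
    then have 1: "holds S e r q" if "range r \<subseteq> S" "\<forall>r. range r \<subseteq> S \<longrightarrow> (\<forall>X\<in>S. holds S e (case_nat X r) q)" for r
      using that(1) that(2)[rule_format, of "\<lambda>i. r (Suc i)" "r 0"] by auto
    have 2: "holds S e (case_nat X r) q" if "range r \<subseteq> S" "X \<in> S" "\<forall>r. range r \<subseteq> S \<longrightarrow> holds S e r q" for r X
      using that(3)[rule_format, OF range_case_nat[OF that(2,1)]] .
    show ?thesis by (intro iffI allI impI ballI) (rule 1, assumption+, rule 2)
  qed
  with Suc show ?case by simp
qed simp

definition valid :: "'a::{zero,one,plus,times,ord} set set \<Rightarrow> fm \<Rightarrow> bool" where
  "valid S p \<longleftrightarrow> (\<forall>e r. range r \<subseteq> S \<longrightarrow> holds S e r p)"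

lemma valid_universal_closure [simp]: "valid S (universal_closure p) \<longleftrightarrow> valid S p"
proof -
  have "valid S (universal_closure p) \<longleftrightarrow> (\<forall>r. range r \<subseteq> S \<longrightarrow> (\<forall>e. holds S e r ((AllS ^^ boundS p) p)))"
    unfolding valid_def universal_closure_def
    using holds_funpow_AllN[of S _ "boundN p" "(AllS ^^ boundS p) p"] by meson
  also have "\<dots> \<longleftrightarrow> valid S p"
    using holds_funpow_AllS[of S _ "boundS p" p] by (auto simp: valid_def)
  finally show ?thesis .
qed

lemma valid_induction_axiom:
  "valid S (induction_axiom p) \<longleftrightarrow> (\<forall>e r. range r \<subseteq> S \<longrightarrow> holds S (case_nat 0 e) r p \<longrightarrow>
     (\<forall>x. holds S (case_nat x e) r p \<longrightarrow> holds S (case_nat (x + 1) e) r p) \<longrightarrow> (\<forall>x. holds S (case_nat x e) r p))"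
proof -
  have *: "(\<lambda>i. tval (case_nat x e) (case_nat (Plus (Var 0) One) (\<lambda>i. Var (Suc i)) i)) = case_nat (x + 1) e"
    for x and e :: "nat \<Rightarrow> 'a" by (auto simp: fun_eq_iff split: nat.split)
  show ?thesis
    unfolding induction_axiom_def valid_universal_closure
    by (simp add: valid_def holds_fsub * imp_conjL)
qed

lemma valid_comprehension_axiom:
  "valid S (comprehension_axiom p q) \<longleftrightarrow> (\<forall>e r. range r \<subseteq> S \<longrightarrow>
     (\<forall>x. holds S (case_nat x e) r p \<longleftrightarrow> holds S (case_nat x e) r q) \<longrightarrow>
     (\<exists>X\<in>S. \<forall>x. x \<in> X \<longleftrightarrow> holds S (case_nat x e) r p))"
  unfolding comprehension_axiom_def valid_universal_closure
  by (simp add: valid_def iff_conv_conj_imp)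

text \<open>The standard numbers with all sets. This model yields the consistency of RCA0, which
  guarantees a Henkin theory even if the goal has a derivation.\<close>

lemma valid_RCA0_nat: "p \<in> RCA0 \<Longrightarrow> valid (UNIV :: nat set set) p"
  unfolding RCA0_def
proof (elim UnE)
  show "p \<in> basic_axioms \<Longrightarrow> valid (UNIV :: nat set set) p"
    unfolding basic_axioms_def by (elim imageE insertE emptyE; simp; auto simp: valid_def)
next
  have "valid (UNIV :: nat set set) (induction_axiom q)" for q
    unfolding valid_induction_axiom
  proof (intro allI impI)
    fix e :: "nat \<Rightarrow> nat" and r x
    assume "holds UNIV (case_nat 0 e) r q" "\<forall>x. holds UNIV (case_nat x e) r q \<longrightarrow> holds UNIV (case_nat (x + 1) e) r q"
    then show "holds UNIV (case_nat x e) r q" by (induction x) auto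
  qed
  then show "p \<in> {induction_axiom p | p. Sigma01 p} \<Longrightarrow> valid (UNIV :: nat set set) p" by blast
next
  have "valid (UNIV :: nat set set) (comprehension_axiom q q')" for q q'
    unfolding valid_comprehension_axiom
  proof (intro allI impI)
    fix e :: "nat \<Rightarrow> nat" and r
    show "\<exists>X\<in>UNIV. \<forall>x. x \<in> X \<longleftrightarrow> holds UNIV (case_nat x e) r q"
      by (rule bexI[of _ "{x. holds UNIV (case_nat x e) r q}"]) simp_all
  qed
  then show "p \<in> {comprehension_axiom p q | p q. Sigma01 p \<and> Pi01 q} \<Longrightarrow> valid (UNIV :: nat set set) p" by blast
qed

lemma consistent_RCA0: "consistent RCA0"
  unfolding consistent_def
  using soundness[of RCA0 Fls "\<lambda>_. {}" "UNIV :: nat set set" "\<lambda>_. 0"] valid_RCA0_nat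
  by (auto simp: valid_def)

lemma boundS_funpow_AllS: "boundS ((AllS ^^ n) p) = boundS p - n" "boundN ((AllS ^^ n) p) = boundN p"
  by (induction n) auto

lemma boundN_funpow_AllN: "boundN ((AllN ^^ n) p) = boundN p - n" "boundS ((AllN ^^ n) p) = boundS p"
  by (induction n) auto

lemma universal_closure_closed [simp]: "boundN (universal_closure p) = 0" "boundS (universal_closure p) = 0"
  by (simp_all add: universal_closure_def boundS_funpow_AllS boundN_funpow_AllN)

lemma RCA0_closed: "p \<in> RCA0 \<Longrightarrow> boundN p = 0 \<and> boundS p = 0"
  by (auto simp: RCA0_def basic_axioms_def induction_axiom_def comprehension_axiom_def)

lemma derives_universal_closure:
  assumes closed: "\<And>q. q \<in> \<Gamma> \<Longrightarrow> boundN q = 0 \<and> boundS q = 0" and "\<Gamma> \<turnstile> universal_closure p"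
  shows "\<Gamma> \<turnstile> p"
proof -
  have img: "fsub s r ` \<Gamma> = \<Gamma>" for s r
    using fsub_closed closed by (auto simp: image_iff)
  \<comment> \<open>Instantiating by \<open>Var 0\<close> directly would identify the indices 0 and
    1 of q, so the formula is shifted first. The context is closed and stays the same under the
    shift.\<close>
  have N: "\<Gamma> \<turnstile> q" if "\<Gamma> \<turnstile> AllN q" for q
  proof -
    have "fsub (case_nat (Var 0) (\<lambda>i. Var (Suc i))) (\<lambda>i. i) q = fsub Var (\<lambda>i. i) q"
      by (rule fsub_cong) (auto split: nat.split)
    moreover have "\<Gamma> \<turnstile> fsub (\<lambda>i. Var (Suc i)) (\<lambda>i. i) (AllN q)"
      using derives_fsub[OF that] by (simp only: img)
    ultimately show ?thesis
      using derives.AllNE[of \<Gamma> _ "Var 0"] by (simp only: fsub.simps(6)) (metis instN_fsub fsub_id)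
  qed
  have S: "\<Gamma> \<turnstile> q" if "\<Gamma> \<turnstile> AllS q" for q
  proof -
    have "fsub Var (case_nat 0 Suc) q = fsub Var (\<lambda>i. i) q"
      by (rule fsub_cong) (auto split: nat.split)
    moreover have "\<Gamma> \<turnstile> fsub Var Suc (AllS q)"
      using derives_fsub[OF that] by (simp only: img)
    ultimately show ?thesis
      using derives.AllSE[of \<Gamma> _ 0] by (simp only: fsub.simps(7)) (metis instS_fsub fsub_id)
  qed
  have NN: "\<Gamma> \<turnstile> (AllN ^^ n) q \<Longrightarrow> \<Gamma> \<turnstile> q" for n q
    by (induction n) (auto dest: N)
  have SS: "\<Gamma> \<turnstile> (AllS ^^ n) q \<Longrightarrow> \<Gamma> \<turnstile> q" for n q
    by (induction n) (auto dest: S)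
  show ?thesis by (rule SS[OF NN[OF assms(2)[unfolded universal_closure_def]]])
qed


section \<open>Definability\<close>

definition glue :: "nat \<Rightarrow> (nat \<Rightarrow> 'a) \<Rightarrow> (nat \<Rightarrow> 'a) \<Rightarrow> nat \<Rightarrow> 'a" where
  "glue n e c = (\<lambda>i. if i < n then e i else c (i - n))"

text \<open>Interleaves two supplies of parameters, so that two formulas with separate parameters
  can be read in one environment.\<close>

definition mix :: "(nat \<Rightarrow> 'b) \<Rightarrow> (nat \<Rightarrow> 'b) \<Rightarrow> nat \<Rightarrow> 'b" where
  "mix a b = (\<lambda>j. if even j then a (j div 2) else b (j div 2))"

text \<open>
  Predicates take an environment of which only finitely many entries matter; \<open>c\<close> and \<open>r\<close> supply
  number and set parameters.
\<close>

definition dterm :: "((nat \<Rightarrow> 'a::{zero,one,plus,times}) \<Rightarrow> 'a) \<Rightarrow> bool" where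
  "dterm t \<longleftrightarrow> (\<exists>u n c. \<forall>e. t e = tval (glue n e c) u)"

definition delta0 :: "'a::{zero,one,plus,times,ord} set set \<Rightarrow> ((nat \<Rightarrow> 'a) \<Rightarrow> bool) \<Rightarrow> bool" where
  "delta0 S P \<longleftrightarrow>
     (\<exists>p n c r. bounded_fm p \<and> range r \<subseteq> S \<and> (\<forall>e. P e \<longleftrightarrow> holds S (glue n e c) r p))"

definition sigma1 :: "'a::{zero,one,plus,times,ord} set set \<Rightarrow> ((nat \<Rightarrow> 'a) \<Rightarrow> bool) \<Rightarrow> bool" where
  "sigma1 S P \<longleftrightarrow> (\<exists>Q. delta0 S Q \<and> (\<forall>e. P e \<longleftrightarrow> (\<exists>x. Q (case_nat x e))))"

lemma mix_simps [simp]: "mix a b (2 * j) = a j" "mix a b (Suc (2 * j)) = b j"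
  by (auto simp: mix_def)

lemma range_mix: "range a \<subseteq> S \<Longrightarrow> range b \<subseteq> S \<Longrightarrow> range (mix a b) \<subseteq> S"
  by (auto simp: mix_def)

text \<open>Two formulas can be combined only if they have the same number of visible variables.
  Raising this number from m to n moves the parameters, which start right after the visible
  variables; f accounts for the interleaving.\<close>

definition ren :: "nat \<Rightarrow> nat \<Rightarrow> (nat \<Rightarrow> nat) \<Rightarrow> nat \<Rightarrow> tm" where
  "ren m n f = (\<lambda>i. if i < m then Var i else Var (n + f (i - m)))"

lemma tval_ren: "m \<le> n \<Longrightarrow> tval (glue n e c) (ren m n f i) = glue m e (\<lambda>j. c (f j)) i"
  by (auto simp: glue_def ren_def)

lemma bounded_fm_fsub: "bounded_fm p \<Longrightarrow> bounded_fm (fsub s r p)"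
proof (induction arbitrary: s r rule: bounded_fm.induct)
  case (6 p t)
  have "tsub (case_nat (Var 0) (\<lambda>i. lift_tm (s i))) (lift_tm t) = lift_tm (tsub s t)"
    by (simp add: tsub_tsub)
  with 6 show ?case by (auto intro!: bounded_fm.intros)
next
  case (7 p t)
  have "tsub (case_nat (Var 0) (\<lambda>i. lift_tm (s i))) (lift_tm t) = lift_tm (tsub s t)"
    by (simp add: tsub_tsub)
  with 7 show ?case by (auto intro!: bounded_fm.intros)
qed (auto intro: bounded_fm.intros)

lemma delta0E:
  assumes "delta0 S P"
  obtains p n c r where "bounded_fm p" "range r \<subseteq> S" "\<forall>e. P e \<longleftrightarrow> holds S (glue n e c) r p"
  using assms unfolding delta0_def by (elim exE conjE)

lemma dtermE:
  assumes "dterm t"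
  obtains u n c where "\<forall>e. t e = tval (glue n e c) u"
  using assms unfolding dterm_def by (elim exE)

lemma delta0_reindex:
  assumes "\<forall>e. P e \<longleftrightarrow> holds S (glue m e (\<lambda>j. c (f j))) (\<lambda>j. r (g j)) p" "m \<le> n"
  shows "P e \<longleftrightarrow> holds S (glue n e c) r (fsub (ren m n f) g p)"
  using assms by (simp add: holds_fsub tval_ren)

lemma dterm_reindex:
  assumes "\<forall>e. t e = tval (glue m e (\<lambda>j. c (f j))) u" "m \<le> n"
  shows "t e = tval (glue n e c) (tsub (ren m n f) u)"
  using assms by (simp add: tval_tsub tval_ren)

lemma dterm_common:
  assumes "dterm t" "dterm u"
  obtains t' u' n c where "\<And>e. t e = tval (glue n e c) t'" "\<And>e. u e = tval (glue n e c) u'"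
proof -
  obtain t' nt ct where t: "\<forall>e. t e = tval (glue nt e ct) t'" using assms(1) by (rule dtermE)
  obtain u' nu cu where u: "\<forall>e. u e = tval (glue nu e cu) u'" using assms(2) by (rule dtermE)
  let ?c = "mix ct cu" and ?n = "max nt nu"
  show ?thesis
    using that[OF dterm_reindex[of t nt ?c "\<lambda>j. 2 * j" t' ?n] dterm_reindex[of u nu ?c "\<lambda>j. Suc (2 * j)" u' ?n]] t u
    by simp
qed

lemma delta0_common:
  assumes "delta0 S P" "delta0 S Q"
  obtains p q n c r where "bounded_fm p" "bounded_fm q" "range r \<subseteq> S"
    "\<And>e. P e \<longleftrightarrow> holds S (glue n e c) r p" "\<And>e. Q e \<longleftrightarrow> holds S (glue n e c) r q"
proof -
  obtain p np cp rp where p: "bounded_fm p" "range rp \<subseteq> S" "\<forall>e. P e \<longleftrightarrow> holds S (glue np e cp) rp p"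
    using assms(1) by (rule delta0E)
  obtain q nq cq rq where q: "bounded_fm q" "range rq \<subseteq> S" "\<forall>e. Q e \<longleftrightarrow> holds S (glue nq e cq) rq q"
    using assms(2) by (rule delta0E)
  let ?c = "mix cp cq" and ?r = "mix rp rq" and ?n = "max np nq"
  show ?thesis
  proof (rule that)
    show "P e \<longleftrightarrow> holds S (glue ?n e ?c) ?r (fsub (ren np ?n (\<lambda>j. 2 * j)) (\<lambda>j. 2 * j) p)" for e
      by (rule delta0_reindex) (use p in simp_all)
    show "Q e \<longleftrightarrow> holds S (glue ?n e ?c) ?r (fsub (ren nq ?n (\<lambda>j. Suc (2 * j))) (\<lambda>j. Suc (2 * j)) q)" for e
      by (rule delta0_reindex) (use q in simp_all)
  qed (use p q in \<open>simp_all add: bounded_fm_fsub range_mix\<close>)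
qed

text \<open>The predicate gets one more visible variable than the term: index 0 is about to be bound
  by a quantifier whose bound is the term.\<close>

lemma delta0_dterm_common:
  assumes "delta0 S P" "dterm u"
  obtains p n c r u' where "bounded_fm p" "range r \<subseteq> S"
    "\<And>e. P e \<longleftrightarrow> holds S (glue (Suc n) e c) r p" "\<And>e. u e = tval (glue n e c) u'"
proof -
  obtain p np cp r where p: "bounded_fm p" "range r \<subseteq> S" "\<forall>e. P e \<longleftrightarrow> holds S (glue np e cp) r p"
    using assms(1) by (rule delta0E)
  obtain u' nu cu where u: "\<forall>e. u e = tval (glue nu e cu) u'" using assms(2) by (rule dtermE)
  let ?c = "mix cp cu" and ?n = "max np nu"
  show ?thesis
  proof (rule that)
    show "P e \<longleftrightarrow> holds S (glue (Suc ?n) e ?c) r (fsub (ren np (Suc ?n) (\<lambda>j. 2 * j)) (\<lambda>j. j) p)" for e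
      by (rule delta0_reindex) (use p in simp_all)
    show "u e = tval (glue ?n e ?c) (tsub (ren nu ?n (\<lambda>j. Suc (2 * j))) u')" for e
      by (rule dterm_reindex) (use u in simp_all)
  qed (use p in \<open>simp_all add: bounded_fm_fsub\<close>)
qed

section \<open>Definability read off from the shape of a predicate\<close>

named_theorems def_intros

lemma dterm_var [def_intros]: "dterm (\<lambda>e. e k)"
  unfolding dterm_def by (rule exI[of _ "Var k"], rule exI[of _ "Suc k"]) (simp add: glue_def)

lemma dterm_const [def_intros]: "dterm (\<lambda>e. a)"
  unfolding dterm_def
  by (rule exI[of _ "Var 0"], rule exI[of _ 0], rule exI[of _ "\<lambda>_. a"]) (simp add: glue_def)

lemma dterm_plus [def_intros]:
  assumes "dterm t" "dterm u"
  shows "dterm (\<lambda>e. t e + u e)"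
proof -
  obtain t' u' n c where "\<And>e. t e = tval (glue n e c) t'" "\<And>e. u e = tval (glue n e c) u'"
    using assms by (rule dterm_common) (rule that, assumption+)
  then have "\<forall>e. t e + u e = tval (glue n e c) (Plus t' u')" by simp
  then show ?thesis unfolding dterm_def by blast
qed

lemma dterm_times [def_intros]:
  assumes "dterm t" "dterm u"
  shows "dterm (\<lambda>e. t e * u e)"
proof -
  obtain t' u' n c where "\<And>e. t e = tval (glue n e c) t'" "\<And>e. u e = tval (glue n e c) u'"
    using assms by (rule dterm_common) (rule that, assumption+)
  then have "\<forall>e. t e * u e = tval (glue n e c) (Times t' u')" by simp
  then show ?thesis unfolding dterm_def by blast
qed

lemma delta0I:
  "bounded_fm p \<Longrightarrow> range r \<subseteq> S \<Longrightarrow> (\<And>e. P e \<longleftrightarrow> holds S (glue n e c) r p) \<Longrightarrow> delta0 S P"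
  unfolding delta0_def by blast

lemma delta0_mem [def_intros]:
  assumes "dterm t" "X \<in> S"
  shows "delta0 S (\<lambda>e. t e \<in> X)"
proof -
  obtain u n c where "\<forall>e. t e = tval (glue n e c) u" using assms(1) by (rule dtermE)
  with assms(2) show ?thesis
    by (intro delta0I[of "Mem u 0" "\<lambda>_. X" S _ n c]) (auto intro: bounded_fm.intros)
qed

lemma delta0_imp [def_intros]:
  assumes "delta0 S P" "delta0 S Q"
  shows "delta0 S (\<lambda>e. P e \<longrightarrow> Q e)"
  using assms
proof (rule delta0_common)
  fix p q n c r
  assume "bounded_fm p" "bounded_fm q" "range r \<subseteq> S"
    "\<And>e. P e \<longleftrightarrow> holds S (glue n e c) r p" "\<And>e. Q e \<longleftrightarrow> holds S (glue n e c) r q"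
  then show ?thesis by (intro delta0I[of "Imp p q" r S _ n c]) (auto intro: bounded_fm.intros)
qed

lemma delta0_all [def_intros]:
  assumes "dterm t" "delta0 S (\<lambda>e. P (e 0) (\<lambda>i. e (Suc i)))"
  shows "delta0 S (\<lambda>e. \<forall>x<t e. P x e)"
  using assms(2,1)
proof (rule delta0_dterm_common)
  fix p n c r u
  assume *: "bounded_fm p" "range r \<subseteq> S" "\<And>e. P (e 0) (\<lambda>i. e (Suc i)) \<longleftrightarrow> holds S (glue (Suc n) e c) r p"
    "\<And>e. t e = tval (glue n e c) u"
  have "glue (Suc n) (case_nat x e) c = case_nat x (glue n e c)" for x e
    by (auto simp: glue_def fun_eq_iff split: nat.split)
  with *(3)[of "case_nat _ _"] have "P x e \<longleftrightarrow> holds S (case_nat x (glue n e c)) r p" for x e by simp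
  with *(1,2,4) show ?thesis
    by (intro delta0I[of "AllN (Imp (Less (Var 0) (lift_tm u)) p)" r S _ n c])
      (auto intro: bounded_fm.intros simp: tval_tsub)
qed

locale set_universe =
  fixes S :: "'a::{zero,one,plus,times,ord} set set"
  assumes S_nonempty: "S \<noteq> {}"
begin

lemma delta0_eq [def_intros]:
  assumes "dterm t" "dterm u"
  shows "delta0 S (\<lambda>e. t e = u e)"
proof -
  from S_nonempty obtain X where "X \<in> S" by blast
  obtain t' u' n c where "\<And>e. t e = tval (glue n e c) t'" "\<And>e. u e = tval (glue n e c) u'"
    using assms by (rule dterm_common) (rule that, assumption+)
  with \<open>X \<in> S\<close> show ?thesis
    apply -
    apply (rule delta0I[of "Eq t' u'" "\<lambda>_. X" S _ n c])
      apply (simp_all add: bounded_fm.intros image_subset_iff)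
    done
qed

lemma delta0_less [def_intros]:
  assumes "dterm t" "dterm u"
  shows "delta0 S (\<lambda>e. t e < u e)"
proof -
  from S_nonempty obtain X where "X \<in> S" by blast
  obtain t' u' n c where "\<And>e. t e = tval (glue n e c) t'" "\<And>e. u e = tval (glue n e c) u'"
    using assms by (rule dterm_common) (rule that, assumption+)
  with \<open>X \<in> S\<close> show ?thesis
    apply -
    apply (rule delta0I[of "Less t' u'" "\<lambda>_. X" S _ n c])
      apply (simp_all add: bounded_fm.intros image_subset_iff)
    done
qed

lemma delta0_const [def_intros]: "delta0 S (\<lambda>e. b)"
proof -
  from S_nonempty obtain X where "X \<in> S" by blast
  then show ?thesis
    by (intro delta0I[of "if b then Imp Fls Fls else Fls" "\<lambda>_. X"]) (auto intro: bounded_fm.intros)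
qed

lemma delta0_not [def_intros]: "delta0 S P \<Longrightarrow> delta0 S (\<lambda>e. \<not> P e)"
  using delta0_imp[of S P "\<lambda>_. False"] delta0_const[of False] by simp

lemma delta0_and [def_intros]: "delta0 S P \<Longrightarrow> delta0 S Q \<Longrightarrow> delta0 S (\<lambda>e. P e \<and> Q e)"
  using delta0_not[OF delta0_imp[of S P "\<lambda>e. \<not> Q e"]] delta0_not[of Q] by simp

lemma delta0_or [def_intros]: "delta0 S P \<Longrightarrow> delta0 S Q \<Longrightarrow> delta0 S (\<lambda>e. P e \<or> Q e)"
  using delta0_imp[of S "\<lambda>e. \<not> P e" Q] delta0_not[of P] by (simp add: imp_conv_disj)

lemma delta0_iff [def_intros]: "delta0 S P \<Longrightarrow> delta0 S Q \<Longrightarrow> delta0 S (\<lambda>e. P e \<longleftrightarrow> Q e)"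
  using delta0_and[OF delta0_imp delta0_imp, of P Q Q P] by (simp add: iff_conv_conj_imp)

lemma delta0_ex [def_intros]:
  assumes "dterm t" "delta0 S (\<lambda>e. P (e 0) (\<lambda>i. e (Suc i)))"
  shows "delta0 S (\<lambda>e. \<exists>x<t e. P x e)"
  using delta0_not[OF delta0_all[of t S "\<lambda>x e. \<not> P x e"]] assms delta0_not by simp

lemma sigma1_delta0:
  assumes "delta0 S P"
  shows "sigma1 S P"
proof -
  obtain p n c r where *: "bounded_fm p" "range r \<subseteq> S" "\<forall>e. P e \<longleftrightarrow> holds S (glue n e c) r p"
    using assms by (rule delta0E)
  have "glue (Suc n) (case_nat x e) c = case_nat x (glue n e c)" for x e
    by (auto simp: glue_def fun_eq_iff split: nat.split)
  moreover have "bounded_fm (liftN p)" using * by (auto simp: liftN_def bounded_fm_fsub)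
  ultimately show ?thesis using * unfolding sigma1_def
    by (intro exI[of _ "\<lambda>e. holds S (glue (Suc n) e c) r (liftN p)"]) (auto intro!: delta0I)
qed

lemma sigma1_ex_delta0:
  assumes "delta0 S (\<lambda>e. P (e 0) (\<lambda>i. e (Suc i)))"
  shows "sigma1 S (\<lambda>e. \<exists>x. P x e)"
  unfolding sigma1_def by (rule exI, rule conjI, rule assms) simp

end

section \<open>Induction and comprehension for definable predicates\<close>

locale model_RCA0 = set_universe +
  assumes valid_RCA0: "p \<in> RCA0 \<Longrightarrow> valid S p"
begin

text \<open>The way back from predicates to literal formulas, to which the axiom schemes
  apply.\<close>

lemma sigma1E:
  assumes "sigma1 S (\<lambda>e. P (e 0))"
  obtains p c r where "Sigma01 p" "range r \<subseteq> S" "\<And>x. P x \<longleftrightarrow> holds S (case_nat x c) r p"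
proof -
  from assms obtain Q where Q: "delta0 S Q" "\<forall>e. P (e 0) \<longleftrightarrow> (\<exists>x. Q (case_nat x e))"
    unfolding sigma1_def by blast
  obtain p n c r where p: "bounded_fm p" "range r \<subseteq> S" "\<forall>e. Q e \<longleftrightarrow> holds S (glue n e c) r p"
    using Q(1) by (rule delta0E)
  \<comment> \<open>At least two variables must be visible, the witness and x; all further visible
    ones are set to 0.\<close>
  define p' where "p' = fsub (ren n (Suc (Suc n)) (\<lambda>j. j)) (\<lambda>j. j) p"
  let ?c = "glue n (\<lambda>_. 0) c"
  have e: "case_nat y (case_nat x ?c) = glue (Suc (Suc n)) (case_nat y (case_nat x (\<lambda>_. 0))) c" for x y
    by (auto simp: glue_def fun_eq_iff split: nat.split)
  have "P x \<longleftrightarrow> holds S (case_nat x ?c) r (ExN p')" for x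
  proof -
    have "P x \<longleftrightarrow> (\<exists>y. Q (case_nat y (case_nat x (\<lambda>_. 0))))" using Q(2)[rule_format, of "case_nat x (\<lambda>_. 0)"] by simp
    also have "\<dots> \<longleftrightarrow> (\<exists>y. holds S (case_nat y (case_nat x ?c)) r p')"
      unfolding e p'_def using delta0_reindex[of Q S n c "\<lambda>j. j" r "\<lambda>j. j" p "Suc (Suc n)"] p(3) by simp
    finally show ?thesis by simp
  qed
  moreover have "Sigma01 (ExN p')" using p(1) by (auto simp: Sigma01_def p'_def bounded_fm_fsub)
  ultimately show ?thesis using that p(2) by blast
qed

lemma sigma1_induct [consumes 1, case_names zero step]:
  assumes "sigma1 S (\<lambda>e. P (e 0))" and "P 0" and "\<And>x. P x \<Longrightarrow> P (x + 1)"
  shows "P x"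
proof -
  obtain p c r where p: "Sigma01 p" "range r \<subseteq> S" "\<And>x. P x \<longleftrightarrow> holds S (case_nat x c) r p"
    using assms(1) by (rule sigma1E) (rule that, assumption+)
  from p(1) have "valid S (induction_axiom p)" by (intro valid_RCA0) (auto simp: RCA0_def)
  from this[unfolded valid_induction_axiom, rule_format, OF p(2), of c x] assms(2,3)
  show ?thesis unfolding p(3) by blast
qed

lemma delta0_induct [consumes 1, case_names zero step]:
  assumes "delta0 S (\<lambda>e. P (e 0))" and "P 0" and "\<And>x. P x \<Longrightarrow> P (x + 1)"
  shows "P x"
  using sigma1_induct[OF sigma1_delta0[OF assms(1)] assms(2,3)] .

text \<open>The axiom asks for a Sigma and a Pi formula. The latter comes from the Sigma formula for
  the complement by negating its matrix; interleaved parameters put both into one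
  environment.\<close>

lemma comprehension:
  assumes "sigma1 S (\<lambda>e. P (e 0))" and "sigma1 S (\<lambda>e. \<not> P (e 0))"
  shows "{x. P x} \<in> S"
proof -
  obtain p c r where p: "Sigma01 p" "range r \<subseteq> S" "\<And>x. P x \<longleftrightarrow> holds S (case_nat x c) r p"
    using assms(1) by (rule sigma1E) (rule that, assumption+)
  obtain q c' r' where q: "Sigma01 q" "range r' \<subseteq> S" "\<And>x. \<not> P x \<longleftrightarrow> holds S (case_nat x c') r' q"
    using assms(2) by (rule sigma1E) (rule that, assumption+)
  let ?c = "mix c c'" and ?r = "mix r r'"
  define p' where "p' = fsub (ren 1 1 (\<lambda>j. 2 * j)) (\<lambda>j. 2 * j) p"
  define q' where "q' = fsub (ren 1 1 (\<lambda>j. Suc (2 * j))) (\<lambda>j. Suc (2 * j)) q"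
  have e: "case_nat x c = glue 1 (\<lambda>_. x) c" for x and c :: "nat \<Rightarrow> 'a"
    by (auto simp: glue_def fun_eq_iff split: nat.split)
  have p': "P x \<longleftrightarrow> holds S (case_nat x ?c) ?r p'" for x
    unfolding p'_def p(3) e by (simp add: holds_fsub tval_ren)
  have q': "\<not> P x \<longleftrightarrow> holds S (case_nat x ?c) ?r q'" for x
    unfolding q'_def q(3) e by (simp add: holds_fsub tval_ren)
  have "Sigma01 p'" using p(1) by (auto simp: Sigma01_def p'_def bounded_fm_fsub)
  obtain q0 where q0: "q' = ExN q0" "bounded_fm q0"
    using q(1) by (auto simp: Sigma01_def q'_def bounded_fm_fsub)
  then have "Pi01 (AllN (Neg q0))" by (auto simp: Pi01_def intro: bounded_fm.intros)
  with \<open>Sigma01 p'\<close> have "valid S (comprehension_axiom p' (AllN (Neg q0)))"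
    by (intro valid_RCA0) (auto simp: RCA0_def)
  moreover have "range ?r \<subseteq> S" using p(2) q(2) by (rule range_mix)
  ultimately have "\<exists>X\<in>S. \<forall>x. x \<in> X \<longleftrightarrow> holds S (case_nat x ?c) ?r p'"
  proof (rule valid_comprehension_axiom[THEN iffD1, rule_format])
    show "holds S (case_nat x ?c) ?r p' \<longleftrightarrow> holds S (case_nat x ?c) ?r (AllN (Neg q0))" for x
      using p'[of x] q'[of x] by (auto simp add: q0(1))
  qed
  then obtain X where "X \<in> S" "\<forall>x. x \<in> X \<longleftrightarrow> P x" using p' by auto
  moreover from this have "X = {x. P x}" by blast
  ultimately show ?thesis by simp
qed

end

section \<open>Arithmetic from the basic axioms and induction\<close>

context model_RCA0
begin

text \<open>The axioms mention no variable beyond 0 and 1, so giving one value to 0 and another to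
  all the rest covers every instance.\<close>

lemma basic_axiom:
  assumes "universal_closure p \<in> basic_axioms"
  shows "\<exists>r. holds S (case_nat x (\<lambda>_. y)) r p"
proof -
  have "valid S (universal_closure p)" using assms by (intro valid_RCA0) (simp add: RCA0_def)
  then have "valid S p" by simp
  moreover obtain X where "X \<in> S" using S_nonempty by blast
  ultimately show ?thesis unfolding valid_def
    by (intro exI[of _ "\<lambda>_. X"]) (simp add: image_subset_iff)
qed

lemma plus_one_neq_zero: "x + 1 \<noteq> 0" for x :: 'a
  using basic_axiom[of "Neg (Eq (Plus (Var 0) One) Zero)" x] by (auto simp: basic_axioms_def)

lemma plus_one_inject: "x + 1 = y + 1 \<Longrightarrow> x = y" for x y :: 'a
  using basic_axiom[of "Imp (Eq (Plus (Var 0) One) (Plus (Var 1) One)) (Eq (Var 0) (Var 1))" x y]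
  by (auto simp: basic_axioms_def)

lemma plus_zero: "x + 0 = x" for x :: 'a
  using basic_axiom[of "Eq (Plus (Var 0) Zero) (Var 0)" x]
  by (auto simp: basic_axioms_def)

lemma plus_plus_one: "x + (y + 1) = (x + y) + 1" for x y :: 'a
  using basic_axiom[of "Eq (Plus (Var 0) (Plus (Var 1) One)) (Plus (Plus (Var 0) (Var 1)) One)" x y]
  by (auto simp: basic_axioms_def)

lemma times_zero: "x * 0 = 0" for x :: 'a
  using basic_axiom[of "Eq (Times (Var 0) Zero) Zero" x]
  by (auto simp: basic_axioms_def)

lemma times_plus_one: "x * (y + 1) = x * y + x" for x y :: 'a
  using basic_axiom[of "Eq (Times (Var 0) (Plus (Var 1) One)) (Plus (Times (Var 0) (Var 1)) (Var 0))" x y]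
  by (auto simp: basic_axioms_def)

lemma not_less_zero: "\<not> x < 0" for x :: 'a
  using basic_axiom[of "Neg (Less (Var 0) Zero)" x]
  by (auto simp: basic_axioms_def)

lemma less_plus_one: "x < y + 1 \<longleftrightarrow> x < y \<or> x = y" for x y :: 'a
proof -
  obtain r where "holds S (case_nat x (\<lambda>_. y)) r (Iff (Less (Var 0) (Plus (Var 1) One)) (Disj (Less (Var 0) (Var 1)) (Eq (Var 0) (Var 1))))"
    using basic_axiom[of "Iff (Less (Var 0) (Plus (Var 1) One)) (Disj (Less (Var 0) (Var 1)) (Eq (Var 0) (Var 1)))" x y]
    unfolding basic_axioms_def by blast
  then show ?thesis by auto
qed

section \<open>Semiring laws\<close>

lemma zero_plus: "0 + x = x" for x :: 'a
  by (rule delta0_induct[where P = "\<lambda>x. 0 + x = x"]) (intro def_intros, simp_all add: plus_zero plus_plus_one)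

lemma plus_assoc: "(x + y) + z = x + (y + z)" for x y z :: 'a
  by (rule delta0_induct[where P = "\<lambda>z. (x + y) + z = x + (y + z)"])
    (intro def_intros, simp_all add: plus_zero plus_plus_one)

lemma one_plus: "1 + x = x + 1" for x :: 'a
  by (rule delta0_induct[where P = "\<lambda>x. 1 + x = x + 1"])
    (intro def_intros, simp_all add: plus_zero zero_plus plus_plus_one)

lemma plus_comm: "x + y = y + x" for x y :: 'a
proof (rule delta0_induct[where P = "\<lambda>y. x + y = y + x"])
  fix y
  assume IH: "x + y = y + x"
  have "x + (y + 1) = (y + x) + 1" by (simp only: plus_plus_one IH)
  also have "\<dots> = y + (1 + x)" by (simp only: plus_assoc one_plus)
  finally show "x + (y + 1) = y + 1 + x" by (simp only: plus_assoc)
qed (intro def_intros, simp add: plus_zero zero_plus)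

lemma plus_right_cancel: "x + z = y + z \<longleftrightarrow> x = y" for x y z :: 'a
  by (rule delta0_induct[where P = "\<lambda>z. x + z = y + z \<longleftrightarrow> x = y"])
    (intro def_intros, auto simp: plus_zero plus_plus_one dest: plus_one_inject)

lemma times_plus: "x * (y + z) = x * y + x * z" for x y z :: 'a
proof (rule delta0_induct[where P = "\<lambda>z. x * (y + z) = x * y + x * z"])
  fix z
  assume IH: "x * (y + z) = x * y + x * z"
  have "x * (y + (z + 1)) = (x * y + x * z) + x" by (simp only: plus_plus_one times_plus_one IH)
  then show "x * (y + (z + 1)) = x * y + x * (z + 1)" by (simp only: plus_assoc times_plus_one)
qed (intro def_intros, simp add: plus_zero times_zero)

lemma times_one: "x * 1 = x" for x :: 'a
  using times_plus_one[of x 0] by (simp add: zero_plus times_zero)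

lemma times_assoc: "(x * y) * z = x * (y * z)" for x y z :: 'a
  by (rule delta0_induct[where P = "\<lambda>z. (x * y) * z = x * (y * z)"])
    (intro def_intros, simp_all add: times_zero times_one times_plus)

lemma zero_times: "0 * x = 0" for x :: 'a
  by (rule delta0_induct[where P = "\<lambda>x. 0 * x = 0"])
    (intro def_intros, simp_all add: times_zero times_plus_one plus_zero)

lemma plus_one_times: "(x + 1) * y = x * y + y" for x y :: 'a
proof (rule delta0_induct[where P = "\<lambda>y. (x + 1) * y = x * y + y"])
  fix y
  assume IH: "(x + 1) * y = x * y + y"
  have "(x * y + y) + x = (x * y + x) + y" by (simp only: plus_assoc plus_comm[of y x])
  then show "(x + 1) * (y + 1) = x * (y + 1) + (y + 1)"
    by (simp only: times_plus_one IH plus_plus_one)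
qed (intro def_intros, simp add: times_zero plus_zero)

lemma times_comm: "x * y = y * x" for x y :: 'a
  by (rule delta0_induct[where P = "\<lambda>y. x * y = y * x"])
    (intro def_intros, simp_all add: times_zero zero_times times_plus_one plus_one_times)

section \<open>The order and its description by addition\<close>

lemma zero_or_plus_one: "x = 0 \<or> (\<exists>y. x = y + 1)" for x y :: 'a
proof -
  have "\<exists>y. x = 0 \<or> x = y + 1"
    by (rule sigma1_induct[where P = "\<lambda>x. \<exists>y. x = 0 \<or> x = y + 1"])
      (rule sigma1_ex_delta0, intro def_intros, auto)
  then show ?thesis by blast
qed

lemma less_iff_plus: "x < y \<longleftrightarrow> (\<exists>d. y = x + (d + 1))" for x y :: 'a
proof
  have "x < x + (d + 1)" for d
    by (rule delta0_induct[where P = "\<lambda>d. x < x + (d + 1)"])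
      (intro def_intros, simp_all add: zero_plus plus_plus_one less_plus_one)
  then show "\<exists>d. y = x + (d + 1) \<Longrightarrow> x < y" by blast
next
  \<comment> \<open>The quantifier stands in front of the implication to make the induction formula
    Sigma.\<close>
  have "\<exists>d. x < y \<longrightarrow> y = x + (d + 1)"
  proof (rule sigma1_induct[where P = "\<lambda>y. \<exists>d. x < y \<longrightarrow> y = x + (d + 1)"])
    show "\<exists>d. x < y + 1 \<longrightarrow> y + 1 = x + (d + 1)" if "\<exists>d. x < y \<longrightarrow> y = x + (d + 1)" for y
      using that by (metis less_plus_one plus_plus_one plus_zero)
  qed (rule sigma1_ex_delta0, intro def_intros, simp add: not_less_zero)
  then show "x < y \<Longrightarrow> \<exists>d. y = x + (d + 1)" by blast
qed

lemma less_total: "x < y \<or> x = y \<or> y < x" for x y :: 'a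
proof (rule delta0_induct[where P = "\<lambda>y. x < y \<or> x = y \<or> y < x"])
  show "x < 0 \<or> x = 0 \<or> 0 < x"
    by (rule delta0_induct[where P = "\<lambda>x. x < 0 \<or> x = 0 \<or> 0 < x"])
      (intro def_intros, auto simp: less_plus_one not_less_zero)
next
  fix y
  assume "x < y \<or> x = y \<or> y < x"
  then show "x < y + 1 \<or> x = y + 1 \<or> y + 1 < x"
  proof (elim disjE)
    assume "y < x"
    then obtain d where d: "x = y + (d + 1)" by (auto simp: less_iff_plus)
    consider "d = 0" | d' where "d = d' + 1" using zero_or_plus_one by blast
    then show ?thesis
    proof cases
      case (2 d')
      then have "x = (y + 1) + (d' + 1)" using d by (metis one_plus plus_assoc)
      then show ?thesis by (auto simp: less_iff_plus)
    qed (simp add: d zero_plus)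
  qed (simp_all add: less_plus_one)
qed (intro def_intros)

lemma less_irrefl': "\<not> x < x" for x :: 'a
proof
  assume "x < x"
  then obtain d where "x = x + (d + 1)" by (auto simp: less_iff_plus)
  then have "0 + x = (d + 1) + x" using zero_plus plus_comm[of x "d + 1"] by simp
  then show False by (metis plus_right_cancel plus_one_neq_zero)
qed

lemma less_trans': "x < y \<Longrightarrow> y < z \<Longrightarrow> x < z" for x y z :: 'a
proof -
  assume "x < y" "y < z"
  then obtain d k where "y = x + (d + 1)" "z = y + (k + 1)" by (auto simp: less_iff_plus)
  then have "z = x + ((d + 1 + k) + 1)" by (simp add: plus_assoc)
  then show "x < z" unfolding less_iff_plus by blast
qed

lemma le_iff_plus: "x < y \<or> x = y \<longleftrightarrow> (\<exists>d. y = x + d)" for x y :: 'a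
proof -
  have "x < y \<or> x = y \<longleftrightarrow> (\<exists>d. y = x + (d + 1)) \<or> y = x + 0"
    by (auto simp: less_iff_plus plus_zero)
  also have "\<dots> \<longleftrightarrow> (\<exists>d. y = x + d)"
  proof
    assume "\<exists>d. y = x + d"
    then obtain d where "y = x + d" ..
    then show "(\<exists>d. y = x + (d + 1)) \<or> y = x + 0" using zero_or_plus_one[of d] by auto
  qed blast
  finally show ?thesis .
qed

end


section \<open>Completeness\<close>

text \<open>
  The term model of a Henkin theory that omits \<open>p\<close> if \<open>RCA0\<close> does not prove it. Making its
  universe a type gives access to the overloaded arithmetic of the library. As \<open>RCA0\<close> is
  consistent, this yields a model of \<open>RCA0\<close> in any case.
\<close>

definition counter_theory :: "fm \<Rightarrow> fm set" where
  "counter_theory p = (SOME H. henkin H \<and> RCA0 \<subseteq> H \<and> (\<not> RCA0 \<turnstile> p \<longrightarrow> universal_closure p \<notin> H))"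

lemma counter_theory:
  "henkin (counter_theory p)" "RCA0 \<subseteq> counter_theory p"
  "\<not> RCA0 \<turnstile> p \<Longrightarrow> universal_closure p \<notin> counter_theory p"
proof -
  have "\<exists>H. henkin H \<and> RCA0 \<subseteq> H \<and> (\<not> RCA0 \<turnstile> p \<longrightarrow> universal_closure p \<notin> H)"
  proof (cases "RCA0 \<turnstile> p")
    case True
    with henkin_extension[OF consistent_RCA0 RCA0_closed] show ?thesis by blast
  next
    case False
    then have "\<not> RCA0 \<turnstile> universal_closure p" using derives_universal_closure RCA0_closed by blast
    then have "consistent (insert (Neg (universal_closure p)) RCA0)"
      unfolding consistent_def by (blast intro: derives.Contr)
    moreover have "boundN q = 0 \<and> boundS q = 0" if "q \<in> insert (Neg (universal_closure p)) RCA0" for q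
      using that RCA0_closed by auto
    ultimately obtain H where H: "insert (Neg (universal_closure p)) RCA0 \<subseteq> H" "henkin H"
      using henkin_extension by blast
    then have "universal_closure p \<notin> H" using henkin_Imp[OF H(2), of "universal_closure p" Fls] henkin_Fls by blast
    with H show ?thesis by blast
  qed
  from someI_ex[OF this] show "henkin (counter_theory p)" "RCA0 \<subseteq> counter_theory p"
    "\<not> RCA0 \<turnstile> p \<Longrightarrow> universal_closure p \<notin> counter_theory p"
    by (simp_all add: counter_theory_def)
qed

text \<open>A constant, because the quotient type below needs a closed equivalence relation: the
  counter theory has to be that of one fixed formula.\<close>

definition goal :: fm where
  "goal = sentence (\<^bold>\<forall>\<^sub>S P. \<^bold>\<forall>\<^sub>S E. representatives P E \<^bold>\<longrightarrow>
     (\<^bold>\<forall>\<^sub>S W. WPO_dilator P E W \<^bold>\<longrightarrow> monotone_dilator P E W))"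

abbreviation "H0 \<equiv> counter_theory goal"

quotient_type elt = tm / "\<lambda>t u. Eq t u \<in> H0"
  by (intro equivpI reflpI sympI transpI)
    (blast intro: henkin_Eq_refl henkin_Eq_sym henkin_Eq_trans counter_theory)+

instantiation elt :: "{zero,one,plus,times,ord}"
begin

lift_definition zero_elt :: elt is Zero .
lift_definition one_elt :: elt is One .
lift_definition plus_elt :: "elt \<Rightarrow> elt \<Rightarrow> elt" is Plus
  by (rule henkin_Eq_Plus[OF counter_theory(1)])
lift_definition times_elt :: "elt \<Rightarrow> elt \<Rightarrow> elt" is Times
  by (rule henkin_Eq_Times[OF counter_theory(1)])
lift_definition less_elt :: "elt \<Rightarrow> elt \<Rightarrow> bool" is "\<lambda>t u. Less t u \<in> H0"
  by (meson henkin_Less_cong henkin_Eq_sym counter_theory(1))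
definition less_eq_elt :: "elt \<Rightarrow> elt \<Rightarrow> bool" where
  "less_eq_elt x y \<longleftrightarrow> x < y \<or> x = y"

instance ..

end

text \<open>The sets of the term model are those named by a set variable. Equality of sets is not
  primitive, so several variables may name the same set.\<close>

definition ext :: "nat \<Rightarrow> elt set" where
  "ext X = abs_elt ` {t. Mem t X \<in> H0}"

lemma abs_elt_mem_ext: "abs_elt t \<in> ext X \<longleftrightarrow> Mem t X \<in> H0"
  unfolding ext_def
  using henkin_Mem_cong[OF counter_theory(1) henkin_Eq_sym[OF counter_theory(1)]]
  by (auto simp: elt.abs_eq_iff)

lemma tval_abs_elt: "tval (\<lambda>i. abs_elt (s i)) t = abs_elt (tsub s t)"
  by (induction t) (simp_all add: zero_elt_def one_elt_def plus_elt.abs_eq times_elt.abs_eq)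

text \<open>The truth lemma. Every number is the class of a term and every set has a name, so
  quantifiers reduce to instances, where \<open>henkin_AllN\<close> and \<open>henkin_AllS\<close>
  apply.\<close>

lemma holds_abs_elt:
  "holds (range ext) (\<lambda>i. abs_elt (s i)) (\<lambda>X. ext (r X)) p \<longleftrightarrow> fsub s r p \<in> H0"
proof (induction p arbitrary: s r)
  case (AllN p)
  have "case_nat (abs_elt t) (\<lambda>i. abs_elt (s i)) = (\<lambda>i. abs_elt (case_nat t s i))" for t
    by (auto simp: fun_eq_iff split: nat.split)
  moreover have "(\<forall>x. Q x) \<longleftrightarrow> (\<forall>t. Q (abs_elt t))" for Q
    by (metis elt.abs_eq_iff elt.abs_induct)
  ultimately show ?case
    using AllN.IH[of "case_nat _ s" r] by (simp add: henkin_AllN[OF counter_theory(1)] instN_fsub)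
next
  case (AllS p)
  have "case_nat (ext X) (\<lambda>i. ext (r i)) = (\<lambda>i. ext (case_nat X r i))" for X
    by (auto simp: fun_eq_iff split: nat.split)
  then show ?case
    using AllS.IH[of s "case_nat _ r"] by (simp add: henkin_AllS[OF counter_theory(1)] instS_fsub)
qed (auto simp: tval_abs_elt elt.abs_eq_iff less_elt.abs_eq abs_elt_mem_ext
    henkin_Imp[OF counter_theory(1)] henkin_Fls[OF counter_theory(1)])

lemma valid_elt:
  assumes "boundN p = 0" "boundS p = 0"
  shows "valid (range ext) p \<longleftrightarrow> p \<in> H0"
proof -
  have "holds (range ext) e r p \<longleftrightarrow> p \<in> H0" if r: "range r \<subseteq> range ext" for e r
  proof -
    have "\<exists>s. e = (\<lambda>i. abs_elt (s i))"
      by (rule exI[of _ "\<lambda>i. rep_elt (e i)"]) (simp add: Quotient3_abs_rep[OF Quotient3_elt])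
    moreover have "\<exists>r'. r = (\<lambda>X. ext (r' X))"
    proof -
      have "\<exists>Y. r X = ext Y" for X using r by blast
      from choice[OF allI, OF this] show ?thesis by (simp add: fun_eq_iff)
    qed
    ultimately obtain s r' where "e = (\<lambda>i. abs_elt (s i))" "r = (\<lambda>X. ext (r' X))" by blast
    then show ?thesis using holds_abs_elt fsub_closed[OF assms] by simp
  qed
  then show ?thesis unfolding valid_def by blast
qed

interpretation elt: model_RCA0 "range ext"
  by unfold_locales (use valid_elt RCA0_closed counter_theory(2) in auto)

section \<open>The term model as an ordered semiring\<close>

instantiation elt :: linordered_semidom
begin

text \<open>The type class demands a subtraction. This is the truncated one; the default 0 is what
  makes iterated subtraction and distributivity hold when the difference does not exist.\<close>

definition minus_elt :: "elt \<Rightarrow> elt \<Rightarrow> elt" where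
  "minus_elt x y = (if \<exists>d. x = y + d then THE d. x = y + d else 0)"

lemma elt_add_diff: "(x + y) - x = (y :: elt)"
proof -
  have "(THE d. x + y = x + d) = y"
    by (rule the_equality) (metis elt.plus_comm elt.plus_right_cancel)+
  then show ?thesis by (auto simp: minus_elt_def)
qed

lemma elt_diff_eq_0: "\<nexists>d. x = y + d \<Longrightarrow> x - y = (0 :: elt)"
  by (auto simp: minus_elt_def)

instance
proof
  fix a b c :: elt
  note le = less_eq_elt_def elt.le_iff_plus
  show "(a < b) = (a \<le> b \<and> \<not> b \<le> a)"
    unfolding less_eq_elt_def using elt.less_irrefl' elt.less_trans' by metis
  show "a \<le> a" by (simp add: less_eq_elt_def)
  show "a \<le> b \<Longrightarrow> b \<le> c \<Longrightarrow> a \<le> c"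
    unfolding less_eq_elt_def using elt.less_trans' by metis
  show "a \<le> b \<Longrightarrow> b \<le> a \<Longrightarrow> a = b"
    unfolding less_eq_elt_def using elt.less_irrefl' elt.less_trans' by metis
  show "a \<le> b \<or> b \<le> a"
    unfolding less_eq_elt_def using elt.less_total by metis
  show "a + b + c = a + (b + c)" by (rule elt.plus_assoc)
  show "a + b = b + a" by (rule elt.plus_comm)
  show "0 + a = a" by (rule elt.zero_plus)
  show "a * b * c = a * (b * c)" by (rule elt.times_assoc)
  show "a * b = b * a" by (rule elt.times_comm)
  show "1 * a = a" by (metis elt.times_comm elt.times_one)
  show "(a + b) * c = a * c + b * c" by (metis elt.times_comm elt.times_plus)
  show "0 * a = 0" "a * 0 = 0" by (rule elt.zero_times elt.times_zero)+
  show "a * (b + c) = a * b + a * c" by (rule elt.times_plus)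
  show "(0 :: elt) \<noteq> 1" by (metis elt.plus_one_neq_zero elt.zero_plus)
  show "(0 :: elt) < 1" by (metis elt.less_iff_plus elt.zero_plus)
  show "a + b - a = b" by (rule elt_add_diff)
  show "a - b - c = a - (b + c)"
  proof (cases "\<exists>d. a = b + d")
    case True
    then obtain d where d: "a = b + d" by blast
    show ?thesis
    proof (cases "\<exists>d'. d = c + d'")
      case True
      then show ?thesis by (metis d elt_add_diff elt.plus_assoc)
    next
      case False
      then have "\<nexists>d'. a = (b + c) + d'"
        unfolding d by (metis elt.plus_assoc elt.plus_comm elt.plus_right_cancel)
      then show ?thesis by (simp add: d elt_add_diff False elt_diff_eq_0)
    qed
  next
    case False
    then have "\<nexists>d'. a = (b + c) + d'" by (metis elt.plus_assoc)
    moreover have "0 - c = 0" for c :: elt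
    proof (cases "\<exists>d. 0 = c + d")
      case True
      then obtain d where d: "0 = c + d" by blast
      then have "d = 0" using elt.zero_or_plus_one[of d] by (metis elt.plus_one_neq_zero elt.plus_plus_one)
      then have "c = 0" using d by (simp add: elt.plus_zero)
      then show ?thesis using elt_add_diff[of 0 0] by (simp add: elt.zero_plus)
    qed (rule elt_diff_eq_0)
    ultimately show ?thesis using False by (simp add: elt_diff_eq_0)
  qed
  show "a * (b - c) = a * b - a * c"
  proof (cases "\<exists>d. b = c + d")
    case True
    then show ?thesis by (metis elt_add_diff elt.times_plus)
  next
    case False
    then have "b < c" using elt.less_total[of b c] elt.le_iff_plus[of c b] by blast
    then obtain d where d: "c = b + d" by (auto simp: elt.less_iff_plus)
    have "a * b - a * c = 0"
    proof (cases "\<exists>d'. a * b = a * c + d'")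
      case True
      then obtain d' where "a * b = a * b + (a * d + d')" by (auto simp: d elt.times_plus elt.plus_assoc)
      then have "a * d + d' = 0" by (metis elt.plus_comm elt.plus_right_cancel elt.zero_plus)
      then have "d' = 0" using elt.zero_or_plus_one[of d'] by (metis elt.plus_one_neq_zero elt.plus_plus_one)
      with \<open>a * d + d' = 0\<close> have "a * c = a * b" by (simp add: d elt.times_plus elt.plus_zero)
      then show ?thesis using elt_add_diff[of "a * b" 0] by (simp add: elt.plus_zero)
    qed (rule elt_diff_eq_0)
    then show ?thesis using False by (simp add: elt_diff_eq_0 elt.times_zero)
  qed
  show "a \<noteq> 0 \<Longrightarrow> b \<noteq> 0 \<Longrightarrow> a * b \<noteq> 0"
    by (metis elt.zero_or_plus_one elt.plus_one_neq_zero elt.plus_plus_one elt.times_plus_one)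
  show "a \<le> b \<Longrightarrow> c + a \<le> c + b" unfolding le by (metis elt.plus_assoc)
  show "c * a < c * b" if "a < b" "0 < c"
  proof -
    from that(1) obtain d where "b = a + (d + 1)" by (auto simp: elt.less_iff_plus)
    moreover from that(2) obtain k where "c = k + 1" by (auto simp: elt.less_iff_plus elt.zero_plus)
    ultimately have "c * b = c * a + ((c * d + k) + 1)"
      by (simp add: elt.times_plus elt.times_plus_one elt.plus_plus_one elt.times_one)
        (simp add: elt.plus_assoc)
    then show ?thesis unfolding elt.less_iff_plus by blast
  qed
  show "b \<le> a \<Longrightarrow> a - b + b = a" unfolding le by (metis elt_add_diff elt.plus_comm)
qed

end

theorem derives_goal:
  assumes "valid (range ext) goal"
  shows "RCA0 \<turnstile> goal"
proof (rule ccontr)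
  assume "\<not> RCA0 \<turnstile> goal"
  then have "universal_closure goal \<notin> H0" by (rule counter_theory)
  with assms show False using valid_elt[of "universal_closure goal"] by simp
qed

section \<open>Closure properties of definable predicates\<close>

lemma delta0_rename:
  assumes "delta0 S P"
  shows "delta0 S (\<lambda>e. P (\<lambda>i. e (f i)))"
proof -
  obtain p n c r where p: "bounded_fm p" "range r \<subseteq> S" "\<forall>e. P e \<longleftrightarrow> holds S (glue n e c) r p"
    using assms by (rule delta0E)
  \<comment> \<open>The parameters start at N, past every variable \<open>f i\<close> that replaces
    a visible one; inserting 0 keeps the maximum defined if there is none.\<close>
  define N where "N = Suc (Max (insert 0 (f ` {..<n})))"
  have N: "f i < N" if "i < n" for i
    unfolding N_def using that by (simp add: less_Suc_eq_le Max_ge)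
  define s where "s = (\<lambda>i. if i < n then Var (f i) else Var (N + (i - n)))"
  have "(\<lambda>i. tval (glue N e c) (s i)) = glue n (\<lambda>i. e (f i)) c" for e
    by (auto simp: fun_eq_iff glue_def s_def N)
  then show ?thesis
    using p by (intro delta0I[of "fsub s (\<lambda>j. j) p" r S _ N c]) (simp_all add: bounded_fm_fsub holds_fsub)
qed

lemma dterm_shift:
  assumes "dterm t"
  shows "dterm (\<lambda>e. t (\<lambda>i. e (Suc i)))"
proof -
  obtain u n c where u: "\<forall>e. t e = tval (glue n e c) u" using assms by (rule dtermE)
  have "(\<lambda>i. tval (glue (Suc n) e c) (Var (Suc i))) = glue n (\<lambda>i. e (Suc i)) c" for e
    by (auto simp: fun_eq_iff glue_def)
  then have "\<forall>e. t (\<lambda>i. e (Suc i)) = tval (glue (Suc n) e c) (lift_tm u)"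
    using u by (simp add: tval_tsub)
  then show ?thesis unfolding dterm_def by blast
qed

lemma delta0_subst:
  assumes "delta0 S P" "dterm t"
  shows "delta0 S (\<lambda>e. P (case_nat (t e) e))"
  using assms
proof (rule delta0_dterm_common)
  fix p n c r u
  assume *: "bounded_fm p" "range r \<subseteq> S" "\<And>e. P e \<longleftrightarrow> holds S (glue (Suc n) e c) r p"
    "\<And>e. t e = tval (glue n e c) u"
  have "glue (Suc n) (case_nat x e) c = case_nat x (glue n e c)" for x e
    by (auto simp: glue_def fun_eq_iff split: nat.split)
  moreover have "bounded_fm (instN u p)" using *(1) by (simp add: instN_def bounded_fm_fsub)
  ultimately show ?thesis using *
    by (intro delta0I[of "instN u p" r S _ n c]) simp_all
qed

lemma delta0_rel1: "delta0 S (\<lambda>e. R (e 0)) \<Longrightarrow> dterm t \<Longrightarrow> delta0 S (\<lambda>e. R (t e))"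
  using delta0_subst[of S "\<lambda>e. R (e 0)" t] by simp

text \<open>With this, definability of a relation has to be shown for two variables only; arbitrary
  terms are substituted afterwards.\<close>

lemma delta0_rel2:
  assumes "delta0 S (\<lambda>e. R (e 0) (e (Suc 0)))" "dterm t" "dterm u"
  shows "delta0 S (\<lambda>e. R (t e) (u e))"
  using delta0_subst[OF delta0_subst[OF assms(1) dterm_shift[OF assms(2)]] assms(3)] by simp

locale arithmetic = model_RCA0 S for S :: "'a::linordered_semidom set set"
begin

lemma less_add_one_iff: "x < y + 1 \<longleftrightarrow> x \<le> y" for x y :: 'a
  by (simp add: less_plus_one le_less)

lemma zero_le [simp]: "0 \<le> x" for x :: 'a
  using not_less_zero[of x] by simp

lemma delta0_le [def_intros]: "dterm t \<Longrightarrow> dterm u \<Longrightarrow> delta0 S (\<lambda>e. t e \<le> u e)"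
  unfolding less_add_one_iff[symmetric] by (intro def_intros)

text \<open>Adjacent unbounded quantifiers are merged by a common bound z on both witnesses, which
  leaves bounded quantifiers inside a single unbounded one.\<close>

lemma sigma1_ex:
  assumes "sigma1 S (\<lambda>e. P (e 0) (\<lambda>i. e (Suc i)))"
  shows "sigma1 S (\<lambda>e. \<exists>x. P x e)"
proof -
  obtain Q where Q: "delta0 S Q" "\<And>e. P (e 0) (\<lambda>i. e (Suc i)) \<longleftrightarrow> (\<exists>x. Q (case_nat x e))"
    using assms unfolding sigma1_def by blast
  have P: "P x e \<longleftrightarrow> (\<exists>y. Q (case_nat y (case_nat x e)))" for x e
    using Q(2)[of "case_nat x e"] by simp
  have "(\<exists>x. P x e) \<longleftrightarrow> (\<exists>z. \<exists>x<z. \<exists>y<z. Q (case_nat y (case_nat x e)))" for e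
  proof
    assume "\<exists>x. P x e"
    then obtain x y where "Q (case_nat y (case_nat x e))" using P by blast
    moreover have "x < max x y + 1" "y < max x y + 1" by (simp_all add: less_add_one_iff)
    ultimately show "\<exists>z. \<exists>x<z. \<exists>y<z. Q (case_nat y (case_nat x e))" by blast
  qed (use P in blast)
  moreover have "sigma1 S (\<lambda>e. \<exists>z. \<exists>x<z. \<exists>y<z. Q (case_nat y (case_nat x e)))"
  proof (rule sigma1_ex_delta0, rule delta0_ex, rule dterm_var, rule delta0_ex, rule dterm_var)
    \<comment> \<open>Index 2 holds the bound z, which Q does not mention.\<close>
    define f :: "nat \<Rightarrow> nat" where "f = case_nat 0 (case_nat 1 (\<lambda>i. i + 3))"
    have "case_nat (e 0) (case_nat (e (Suc 0)) (\<lambda>i. e (Suc (Suc (Suc i))))) = (\<lambda>i. e (f i))" for e :: "nat \<Rightarrow> 'a"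
      by (auto simp: f_def fun_eq_iff numeral_3_eq_3 split: nat.split)
    then show "delta0 S (\<lambda>e. Q (case_nat (e 0) (case_nat (e (Suc 0)) (\<lambda>i. e (Suc (Suc (Suc i)))))))"
      using delta0_rename[OF Q(1), of f] by simp
  qed
  ultimately show ?thesis by simp
qed

lemma sigma1_and:
  assumes "sigma1 S P" "sigma1 S P'"
  shows "sigma1 S (\<lambda>e. P e \<and> P' e)"
proof -
  obtain Q where Q: "delta0 S Q" "\<And>e. P e \<longleftrightarrow> (\<exists>x. Q (case_nat x e))"
    using assms(1) unfolding sigma1_def by blast
  obtain Q' where Q': "delta0 S Q'" "\<And>e. P' e \<longleftrightarrow> (\<exists>x. Q' (case_nat x e))"
    using assms(2) unfolding sigma1_def by blast
  have "sigma1 S (\<lambda>e. \<exists>x y. Q (case_nat x e) \<and> Q' (case_nat y e))"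
  proof (intro sigma1_ex sigma1_delta0 delta0_and)
    have "case_nat (e (Suc 0)) (\<lambda>i. e (Suc (Suc i))) = (\<lambda>i. e (Suc i))" for e :: "nat \<Rightarrow> 'a"
      by (auto simp: fun_eq_iff split: nat.split)
    then show "delta0 S (\<lambda>e. Q (case_nat (e (Suc 0)) (\<lambda>i. e (Suc (Suc i)))))"
      using delta0_rename[OF Q(1), of Suc] by simp
    have "case_nat (e 0) (\<lambda>i. e (Suc (Suc i))) = (\<lambda>i. e (case_nat 0 (\<lambda>i. Suc (Suc i)) i))" for e :: "nat \<Rightarrow> 'a"
      by (auto simp: fun_eq_iff split: nat.split)
    then show "delta0 S (\<lambda>e. Q' (case_nat (e 0) (\<lambda>i. e (Suc (Suc i)))))"
      using delta0_rename[OF Q'(1), of "case_nat 0 (\<lambda>i. Suc (Suc i))"] by simp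
  qed
  then show ?thesis using Q(2) Q'(2) by simp
qed

lemma least_delta0:
  assumes "delta0 S (\<lambda>e. P (e 0))" "P x"
  obtains z where "P z" "\<And>y. y < z \<Longrightarrow> \<not> P y"
proof -
  have "\<exists>z. P z \<and> (\<forall>y<z. \<not> P y)"
  proof (rule ccontr)
    assume *: "\<not> (\<exists>z. P z \<and> (\<forall>y<z. \<not> P y))"
    have "\<forall>y<x + 1. \<not> P y"
    proof (rule delta0_induct[where P = "\<lambda>b. \<forall>y<b. \<not> P y"])
      show "delta0 S (\<lambda>e. \<forall>y<e 0. \<not> P y)"
        by (intro def_intros delta0_rel1[OF assms(1)])
      show "\<forall>y<b + 1. \<not> P y" if "\<forall>y<b. \<not> P y" for b
        using that * by (auto simp: less_plus_one)
    qed (simp add: not_less_zero)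
    with assms(2) show False by (simp add: less_plus_one)
  qed
  with that show ?thesis by blast
qed

text \<open>Induction on the negation of P would concern a Pi predicate. Instead the induction runs
  over the distance j descended from k, and the position i that has been reached is quantified
  existentially.\<close>

lemma sigma1_descend:
  assumes "sigma1 S (\<lambda>e. P (e 0))" "\<And>x. P (x + 1) \<Longrightarrow> P x" "P k"
  shows "P 0"
proof -
  \<comment> \<open>At distance k the only possible position is 0. The disjunct with k below the
    distance carries the induction past k.\<close>
  have "\<exists>i. (i + k = k \<or> k < k) \<and> P i"
  proof (rule sigma1_induct[where P = "\<lambda>j. \<exists>i. (i + j = k \<or> k < j) \<and> P i"])
    show "sigma1 S (\<lambda>e. \<exists>i. (i + e 0 = k \<or> k < e 0) \<and> P i)"
      by (rule sigma1_ex, rule sigma1_and, rule sigma1_delta0, intro def_intros, rule assms(1))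
    show "\<exists>i. (i + 0 = k \<or> k < 0) \<and> P i" using assms(3) by auto
    show "\<exists>i. (i + (j + 1) = k \<or> k < j + 1) \<and> P i" if "\<exists>i. (i + j = k \<or> k < j) \<and> P i" for j
    proof -
      obtain i where i: "i + j = k \<or> k < j" "P i" using \<open>\<exists>i. (i + j = k \<or> k < j) \<and> P i\<close> by blast
      show ?thesis
      proof (cases "k \<le> j")
        case True
        with i show ?thesis by (auto simp: less_add_one_iff)
      next
        case False
        with i have "i + j = k" "i \<noteq> 0" by auto
        then obtain i' where "i = i' + 1" using zero_or_plus_one[of i] by blast
        with i \<open>i + j = k\<close> assms(2)[of i'] show ?thesis by (auto simp: ac_simps)
      qed
    qed
  qed
  then show ?thesis by auto
qed


section \<open>Coding of finite sets\<close>

definition pr :: "'a \<Rightarrow> 'a \<Rightarrow> 'a" where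
  "pr x y = (x + y) * (x + y) + x"

lemma dterm_pr [def_intros]: "dterm t \<Longrightarrow> dterm u \<Longrightarrow> dterm (\<lambda>e. pr (t e) (u e))"
  unfolding pr_def by (intro def_intros)

lemma le_square: "x \<le> x * x" for x :: 'a
  using zero_or_plus_one[of x] by (auto simp: distrib_left distrib_right)

lemma pr_le: "x \<le> pr x y" "y \<le> pr x y"
proof -
  have "x + y \<le> pr x y" unfolding pr_def using le_square[of "x + y"] by (metis add_increasing2 zero_le)
  then show "x \<le> pr x y" "y \<le> pr x y" by (metis add_increasing2 add_increasing order_trans order_refl zero_le)+
qed

text \<open>A pair lies between the square of \<open>x + y\<close> and the next square, so the sum,
  and then x, can be recovered from it.\<close>

lemma pr_less: "x + y < x' + y' \<Longrightarrow> pr x y < pr x' y'"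
proof -
  assume "x + y < x' + y'"
  then obtain d where d: "x' + y' = (x + y) + 1 + d"
    by (auto simp: less_iff_plus ac_simps)
  have "pr x y < (x + y + 1) * (x + y + 1)"
  proof -
    have "(x + y + 1) * (x + y + 1) = pr x y + (x + y + y + 1)"
      by (simp add: pr_def algebra_simps)
    then show ?thesis unfolding less_iff_plus by blast
  qed
  also have "\<dots> \<le> (x' + y') * (x' + y')" unfolding d by (rule mult_mono) (simp_all add: add_increasing)
  also have "\<dots> \<le> pr x' y'" by (simp add: pr_def)
  finally show ?thesis .
qed

lemma pr_inject [simp]: "pr x y = pr x' y' \<longleftrightarrow> x = x' \<and> y = y'"
proof
  assume eq: "pr x y = pr x' y'"
  have "x + y = x' + y'"
    using pr_less[of x y x' y'] pr_less[of x' y' x y] eq by (metis less_irrefl linorder_neqE)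
  with eq show "x = x' \<and> y = y'" by (auto simp: pr_def)
qed simp

definition code :: "'a \<Rightarrow> 'a set" where
  "code c = {i. \<exists>k m n q. c = pr (pr k m) n \<and> i < k \<and> n = q * (m * (i + 1) + 1)}"

lemma code_bound: "i \<in> code c \<Longrightarrow> i < c"
  unfolding code_def using pr_le(1) by (blast intro: less_le_trans order_trans)

lemma le_times_plus_one: "q \<le> q * (m + 1)" for q m :: 'a
  by (simp add: distrib_left add_increasing)

text \<open>All four witnesses are at most the code: three are components of pairs, and q is at most
  n because the modulus is a successor.\<close>

lemma delta0_code [def_intros]:
  assumes "dterm t" "dterm u"
  shows "delta0 S (\<lambda>e. t e \<in> code (u e))"
proof (rule delta0_rel2[OF _ assms])
  have "i \<in> code c \<longleftrightarrow> (\<exists>k<c + 1. \<exists>m<c + 1. \<exists>n<c + 1. \<exists>q<c + 1.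
      c = pr (pr k m) n \<and> i < k \<and> n = q * (m * (i + 1) + 1))" for i c
  proof
    assume "i \<in> code c"
    then obtain k m n q where *: "c = pr (pr k m) n" "i < k" "n = q * (m * (i + 1) + 1)"
      unfolding code_def by blast
    have "n \<le> c" "k \<le> c" "m \<le> c" unfolding *(1) using pr_le order_trans by blast+
    moreover have "q \<le> c" using \<open>n \<le> c\<close> le_times_plus_one[of q "m * (i + 1)"] *(3) by simp
    ultimately show "\<exists>k<c + 1. \<exists>m<c + 1. \<exists>n<c + 1. \<exists>q<c + 1.
      c = pr (pr k m) n \<and> i < k \<and> n = q * (m * (i + 1) + 1)"
      using * unfolding less_add_one_iff by blast
  qed (auto simp: code_def)
  then show "delta0 S (\<lambda>e. e 0 \<in> code (e (Suc 0)))"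
    by (simp only:) (intro def_intros)
qed

definition isfin :: "'a \<Rightarrow> bool" where
  "isfin c \<longleftrightarrow> (\<forall>c'<c. code c' \<noteq> code c)"

lemma isfin_inject: "isfin c \<Longrightarrow> isfin d \<Longrightarrow> code c = code d \<Longrightarrow> c = d"
  unfolding isfin_def by (metis linorder_neqE)

text \<open>Both coded sets lie below c, so their equality needs bounded quantifiers only.\<close>

lemma delta0_isfin [def_intros]: "dterm t \<Longrightarrow> delta0 S (\<lambda>e. isfin (t e))"
proof (rule delta0_rel1)
  have "isfin c \<longleftrightarrow> (\<forall>c'<c. \<not> (\<forall>i<c. i \<in> code c' \<longleftrightarrow> i \<in> code c))" for c
  proof -
    have "code c' = code c \<longleftrightarrow> (\<forall>i<c. i \<in> code c' \<longleftrightarrow> i \<in> code c)" if "c' < c" for c'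
      using that by (auto dest: code_bound less_trans)
    then show ?thesis unfolding isfin_def by blast
  qed
  then show "delta0 S (\<lambda>e. isfin (e 0))" by (simp only:) (intro def_intros)
qed

lemma code_in_S: "code c \<in> S"
proof -
  have "{x. x \<in> code c} \<in> S" by (rule comprehension; rule sigma1_delta0; intro def_intros)
  then show ?thesis by simp
qed

text \<open>Takes the place of the factorial in Goedel's coding: for such m the moduli
  \<open>m * (i + 1) + 1\<close> with i below k are pairwise coprime. In the proof the quotients are
  bounded to keep the induction formula Sigma.\<close>

lemma common_multiple: "\<exists>m. 0 < m \<and> (\<forall>i<k. i + 1 dvd m)" for k :: 'a
proof -
  have "\<exists>m. 0 < m \<and> (\<forall>i<k. \<exists>q<m + 1. m = (i + 1) * q)"
  proof (rule sigma1_induct[where P = "\<lambda>k. \<exists>m. 0 < m \<and> (\<forall>i<k. \<exists>q<m + 1. m = (i + 1) * q)"])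
    show "sigma1 S (\<lambda>e. \<exists>m. 0 < m \<and> (\<forall>i<e 0. \<exists>q<m + 1. m = (i + 1) * q))"
      by (rule sigma1_ex_delta0, intro def_intros)
    show "\<exists>m. 0 < m \<and> (\<forall>i<0::'a. \<exists>q<m + 1. m = (i + 1) * q)"
      by (intro exI[of _ 1]) (simp add: not_less_zero)
    fix k :: 'a
    assume "\<exists>m. 0 < m \<and> (\<forall>i<k. \<exists>q<m + 1. m = (i + 1) * q)"
    then obtain m where m: "0 < m" "\<forall>i<k. \<exists>q<m + 1. m = (i + 1) * q" by blast
    have "\<exists>q<m * (k + 1) + 1. m * (k + 1) = (i + 1) * q" if "i < k + 1" for i
    proof -
      have "i + 1 dvd m * (k + 1)"
      proof (cases "i = k")
        case False
        with that m(2) have "i + 1 dvd m" by (auto simp: less_plus_one[of i] dvd_def)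
        then show ?thesis by (rule dvd_mult2)
      qed simp
      then obtain q where q: "m * (k + 1) = (i + 1) * q" by (auto simp: dvd_def)
      then have "q \<le> m * (k + 1)" using le_times_plus_one[of q i] by (simp add: mult.commute)
      with q show ?thesis unfolding less_add_one_iff by blast
    qed
    moreover have "0 < m * (k + 1)" using m(1) by (simp add: add_nonneg_pos)
    ultimately show "\<exists>m. 0 < m \<and> (\<forall>i<k + 1. \<exists>q<m + 1. m = (i + 1) * q)" by blast
  qed
  then show ?thesis by (auto simp: dvd_def)
qed

text \<open>Coprimality of the moduli d_i, argued by divisibility alone. The difference of (j + 1)
  d_i and (i + 1) d_j is j - i, up to sign a divisor of m. Hence d_i divides n times that distance,
  so also n m, and n d_i = n m (i + 1) + n gives the claim.\<close>

lemma dvd_cancel_modulus: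
  fixes m :: 'a
  assumes m: "\<forall>i<k. i + 1 dvd m" and "i < k" "j < k" "i \<noteq> j"
    and dvd: "m * (i + 1) + 1 dvd n * (m * (j + 1) + 1)"
  shows "m * (i + 1) + 1 dvd n"
proof -
  let ?di = "m * (i + 1) + 1" and ?dj = "m * (j + 1) + 1"
  \<comment> \<open>The witness is the distance of i and j; there are two cases for want of negative
    numbers.\<close>
  have "\<exists>s. s dvd m \<and> ?di dvd n * s"
  proof (cases "i < j")
    case True
    then obtain s where s: "j = i + (s + 1)" by (auto simp: less_iff_plus)
    then have "s < k" using \<open>j < k\<close> by (metis add.commute add_strict_increasing less_trans not_less_zero
          less_add_one_iff linorder_not_less add_increasing order_refl zero_le less_plus_one)
    then have "s + 1 dvd m" using m by blast
    moreover have "n * ((j + 1) * ?di) = n * ?dj * (i + 1) + n * (s + 1)"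
      by (simp add: s algebra_simps)
    then have "?di dvd n * ?dj * (i + 1) + n * (s + 1)"
      by (metis dvd_triv_right dvd_mult)
    then have "?di dvd n * (s + 1)" using dvd_add_right_iff[OF dvd_mult2[OF dvd]] by blast
    ultimately show ?thesis by blast
  next
    case False
    with \<open>i \<noteq> j\<close> have "j < i" by simp
    then obtain s where s: "i = j + (s + 1)" by (auto simp: less_iff_plus)
    then have "s < k" using \<open>i < k\<close> by (metis add.commute add_strict_increasing less_trans not_less_zero
          less_add_one_iff linorder_not_less add_increasing order_refl zero_le less_plus_one)
    then have "s + 1 dvd m" using m by blast
    moreover have "n * ?dj * (i + 1) = n * (j + 1) * ?di + n * (s + 1)"
      by (simp add: s algebra_simps)
    then have "?di dvd n * (j + 1) * ?di + n * (s + 1)"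
      using dvd_mult2[OF dvd] by metis
    then have "?di dvd n * (s + 1)" by (metis dvd_add_right_iff dvd_triv_right)
    ultimately show ?thesis by blast
  qed
  then obtain s t where "m = s * t" "?di dvd n * s" by (auto simp: dvd_def)
  then have "?di dvd n * m * (i + 1)" by (metis dvd_mult2 mult.assoc)
  moreover have "n * ?di = n * m * (i + 1) + n" by (simp add: algebra_simps)
  ultimately show ?thesis by (metis dvd_add_right_iff dvd_triv_right)
qed

text \<open>The number n of the code is the product of the moduli of the elements of A. It is built
  by induction on j, taking in the elements below j.\<close>

lemma ex_code:
  assumes "A \<in> S" and bound: "\<And>x. x \<in> A \<Longrightarrow> x < k"
  obtains c where "isfin c" "code c = A"
proof -
  obtain m where m: "0 < m" "\<forall>i<k. i + 1 dvd m" using common_multiple by blast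
  define d where "d i = m * (i + 1) + 1" for i
  have "\<exists>n. 0 < n \<and> (\<forall>i<k. (\<exists>q<n + 1. n = q * (m * (i + 1) + 1)) \<longleftrightarrow> i \<in> A \<and> i < k)"
  proof (rule sigma1_induct[where P = "\<lambda>j. \<exists>n. 0 < n \<and> (\<forall>i<k. (\<exists>q<n + 1. n = q * (m * (i + 1) + 1)) \<longleftrightarrow> i \<in> A \<and> i < j)"])
    show "sigma1 S (\<lambda>e. \<exists>n. 0 < n \<and> (\<forall>i<k. (\<exists>q<n + 1. n = q * (m * (i + 1) + 1)) \<longleftrightarrow> i \<in> A \<and> i < e 0))"
      by (rule sigma1_ex_delta0, intro def_intros assms(1))
    have dvd: "(\<exists>q<n + 1. n = q * (m * (i + 1) + 1)) \<longleftrightarrow> d i dvd n" for n i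
    proof -
      have "q < n + 1" if "n = q * (m * (i + 1) + 1)" for q
        using le_times_plus_one[of q "m * (i + 1)"] that by (simp add: less_add_one_iff)
      then show ?thesis unfolding d_def dvd_def by (auto simp: mult.commute)
    qed
    show "\<exists>n. 0 < n \<and> (\<forall>i<k. (\<exists>q<n + 1. n = q * (m * (i + 1) + 1)) \<longleftrightarrow> i \<in> A \<and> i < 0)"
    proof (intro exI[of _ 1] conjI allI impI)
      fix i
      \<comment> \<open>Positivity of m makes every modulus exceed 1, so none of them divides the
        empty product.\<close>
      have "1 < d i" unfolding d_def using m(1) by (simp add: add_nonneg_pos)
      then have "\<not> d i dvd 1" by (auto simp: dvd_def dest!: sym[of 1]) (metis zero_or_plus_one le_times_plus_one mult.commute mult_zero_left not_less zero_neq_one)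
      then show "(\<exists>q<1 + 1. 1 = q * (m * (i + 1) + 1)) \<longleftrightarrow> i \<in> A \<and> i < 0"
        unfolding dvd by (simp add: not_less_zero)
    qed simp
    fix j
    assume "\<exists>n. 0 < n \<and> (\<forall>i<k. (\<exists>q<n + 1. n = q * (m * (i + 1) + 1)) \<longleftrightarrow> i \<in> A \<and> i < j)"
    then obtain n where n: "0 < n" "\<forall>i<k. d i dvd n \<longleftrightarrow> i \<in> A \<and> i < j" unfolding dvd by blast
    show "\<exists>n. 0 < n \<and> (\<forall>i<k. (\<exists>q<n + 1. n = q * (m * (i + 1) + 1)) \<longleftrightarrow> i \<in> A \<and> i < j + 1)"
      unfolding dvd
    proof (cases "j \<in> A")
      case True
      then have "j < k" by (rule bound)
      have "d i dvd n * d j \<longleftrightarrow> i \<in> A \<and> i < j + 1" if "i < k" for i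
      proof (cases "i = j")
        case True
        with \<open>j \<in> A\<close> show ?thesis by (simp add: less_plus_one)
      next
        case False
        have "d i dvd n * d j \<longleftrightarrow> d i dvd n"
          using dvd_cancel_modulus[OF m(2) that \<open>j < k\<close> False, of n] dvd_mult2[of "d i" n "d j"]
          unfolding d_def by blast
        also have "\<dots> \<longleftrightarrow> i \<in> A \<and> i < j" using n(2) that by blast
        finally show ?thesis using False by (simp add: less_plus_one)
      qed
      moreover have "0 < n * d j" unfolding d_def using n(1) by (simp add: add_nonneg_pos)
      ultimately show "\<exists>n. 0 < n \<and> (\<forall>i<k. d i dvd n \<longleftrightarrow> i \<in> A \<and> i < j + 1)" by blast
    next
      case False
      with n show "\<exists>n. 0 < n \<and> (\<forall>i<k. d i dvd n \<longleftrightarrow> i \<in> A \<and> i < j + 1)"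
        by (auto simp: less_plus_one intro!: exI[of _ n])
    qed
  qed
  then obtain n where n: "\<forall>i<k. (\<exists>q<n + 1. n = q * (m * (i + 1) + 1)) \<longleftrightarrow> i \<in> A \<and> i < k" by blast
  have "q < n + 1" if "n = q * (m * (i + 1) + 1)" for q i
    using le_times_plus_one[of q "m * (i + 1)"] that by (simp add: less_add_one_iff)
  then have "i \<in> code (pr (pr k m) n) \<longleftrightarrow> i < k \<and> (\<exists>q<n + 1. n = q * (m * (i + 1) + 1))" for i
    unfolding code_def by auto
  then have "code (pr (pr k m) n) = A"
    using n bound by blast
  \<comment> \<open>Both sets are bounded, so being a code of A is a bounded condition and a least
    code exists.\<close>
  moreover have "code c = A \<longleftrightarrow> (\<forall>x<c. x \<in> code c \<longrightarrow> x \<in> A) \<and> (\<forall>x<k. x \<in> A \<longrightarrow> x \<in> code c)" for c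
    using code_bound bound by blast
  then have "delta0 S (\<lambda>e. code (e 0) = A)"
    by (simp only:) (intro def_intros assms(1))
  ultimately obtain c where "code c = A" "\<And>c'. c' < c \<Longrightarrow> code c' \<noteq> A"
    using least_delta0[of "\<lambda>c. code c = A"] by blast
  then show ?thesis using that by (auto simp: isfin_def)
qed

lemma ex_code_delta0:
  assumes "delta0 S (\<lambda>e. P (e 0))" and "\<And>x. P x \<Longrightarrow> x < k"
  obtains c where "isfin c" "code c = {x. P x}"
proof (rule ex_code)
  have "delta0 S (\<lambda>e. \<not> P (e 0))" using assms(1) by (rule delta0_not)
  with assms(1) show "{x. P x} \<in> S" by (intro comprehension sigma1_delta0)
qed (use assms(2) that in auto)


section \<open>The pigeonhole principle\<close>

text \<open>The existence of a coded counterexample is a Sigma predicate, so it is carried down from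
  \<open>k + 1\<close> to k by \<open>sigma1_descend\<close> until no hole is left.\<close>

lemma pigeonhole_code:
  "\<not> (\<exists>u. (\<forall>i<k + 1. \<exists>x<k. pr i x \<in> code u) \<and>
        (\<forall>i<k + 1. \<forall>i'<k + 1. \<forall>x<k. pr i x \<in> code u \<and> pr i' x \<in> code u \<longrightarrow> i = i'))"
  (is "\<not> ?P k")
proof
  assume "?P k"
  then have "?P 0"
  proof (rule sigma1_descend[where P = ?P, rotated -1])
    show "sigma1 S (\<lambda>e. ?P (e 0))"
      by (rule sigma1_ex_delta0, intro def_intros)
    fix k
    assume "?P (k + 1)"
    then obtain u where total: "\<And>i. i < k + 1 + 1 \<Longrightarrow> \<exists>x<k + 1. pr i x \<in> code u"
      and inj: "\<And>i i' x. i < k + 1 + 1 \<Longrightarrow> i' < k + 1 + 1 \<Longrightarrow> x < k + 1 \<Longrightarrow>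
        pr i x \<in> code u \<Longrightarrow> pr i' x \<in> code u \<Longrightarrow> i = i'"
      by blast
    \<comment> \<open>A pigeon in the last hole k moves to a hole of pigeon \<open>k + 1\<close>,
      which is dropped.\<close>
    define R where "R i x \<longleftrightarrow> pr i x \<in> code u \<or> pr i k \<in> code u \<and> pr (k + 1) x \<in> code u" for i x
    obtain v where v: "code v = {z. \<exists>i<k + 1. \<exists>x<k. z = pr i x \<and> (pr i x \<in> code u \<or> pr i k \<in> code u \<and> pr (k + 1) x \<in> code u)}"
    proof (rule ex_code_delta0)
      show "delta0 S (\<lambda>e. \<exists>i<k + 1. \<exists>x<k. e 0 = pr i x \<and> (pr i x \<in> code u \<or> pr i k \<in> code u \<and> pr (k + 1) x \<in> code u))"
        by (intro def_intros)
      show "z < pr (k + 1) k"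
        if "\<exists>i<k + 1. \<exists>x<k. z = pr i x \<and> (pr i x \<in> code u \<or> pr i k \<in> code u \<and> pr (k + 1) x \<in> code u)" for z
        using that by (auto intro!: pr_less add_strict_mono)
    qed
    have v_iff: "pr i x \<in> code v \<longleftrightarrow> R i x" if "i < k + 1" "x < k" for i x
      using that by (auto simp: v R_def)
    have lt: "i < k + 1 + 1" if "i < k + 1" for i using that by (simp add: less_plus_one[of _ "k + 1"])
    have "\<exists>x<k. pr i x \<in> code v" if i: "i < k + 1" for i
    proof -
      obtain x where x: "x < k + 1" "pr i x \<in> code u" using total[OF lt[OF i]] by blast
      show ?thesis
      proof (cases "x < k")
        case True
        with x show ?thesis using v_iff i by (auto simp: R_def)
      next
        case False
        then have "x = k" using x(1) by (simp add: less_plus_one)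
        obtain y where y: "y < k + 1" "pr (k + 1) y \<in> code u" using total[of "k + 1"] by (auto simp: less_plus_one)
        have "y \<noteq> k"
        proof
          assume "y = k"
          then have "i = k + 1" using inj[OF lt[OF i], of "k + 1" k] x y \<open>x = k\<close> by (simp add: less_plus_one)
          with i show False by simp
        qed
        with y have "y < k" by (simp add: less_plus_one)
        moreover have "R i y" using x y \<open>x = k\<close> by (simp add: R_def)
        ultimately show ?thesis using v_iff[OF i] by blast
      qed
    qed
    moreover have "i = i'" if i: "i < k + 1" and i': "i' < k + 1" and x: "x < k"
      and "pr i x \<in> code v" "pr i' x \<in> code v" for i i' x
    proof -
      have "R i x" "R i' x" using that v_iff by blast+
      moreover have "k < k + 1" "x < k + 1" "k + 1 < k + 1 + 1" using x by (simp_all add: less_plus_one)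
      moreover have "i \<noteq> k + 1" "i' \<noteq> k + 1" using i i' by auto
      ultimately show ?thesis unfolding R_def using inj lt[OF i] lt[OF i'] by metis
    qed
    ultimately show "?P k" by blast
  qed
  then show False by (auto simp: not_less_zero dest: spec[of _ 0])
qed

text \<open>Only a bounded part of the unbounded set D enters: \<open>b + 1\<close> of its elements
  are listed by a code, and composing the list with R would place them into b holes.\<close>

lemma pigeonhole:
  assumes "D \<in> S" "R \<in> S"
    and unbounded: "\<And>b. \<exists>n\<in>D. b \<le> n"
    and total: "\<And>n. n \<in> D \<Longrightarrow> \<exists>x<b. pr n x \<in> R"
    and inj: "\<And>n n' x. n \<in> D \<Longrightarrow> n' \<in> D \<Longrightarrow> x < b \<Longrightarrow> pr n x \<in> R \<Longrightarrow> pr n' x \<in> R \<Longrightarrow> n = n'"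
  shows False
proof -
  have enum: "\<exists>u. (\<forall>i<k. \<exists>n<u. n \<in> D \<and> pr i n \<in> code u) \<and>
      (\<forall>i<k. \<forall>i'<k. \<forall>n<u. pr i n \<in> code u \<and> pr i' n \<in> code u \<longrightarrow> i = i')" (is "?E k") for k
  proof (rule sigma1_induct[where P = ?E])
    show "sigma1 S (\<lambda>e. ?E (e 0))"
      by (rule sigma1_ex_delta0, intro def_intros assms(1))
    show "?E 0" by (simp add: not_less_zero)
    fix k
    assume "?E k"
    then obtain u where u: "\<And>i. i < k \<Longrightarrow> \<exists>n<u. n \<in> D \<and> pr i n \<in> code u"
      "\<And>i i' n. i < k \<Longrightarrow> i' < k \<Longrightarrow> n < u \<Longrightarrow> pr i n \<in> code u \<Longrightarrow> pr i' n \<in> code u \<Longrightarrow> i = i'"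
      by blast
    \<comment> \<open>All listed elements are below u, so an element of D from u on is new.\<close>
    obtain m where m: "m \<in> D" "u \<le> m" using unbounded by blast
    obtain v where v: "code v = {z. (\<exists>i<k. \<exists>n<u. z = pr i n \<and> pr i n \<in> code u) \<or> z = pr k m}"
    proof (rule ex_code_delta0)
      show "delta0 S (\<lambda>e. (\<exists>i<k. \<exists>n<u. e 0 = pr i n \<and> pr i n \<in> code u) \<or> e 0 = pr k m)"
        by (intro def_intros)
      show "z < pr k m + 1" if "(\<exists>i<k. \<exists>n<u. z = pr i n \<and> pr i n \<in> code u) \<or> z = pr k m" for z
      proof -
        have "pr i n < pr k m" if "i < k" "n < u" for i n
          using that m(2) by (intro pr_less add_strict_mono) simp_all
        with that show ?thesis by (auto simp: less_plus_one)
      qed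
    qed
    have v_iff: "pr i n \<in> code v \<longleftrightarrow> (i < k \<and> n < u \<and> pr i n \<in> code u) \<or> i = k \<and> n = m" for i n
      by (auto simp: v)
    have lt: "n < v" if "pr i n \<in> code v" for i n
      using code_bound[OF that] pr_le(2)[of n i] by (rule le_less_trans[rotated])
    have "\<exists>n<v. n \<in> D \<and> pr i n \<in> code v" if "i < k + 1" for i
    proof (cases "i < k")
      case True
      then obtain n where "n < u" "n \<in> D" "pr i n \<in> code u" using u(1) by blast
      then have "pr i n \<in> code v" using v_iff True by blast
      with \<open>n \<in> D\<close> lt show ?thesis by blast
    next
      case False
      then have "pr i m \<in> code v" using that v_iff by (simp add: less_plus_one)
      with m(1) lt show ?thesis by blast
    qed
    moreover have "i = i'" if "pr i n \<in> code v" "pr i' n \<in> code v" for i i' n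
      using that u(2) m(2) unfolding v_iff by (metis not_less)
    ultimately show "?E (k + 1)" by blast
  qed
  obtain u where u: "\<And>i. i < b + 1 \<Longrightarrow> \<exists>n<u. n \<in> D \<and> pr i n \<in> code u"
    "\<And>i i' n. i < b + 1 \<Longrightarrow> i' < b + 1 \<Longrightarrow> n < u \<Longrightarrow> pr i n \<in> code u \<Longrightarrow> pr i' n \<in> code u \<Longrightarrow> i = i'"
    using enum[of "b + 1"] by blast
  obtain v where v: "code v = {z. \<exists>i<b + 1. \<exists>x<b. z = pr i x \<and> (\<exists>n<u. n \<in> D \<and> pr i n \<in> code u \<and> pr n x \<in> R)}"
  proof (rule ex_code_delta0)
    show "delta0 S (\<lambda>e. \<exists>i<b + 1. \<exists>x<b. e 0 = pr i x \<and> (\<exists>n<u. n \<in> D \<and> pr i n \<in> code u \<and> pr n x \<in> R))"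
      by (intro def_intros assms)
    show "z < pr (b + 1) b" if "\<exists>i<b + 1. \<exists>x<b. z = pr i x \<and> (\<exists>n<u. n \<in> D \<and> pr i n \<in> code u \<and> pr n x \<in> R)" for z
      using that by (auto intro!: pr_less add_strict_mono)
  qed
  have v_iff: "pr i x \<in> code v \<longleftrightarrow> (\<exists>n<u. n \<in> D \<and> pr i n \<in> code u \<and> pr n x \<in> R)" if "i < b + 1" "x < b" for i x
    using that by (auto simp: v)
  have "\<exists>x<b. pr i x \<in> code v" if i: "i < b + 1" for i
  proof -
    obtain n where n: "n < u" "n \<in> D" "pr i n \<in> code u" using u(1)[OF i] by blast
    then obtain x where "x < b" "pr n x \<in> R" using total by blast
    then show ?thesis using v_iff[OF i] n by blast
  qed
  moreover have "i = i'" if "i < b + 1" "i' < b + 1" "x < b" "pr i x \<in> code v" "pr i' x \<in> code v" for i i' x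
    using that v_iff inj u(2) by metis
  ultimately show False using pigeonhole_code[of b] by blast
qed

end

section \<open>Meaning of formulas in higher-order abstract syntax\<close>

text \<open>
  A world consists of the current numbers of number and set quantifiers and the environments at
  this depth; it is extended by passing under further quantifiers. An expression has a meaning at a
  world if it has this meaning at all extensions.
\<close>

type_synonym 'a world = "nat \<times> nat \<times> (nat \<Rightarrow> 'a) \<times> (nat \<Rightarrow> 'a set)"

definition extends :: "'a world \<Rightarrow> 'a world \<Rightarrow> bool" where
  "extends = (\<lambda>(m', k', e', r') (m, k, e, r). m \<le> m' \<and> k \<le> k' \<and>
     (\<forall>i. e' (i + (m' - m)) = e i) \<and> (\<forall>i. r' (i + (k' - k)) = r i))"

lemma extends_refl: "extends w w"
  by (auto simp: extends_def)

lemma extends_trans: "extends w'' w' \<Longrightarrow> extends w' w \<Longrightarrow> extends w'' w"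
proof (cases w, cases w', cases w'')
  fix m k e r m' k' e' r' m'' k'' e'' r''
  assume w: "w = (m, k, e, r)" "w' = (m', k', e', r')" "w'' = (m'', k'', e'', r'')"
    and "extends w'' w'" "extends w' w"
  then have *: "m \<le> m'" "k \<le> k'" "m' \<le> m''" "k' \<le> k''"
    "\<And>i. e'' (i + (m'' - m')) = e' i" "\<And>i. e' (i + (m' - m)) = e i"
    "\<And>i. r'' (i + (k'' - k')) = r' i" "\<And>i. r' (i + (k' - k)) = r i"
    by (auto simp: extends_def)
  have eq: "i + (m'' - m) = i + (m' - m) + (m'' - m')" "i + (k'' - k) = i + (k' - k) + (k'' - k')" for i
    using *(1-4) by simp_all
  have "e'' (i + (m'' - m)) = e i" "r'' (i + (k'' - k)) = r i" for i
    unfolding eq by (simp_all only: *)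
  then show "extends w'' w" unfolding w extends_def using *(1-4) by simp
qed

context arithmetic
begin

definition Tm :: "'a world \<Rightarrow> nterm \<Rightarrow> 'a \<Rightarrow> bool" where
  "Tm w t a \<longleftrightarrow> (\<forall>m k e r. extends (m, k, e, r) w \<longrightarrow> tval e (t m) = a)"

definition St :: "'a world \<Rightarrow> sterm \<Rightarrow> 'a set \<Rightarrow> bool" where
  "St w X A \<longleftrightarrow> (\<forall>m k e r. extends (m, k, e, r) w \<longrightarrow> r (X k) = A)"

definition Fm :: "'a world \<Rightarrow> form \<Rightarrow> bool \<Rightarrow> bool" where
  "Fm w F P \<longleftrightarrow> (\<forall>m k e r. extends (m, k, e, r) w \<longrightarrow> (holds S e r (F m k) \<longleftrightarrow> P))"

text \<open>The quantification over extensions is that of implication in a Kripke model: a class may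
  be applied to variables that are bound further inside.\<close>

definition Cl :: "'a world \<Rightarrow> cls \<Rightarrow> 'a set \<Rightarrow> bool" where
  "Cl w C A \<longleftrightarrow> (\<forall>w' t a. extends w' w \<longrightarrow> Tm w' t a \<longrightarrow> Fm w' (C t) (a \<in> A))"

definition Rl :: "'a world \<Rightarrow> (nterm \<Rightarrow> nterm \<Rightarrow> form) \<Rightarrow> ('a \<Rightarrow> 'a \<Rightarrow> bool) \<Rightarrow> bool" where
  "Rl w L R \<longleftrightarrow> (\<forall>w' t a u b. extends w' w \<longrightarrow> Tm w' t a \<longrightarrow> Tm w' u b \<longrightarrow> Fm w' (L t u) (R a b))"

lemma Tm_mono: "extends w' w \<Longrightarrow> Tm w t a \<Longrightarrow> Tm w' t a"
  unfolding Tm_def using extends_trans by blast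

lemma St_mono: "extends w' w \<Longrightarrow> St w X A \<Longrightarrow> St w' X A"
  unfolding St_def using extends_trans by blast

lemma Cl_mono: "extends w' w \<Longrightarrow> Cl w C A \<Longrightarrow> Cl w' C A"
  unfolding Cl_def using extends_trans by blast

lemma Rl_mono: "extends w' w \<Longrightarrow> Rl w L R \<Longrightarrow> Rl w' L R"
  unfolding Rl_def using extends_trans by blast

lemmas mono_rules = Tm_mono St_mono Cl_mono Rl_mono

named_theorems fm_intros

lemma Tm_basic [fm_intros]:
  "Tm w \<^bold>0 0"
  "Tm w \<^bold>1 1"
  "Tm w t a \<Longrightarrow> Tm w u b \<Longrightarrow> Tm w (t \<^bold>+ u) (a + b)"
  "Tm w t a \<Longrightarrow> Tm w u b \<Longrightarrow> Tm w (t \<^bold>* u) (a * b)"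
  by (simp_all add: Tm_def nt_zero_def nt_one_def nt_plus_def nt_times_def)

lemma Tm_pair [fm_intros]: "Tm w t a \<Longrightarrow> Tm w u b \<Longrightarrow> Tm w (pair t u) (pr a b)"
  unfolding pair_def pr_def by (intro Tm_basic)

lemma Fm_basic [fm_intros]:
  "Tm w t a \<Longrightarrow> Tm w u b \<Longrightarrow> Fm w (t \<^bold>= u) (a = b)"
  "Tm w t a \<Longrightarrow> Tm w u b \<Longrightarrow> Fm w (t \<^bold>< u) (a < b)"
  "Tm w t a \<Longrightarrow> St w X A \<Longrightarrow> Fm w (t \<^bold>\<in> X) (a \<in> A)"
  "Fm w F P \<Longrightarrow> Fm w (\<^bold>\<not> F) (\<not> P)"
  "Fm w F P \<Longrightarrow> Fm w G Q \<Longrightarrow> Fm w (F \<^bold>\<and> G) (P \<and> Q)"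
  "Fm w F P \<Longrightarrow> Fm w G Q \<Longrightarrow> Fm w (F \<^bold>\<or> G) (P \<or> Q)"
  "Fm w F P \<Longrightarrow> Fm w G Q \<Longrightarrow> Fm w (F \<^bold>\<longrightarrow> G) (P \<longrightarrow> Q)"
  "Fm w F P \<Longrightarrow> Fm w G Q \<Longrightarrow> Fm w (F \<^bold>\<longleftrightarrow> G) (P \<longleftrightarrow> Q)"
  by (auto simp: Tm_def St_def Fm_def f_eq_def f_less_def f_mem_def f_not_def f_and_def f_or_def f_imp_def f_iff_def)

lemma extends_bindN:
  assumes "extends (m, k, e, r) w"
  shows "extends (Suc m, k, case_nat a e, r) w" and "Tm (Suc m, k, case_nat a e, r) (\<lambda>m'. Var (m' - Suc m)) a"
proof -
  have "extends (Suc m, k, case_nat a e, r) (m, k, e, r)" by (simp add: extends_def)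
  then show "extends (Suc m, k, case_nat a e, r) w" using assms by (rule extends_trans)
  have "e' (m' - Suc m) = a" if "\<forall>i. e' (i + (m' - Suc m)) = case_nat a e i" for e' m'
    using that[rule_format, of 0] by simp
  then show "Tm (Suc m, k, case_nat a e, r) (\<lambda>m'. Var (m' - Suc m)) a"
    by (auto simp: Tm_def extends_def)
qed

lemma extends_bindS:
  assumes "extends (m, k, e, r) w"
  shows "extends (m, Suc k, e, case_nat A r) w" and "St (m, Suc k, e, case_nat A r) (\<lambda>k'. k' - Suc k) A"
proof -
  have "extends (m, Suc k, e, case_nat A r) (m, k, e, r)" by (simp add: extends_def)
  then show "extends (m, Suc k, e, case_nat A r) w" using assms by (rule extends_trans)
  have "r' (k' - Suc k) = A" if "\<forall>i. r' (i + (k' - Suc k)) = case_nat A r i" for r' k'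
    using that[rule_format, of 0] by simp
  then show "St (m, Suc k, e, case_nat A r) (\<lambda>k'. k' - Suc k) A"
    by (auto simp: St_def extends_def)
qed

lemma Fm_all [fm_intros]:
  assumes "\<And>w' t a. extends w' w \<Longrightarrow> Tm w' t a \<Longrightarrow> Fm w' (F t) (P a)"
  shows "Fm w (f_all F) (\<forall>a. P a)"
  unfolding Fm_def
proof (intro allI impI)
  fix m k e r
  assume w: "extends (m, k, e, r) w"
  have "holds S (case_nat a e) r (F (\<lambda>m'. Var (m' - Suc m)) (Suc m) k) \<longleftrightarrow> P a" for a
    using assms[OF extends_bindN[OF w, of a]] extends_refl unfolding Fm_def by blast
  then show "holds S e r (f_all F m k) \<longleftrightarrow> (\<forall>a. P a)" by (simp add: f_all_def)
qed

lemma Fm_ex [fm_intros]: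
  assumes "\<And>w' t a. extends w' w \<Longrightarrow> Tm w' t a \<Longrightarrow> Fm w' (F t) (P a)"
  shows "Fm w (f_ex F) (\<exists>a. P a)"
  unfolding Fm_def
proof (intro allI impI)
  fix m k e r
  assume w: "extends (m, k, e, r) w"
  have "holds S (case_nat a e) r (F (\<lambda>m'. Var (m' - Suc m)) (Suc m) k) \<longleftrightarrow> P a" for a
    using assms[OF extends_bindN[OF w, of a]] extends_refl unfolding Fm_def by blast
  then show "holds S e r (f_ex F m k) \<longleftrightarrow> (\<exists>a. P a)" by (simp add: f_ex_def)
qed

lemma Fm_all_set [fm_intros]:
  assumes "\<And>w' X A. extends w' w \<Longrightarrow> St w' X A \<Longrightarrow> Fm w' (F X) (P A)"
  shows "Fm w (f_all_set F) (\<forall>A\<in>S. P A)"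
  unfolding Fm_def
proof (intro allI impI)
  fix m k e r
  assume w: "extends (m, k, e, r) w"
  have "holds S e (case_nat A r) (F (\<lambda>k'. k' - Suc k) m (Suc k)) \<longleftrightarrow> P A" for A
    using assms[OF extends_bindS[OF w, of A]] extends_refl unfolding Fm_def by blast
  then show "holds S e r (f_all_set F m k) \<longleftrightarrow> (\<forall>A\<in>S. P A)" by (simp add: f_all_set_def)
qed

text \<open>An applied class variable matches any formula, so this rule and the next stay outside
  the collection and are tried last.\<close>

lemma Fm_app: "Cl w C A \<Longrightarrow> Tm w t a \<Longrightarrow> Fm w (C t) (a \<in> A)"
  unfolding Cl_def using extends_refl by blast

lemma Fm_app2: "Rl w L R \<Longrightarrow> Tm w t a \<Longrightarrow> Tm w u b \<Longrightarrow> Fm w (L t u) (R a b)"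
  unfolding Rl_def using extends_refl by blast

lemma ClI: "(\<And>w' t a. extends w' w \<Longrightarrow> Tm w' t a \<Longrightarrow> Fm w' (C t) (P a)) \<Longrightarrow> Cl w C {a. P a}"
  unfolding Cl_def by simp

lemma RlI: "(\<And>w' t a u b. extends w' w \<Longrightarrow> Tm w' t a \<Longrightarrow> Tm w' u b \<Longrightarrow> Fm w' (L t u) (R a b)) \<Longrightarrow> Rl w L R"
  unfolding Rl_def by simp

lemma Fm_cong: "Fm w F P \<Longrightarrow> P = Q \<Longrightarrow> Fm w F Q"
  by simp

section \<open>Meanings of the notions defined in the object language\<close>

lemma Cl_set [fm_intros]: "St w X A \<Longrightarrow> Cl w (set_cls X) A"
  unfolding set_cls_def Cl_def by (auto intro: fm_intros St_mono)

lemma Cl_code [fm_intros]: "Tm w c a \<Longrightarrow> Cl w (code_cls c) (code a)"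
  unfolding code_cls_def code_def
  by (rule ClI) (assumption | rule fm_intros | rule mono_rules, assumption)+

lemma Fm_isfin [fm_intros]:
  assumes "Tm w c a"
  shows "Fm w (is_finset c) (isfin a)"
proof (rule Fm_cong)
  show "Fm w (is_finset c) (\<forall>c'. c' < a \<longrightarrow> \<not> (\<forall>i. i \<in> code c' \<longleftrightarrow> i \<in> code a))"
    unfolding is_finset_def using assms
    by - (assumption | rule fm_intros | rule mono_rules, assumption | rule Fm_app)+
qed (auto simp: isfin_def)

lemma Fm_subset [fm_intros]:
  assumes "Cl w A A'" "Cl w B B'"
  shows "Fm w (subset_cls A B) (A' \<subseteq> B')"
proof (rule Fm_cong)
  show "Fm w (subset_cls A B) (\<forall>x. x \<in> A' \<longrightarrow> x \<in> B')"
    unfolding subset_cls_def using assms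
    by - (assumption | rule fm_intros | rule mono_rules, assumption | rule Fm_app)+
qed auto

lemma Fm_same [fm_intros]:
  assumes "Cl w A A'" "Cl w B B'"
  shows "Fm w (same_cls A B) (A' = B')"
proof (rule Fm_cong)
  show "Fm w (same_cls A B) (\<forall>x. x \<in> A' \<longleftrightarrow> x \<in> B')"
    unfolding same_cls_def using assms
    by - (assumption | rule fm_intros | rule mono_rules, assumption | rule Fm_app)+
qed auto

lemma Cl_Top [fm_intros]: "Cl w Top_cls UNIV"
  unfolding Cl_def Top_cls_def by (auto intro: Fm_cong fm_intros)

lemma Cl_Union [fm_intros]:
  assumes "Cl w A A'" "Cl w B B'"
  shows "Cl w (Union_cls A B) (A' \<union> B')"
  unfolding Union_cls_def Un_def using assms
  by - (rule ClI, (assumption | rule fm_intros | rule mono_rules, assumption | rule Fm_app)+)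

definition sem_Fin :: "'a set \<Rightarrow> 'a set" where
  "sem_Fin A = {a. isfin a \<and> code a \<subseteq> A}"

lemma Cl_Fin [fm_intros]:
  assumes "Cl w A A'"
  shows "Cl w (Fin_cls A) (sem_Fin A')"
  unfolding Fin_cls_def sem_Fin_def using assms
  by - (rule ClI, (assumption | rule fm_intros | rule mono_rules, assumption | rule Fm_app)+)

definition sem_function :: "'a set \<Rightarrow> 'a set \<Rightarrow> 'a set \<Rightarrow> bool" where
  "sem_function F A B \<longleftrightarrow>
     (\<forall>t. t \<in> F \<longrightarrow> (\<exists>x y. t = pr x y \<and> x \<in> A \<and> y \<in> B)) \<and>
     (\<forall>x. x \<in> A \<longrightarrow> (\<exists>y. pr x y \<in> F)) \<and>
     (\<forall>x y z. pr x y \<in> F \<and> pr x z \<in> F \<longrightarrow> y = z)"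

lemma Fm_function [fm_intros]:
  assumes "Cl w F F'" "Cl w A A'" "Cl w B B'"
  shows "Fm w (is_function F A B) (sem_function F' A' B')"
  unfolding is_function_def sem_function_def using assms
  by - (assumption | rule fm_intros | rule mono_rules, assumption | rule Fm_app)+

definition sem_Id :: "'a set \<Rightarrow> 'a set" where
  "sem_Id A = {t. \<exists>x. t = pr x x \<and> x \<in> A}"

lemma Cl_Id [fm_intros]:
  assumes "Cl w A A'"
  shows "Cl w (Id_cls A) (sem_Id A')"
  unfolding Id_cls_def sem_Id_def using assms
  by - (rule ClI, (assumption | rule fm_intros | rule mono_rules, assumption | rule Fm_app)+)

definition sem_comp :: "'a set \<Rightarrow> 'a set \<Rightarrow> 'a set" where
  "sem_comp G F = {t. \<exists>x y z. t = pr x z \<and> pr x y \<in> F \<and> pr y z \<in> G}"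

lemma Cl_comp [fm_intros]:
  assumes "Cl w G G'" "Cl w F F'"
  shows "Cl w (comp_cls G F) (sem_comp G' F')"
  unfolding comp_cls_def sem_comp_def using assms
  by - (rule ClI, (assumption | rule fm_intros | rule mono_rules, assumption | rule Fm_app)+)

definition sem_converse :: "'a set \<Rightarrow> 'a set" where
  "sem_converse F = {t. \<exists>x y. t = pr y x \<and> pr x y \<in> F}"

lemma Cl_converse [fm_intros]:
  assumes "Cl w F F'"
  shows "Cl w (converse_cls F) (sem_converse F')"
  unfolding converse_cls_def sem_converse_def using assms
  by - (rule ClI, (assumption | rule fm_intros | rule mono_rules, assumption | rule Fm_app)+)

definition sem_Image :: "'a set \<Rightarrow> 'a set \<Rightarrow> 'a set" where
  "sem_Image F A = {y. \<exists>x. x \<in> A \<and> pr x y \<in> F}"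

lemma Cl_Image [fm_intros]:
  assumes "Cl w F F'" "Cl w A A'"
  shows "Cl w (Image_cls F A) (sem_Image F' A')"
  unfolding Image_cls_def sem_Image_def using assms
  by - (rule ClI, (assumption | rule fm_intros | rule mono_rules, assumption | rule Fm_app)+)

definition sem_field :: "'a set \<Rightarrow> 'a set" where
  "sem_field R = {x. pr x x \<in> R}"

lemma Cl_field [fm_intros]:
  assumes "Cl w R R'"
  shows "Cl w (field R) (sem_field R')"
  unfolding field_def sem_field_def using assms
  by - (rule ClI, (assumption | rule fm_intros | rule mono_rules, assumption | rule Fm_app)+)

definition sem_po :: "'a set \<Rightarrow> bool" where
  "sem_po R \<longleftrightarrow>
     (\<forall>t. t \<in> R \<longrightarrow> (\<exists>x y. t = pr x y \<and> x \<in> sem_field R \<and> y \<in> sem_field R)) \<and>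
     (\<forall>x y. pr x y \<in> R \<and> pr y x \<in> R \<longrightarrow> x = y) \<and>
     (\<forall>x y z. pr x y \<in> R \<and> pr y z \<in> R \<longrightarrow> pr x z \<in> R)"

lemma Fm_po [fm_intros]:
  assumes "Cl w R R'"
  shows "Fm w (partial_order R) (sem_po R')"
  unfolding partial_order_def sem_po_def using assms
  by - (assumption | rule fm_intros | rule mono_rules, assumption | rule Fm_app)+

definition sem_qe :: "'a set \<Rightarrow> 'a set \<Rightarrow> 'a set \<Rightarrow> bool" where
  "sem_qe F R Q \<longleftrightarrow> sem_function F (sem_field R) (sem_field Q) \<and>
     (\<forall>x x' y y'. pr x y \<in> F \<and> pr x' y' \<in> F \<and> pr y y' \<in> Q \<longrightarrow> pr x x' \<in> R)"

lemma Fm_qe [fm_intros]: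
  assumes "Cl w F F'" "Cl w R R'" "Cl w Q Q'"
  shows "Fm w (quasi_embedding F R Q) (sem_qe F' R' Q')"
  unfolding quasi_embedding_def sem_qe_def using assms
  by - (assumption | rule fm_intros | rule mono_rules, assumption | rule Fm_app)+

definition sem_emb :: "'a set \<Rightarrow> 'a set \<Rightarrow> 'a set \<Rightarrow> bool" where
  "sem_emb F R Q \<longleftrightarrow> sem_qe F R Q \<and>
     (\<forall>x x' y y'. pr x y \<in> F \<and> pr x' y' \<in> F \<and> pr x x' \<in> R \<longrightarrow> pr y y' \<in> Q)"

lemma Fm_emb [fm_intros]:
  assumes "Cl w F F'" "Cl w R R'" "Cl w Q Q'"
  shows "Fm w (embedding F R Q) (sem_emb F' R' Q')"
  unfolding embedding_def sem_emb_def using assms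
  by - (assumption | rule fm_intros | rule mono_rules, assumption | rule Fm_app)+

definition sem_iso :: "'a set \<Rightarrow> 'a set \<Rightarrow> 'a set \<Rightarrow> bool" where
  "sem_iso F R Q \<longleftrightarrow> sem_emb F R Q \<and> (\<forall>y. y \<in> sem_field Q \<longrightarrow> (\<exists>x. pr x y \<in> F))"

lemma Fm_iso [fm_intros]:
  assumes "Cl w F F'" "Cl w R R'" "Cl w Q Q'"
  shows "Fm w (isomorphism F R Q) (sem_iso F' R' Q')"
  unfolding isomorphism_def sem_iso_def using assms
  by - (assumption | rule fm_intros | rule mono_rules, assumption | rule Fm_app)+

definition sem_good :: "'a set \<Rightarrow> ('a \<Rightarrow> 'a \<Rightarrow> bool) \<Rightarrow> bool" where
  "sem_good A L \<longleftrightarrow> (\<forall>s\<in>S. sem_function s UNIV A \<longrightarrow>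
     (\<exists>i j x y. i < j \<and> pr i x \<in> s \<and> pr j y \<in> s \<and> L x y))"

lemma Fm_good [fm_intros]:
  assumes "Cl w A A'" "Rl w L L'"
  shows "Fm w (sequences_good A L) (sem_good A' L')"
  unfolding sequences_good_def sem_good_def using assms
  by - (assumption | rule fm_intros | rule mono_rules, assumption | rule Fm_app2)+

definition sem_wpo :: "'a set \<Rightarrow> bool" where
  "sem_wpo X \<longleftrightarrow> sem_po X \<and> sem_good (sem_field X) (\<lambda>x y. pr x y \<in> X)"

lemma Fm_wpo [fm_intros]:
  assumes "St w X X'"
  shows "Fm w (well_partial_order X) (sem_wpo X')"
  unfolding well_partial_order_def sem_wpo_def using assms
  by - (assumption | rule fm_intros RlI | rule mono_rules, assumption)+

definition sem_fpo :: "'a \<Rightarrow> bool" where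
  "sem_fpo a \<longleftrightarrow> isfin a \<and> sem_po (code a)"

lemma Fm_fpo [fm_intros]: "Tm w t a \<Longrightarrow> Fm w (finite_po t) (sem_fpo a)"
  unfolding finite_po_def sem_fpo_def by (intro fm_intros)

definition sem_reps :: "'a set \<Rightarrow> 'a set \<Rightarrow> bool" where
  "sem_reps P E \<longleftrightarrow>
     (\<forall>c. c \<in> P \<longrightarrow> sem_fpo c) \<and>
     (\<forall>c d h. c \<in> P \<and> d \<in> P \<and> isfin h \<and> sem_iso (code h) (code c) (code d) \<longrightarrow> c = d) \<and>
     (\<forall>a. sem_fpo a \<longrightarrow> (\<exists>c h. pr (pr a c) h \<in> E \<and> c \<in> P \<and> isfin h \<and>
        sem_iso (code h) (code c) (code a) \<and> (\<forall>c' h'. pr (pr a c') h' \<in> E \<longrightarrow> c' = c \<and> h' = h)))"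

lemma Fm_reps [fm_intros]:
  assumes "St w P P'" "St w E E'"
  shows "Fm w (representatives P E) (sem_reps P' E')"
  unfolding representatives_def sem_reps_def using assms
  by - (assumption | rule fm_intros | rule mono_rules, assumption)+

definition sem_mor :: "'a set \<Rightarrow> 'a \<Rightarrow> 'a \<Rightarrow> 'a \<Rightarrow> bool" where
  "sem_mor P h c d \<longleftrightarrow> c \<in> P \<and> d \<in> P \<and> isfin h \<and> sem_qe (code h) (code c) (code d)"

lemma Fm_mor [fm_intros]:
  assumes "St w P P'" "Tm w h h'" "Tm w c c'" "Tm w d d'"
  shows "Fm w (morphism P h c d) (sem_mor P' h' c' d')"
  unfolding morphism_def sem_mor_def using assms
  by - (assumption | rule fm_intros)+

definition sem_ord :: "'a set \<Rightarrow> 'a \<Rightarrow> 'a set" where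
  "sem_ord W c = {t. pr 0 (pr c t) \<in> W}"

definition sem_Wmor :: "'a set \<Rightarrow> 'a \<Rightarrow> 'a \<Rightarrow> 'a \<Rightarrow> 'a set" where
  "sem_Wmor W h c d = {t. pr 1 (pr (pr (pr c d) h) t) \<in> W}"

definition sem_supp :: "'a set \<Rightarrow> 'a \<Rightarrow> 'a set" where
  "sem_supp W c = {t. pr (1 + 1) (pr c t) \<in> W}"

lemma Cl_W [fm_intros]:
  assumes "St w W W'" "Tm w h h'" "Tm w c c'" "Tm w d d'"
  shows "Cl w (W_mor W h c d) (sem_Wmor W' h' c' d')"
  unfolding W_mor_def sem_Wmor_def using assms
  by - (rule ClI, (assumption | rule fm_intros | rule mono_rules, assumption)+)

lemma Cl_ord [fm_intros]:
  assumes "St w W W'" "Tm w c c'"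
  shows "Cl w (W_ord W c) (sem_ord W' c')"
  unfolding W_ord_def sem_ord_def using assms
  by - (rule ClI, (assumption | rule fm_intros | rule mono_rules, assumption)+)

lemma Cl_supp [fm_intros]:
  assumes "St w W W'" "Tm w c c'"
  shows "Cl w (W_supp W c) (sem_supp W' c')"
  unfolding W_supp_def sem_supp_def using assms
  by - (rule ClI, (assumption | rule fm_intros | rule mono_rules, assumption)+)

definition sem_functor :: "'a set \<Rightarrow> 'a set \<Rightarrow> bool" where
  "sem_functor P W \<longleftrightarrow>
     (\<forall>c. c \<in> P \<longrightarrow> sem_po (sem_ord W c)) \<and>
     (\<forall>c d h. sem_mor P h c d \<longrightarrow> sem_qe (sem_Wmor W h c d) (sem_ord W c) (sem_ord W d)) \<and>
     (\<forall>c h. sem_mor P h c c \<and> code h = sem_Id (sem_field (code c)) \<longrightarrow>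
        sem_Wmor W h c c = sem_Id (sem_field (sem_ord W c))) \<and>
     (\<forall>c d e h k l. sem_mor P h c d \<and> sem_mor P k d e \<and> sem_mor P l c e \<and>
        code l = sem_comp (code k) (code h) \<longrightarrow>
        sem_Wmor W l c e = sem_comp (sem_Wmor W k d e) (sem_Wmor W h c d))"

lemma Fm_functor [fm_intros]:
  assumes "St w P P'" "St w W W'"
  shows "Fm w (PO_functor P W) (sem_functor P' W')"
  unfolding PO_functor_def sem_functor_def using assms
  by - (assumption | rule fm_intros | rule mono_rules, assumption)+

definition sem_pres :: "'a set \<Rightarrow> 'a set \<Rightarrow> bool" where
  "sem_pres P W \<longleftrightarrow> (\<forall>c d h. sem_mor P h c d \<and> sem_emb (code h) (code c) (code d) \<longrightarrow>
     sem_emb (sem_Wmor W h c d) (sem_ord W c) (sem_ord W d))"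

lemma Fm_pres [fm_intros]:
  assumes "St w P P'" "St w W W'"
  shows "Fm w (preserves_embeddings P W) (sem_pres P' W')"
  unfolding preserves_embeddings_def sem_pres_def using assms
  by - (assumption | rule fm_intros | rule mono_rules, assumption)+

definition sem_natural :: "'a set \<Rightarrow> 'a set \<Rightarrow> bool" where
  "sem_natural P W \<longleftrightarrow>
     (\<forall>c. c \<in> P \<longrightarrow> sem_function (sem_supp W c) (sem_field (sem_ord W c)) (sem_Fin (sem_field (code c)))) \<and>
     (\<forall>c d h r s a b. sem_mor P h c d \<and> pr r s \<in> sem_Wmor W h c d \<and>
        pr r a \<in> sem_supp W c \<and> pr s b \<in> sem_supp W d \<longrightarrow> code b = sem_Image (code h) (code a))"

lemma Fm_natural [fm_intros]:
  assumes "St w P P'" "St w W W'"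
  shows "Fm w (supp_natural P W) (sem_natural P' W')"
  unfolding supp_natural_def sem_natural_def using assms
  by - (assumption | rule fm_intros | rule mono_rules, assumption | rule Fm_app)+

definition sem_supp_cond :: "'a set \<Rightarrow> 'a set \<Rightarrow> bool" where
  "sem_supp_cond P W \<longleftrightarrow>
     (\<forall>c d h s b. sem_mor P h c d \<and> sem_emb (code h) (code c) (code d) \<and> pr s b \<in> sem_supp W d \<and>
        code b \<subseteq> sem_Image (code h) (sem_field (code c)) \<longrightarrow> (\<exists>r. pr r s \<in> sem_Wmor W h c d))"

lemma Fm_supp_cond [fm_intros]:
  assumes "St w P P'" "St w W W'"
  shows "Fm w (support_condition P W) (sem_supp_cond P' W')"
  unfolding support_condition_def sem_supp_cond_def using assms
  by - (assumption | rule fm_intros | rule mono_rules, assumption | rule Fm_app)+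

definition sem_trace :: "'a set \<Rightarrow> 'a set \<Rightarrow> 'a \<Rightarrow> 'a \<Rightarrow> bool" where
  "sem_trace P W c r \<longleftrightarrow> c \<in> P \<and> r \<in> sem_field (sem_ord W c) \<and>
     (\<exists>a. pr r a \<in> sem_supp W c \<and> code a = sem_field (code c))"

lemma Fm_trace [fm_intros]:
  assumes "St w P P'" "St w W W'" "Tm w c c'" "Tm w r r'"
  shows "Fm w (trace P W c r) (sem_trace P' W' c' r')"
  unfolding trace_def sem_trace_def using assms
  by - (assumption | rule fm_intros | rule mono_rules, assumption | rule Fm_app)+

definition sem_enum :: "'a set \<Rightarrow> 'a set \<Rightarrow> 'a \<Rightarrow> 'a \<Rightarrow> 'a \<Rightarrow> bool" where
  "sem_enum E X a c h \<longleftrightarrow> (\<exists>q. isfin q \<and>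
     code q = {t. \<exists>x y. t = pr x y \<and> x \<in> code a \<and> y \<in> code a \<and> pr x y \<in> X} \<and> pr (pr q c) h \<in> E)"

lemma Fm_enum [fm_intros]:
  assumes "St w E E'" "St w X X'" "Tm w a a'" "Tm w c c'" "Tm w h h'"
  shows "Fm w (enumerates E X a c h) (sem_enum E' X' a' c' h')"
  unfolding enumerates_def sem_enum_def using assms
  by - (assumption | rule fm_intros | rule mono_rules, assumption | rule Fm_app | rule ClI)+

definition sem_induced :: "'a \<Rightarrow> 'a \<Rightarrow> 'a set \<Rightarrow> 'a \<Rightarrow> bool" where
  "sem_induced m h F k \<longleftrightarrow> isfin m \<and> code m = sem_comp (sem_converse (code k)) (sem_comp F (code h))"

lemma Fm_induced [fm_intros]:
  assumes "Tm w m m'" "Tm w h h'" "Cl w F F'" "Tm w k k'"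
  shows "Fm w (induced m h F k) (sem_induced m' h' F' k')"
  unfolding induced_def sem_induced_def using assms
  by - (assumption | rule fm_intros)+

definition sem_elem :: "'a set \<Rightarrow> 'a set \<Rightarrow> 'a set \<Rightarrow> 'a set \<Rightarrow> 'a set" where
  "sem_elem P E W X = {p. \<exists>a \<sigma> c h. p = pr a \<sigma> \<and> a \<in> sem_Fin (sem_field X) \<and>
     sem_enum E X a c h \<and> sem_trace P W c \<sigma>}"

lemma Cl_elem [fm_intros]:
  assumes "St w P P'" "St w E E'" "St w W W'" "St w X X'"
  shows "Cl w (D_elem P E W X) (sem_elem P' E' W' X')"
  unfolding D_elem_def sem_elem_def using assms
  by - (rule ClI, (assumption | rule fm_intros | rule mono_rules, assumption | rule Fm_app)+)

definition sem_le :: "'a set \<Rightarrow> 'a set \<Rightarrow> 'a set \<Rightarrow> 'a set \<Rightarrow> 'a \<Rightarrow> 'a \<Rightarrow> bool" where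
  "sem_le P E W X p q \<longleftrightarrow> p \<in> sem_elem P E W X \<and> q \<in> sem_elem P E W X \<and>
     (\<exists>a \<sigma> b \<tau> e c h d k l n m m' \<sigma>' \<tau>'.
        p = pr a \<sigma> \<and> q = pr b \<tau> \<and> isfin e \<and> code e = code a \<union> code b \<and>
        sem_enum E X a c h \<and> sem_enum E X b d k \<and> sem_enum E X e l n \<and>
        sem_induced m h (sem_Id (code a)) n \<and> sem_induced m' k (sem_Id (code b)) n \<and>
        pr \<sigma> \<sigma>' \<in> sem_Wmor W m c l \<and> pr \<tau> \<tau>' \<in> sem_Wmor W m' d l \<and> pr \<sigma>' \<tau>' \<in> sem_ord W l)"

lemma Fm_le [fm_intros]:
  assumes "St w P P'" "St w E E'" "St w W W'" "St w X X'" "Tm w p p'" "Tm w q q'"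
  shows "Fm w (D_le P E W X p q) (sem_le P' E' W' X' p' q')"
  unfolding D_le_def sem_le_def using assms
  by - (assumption | rule fm_intros | rule mono_rules, assumption | rule Fm_app)+

definition sem_map :: "'a set \<Rightarrow> 'a set \<Rightarrow> 'a set \<Rightarrow> 'a set \<Rightarrow> 'a set \<Rightarrow> 'a set \<Rightarrow> 'a \<Rightarrow> 'a \<Rightarrow> bool" where
  "sem_map P E W X Y f p q \<longleftrightarrow> p \<in> sem_elem P E W X \<and> q \<in> sem_elem P E W Y \<and>
     (\<exists>a \<sigma> b \<tau> c h d k m.
        p = pr a \<sigma> \<and> q = pr b \<tau> \<and> code b = sem_Image f (code a) \<and>
        sem_enum E X a c h \<and> sem_enum E Y b d k \<and>
        sem_induced m h f k \<and> pr \<sigma> \<tau> \<in> sem_Wmor W m c d)"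

lemma Fm_map [fm_intros]:
  assumes "St w P P'" "St w E E'" "St w W W'" "St w X X'" "St w Y Y'" "St w f f'" "Tm w p p'" "Tm w q q'"
  shows "Fm w (D_map P E W X Y f p q) (sem_map P' E' W' X' Y' f' p' q')"
  unfolding D_map_def sem_map_def using assms
  by - (assumption | rule fm_intros | rule mono_rules, assumption | rule Fm_app)+

definition sem_dilator :: "'a set \<Rightarrow> 'a set \<Rightarrow> bool" where
  "sem_dilator P W \<longleftrightarrow> sem_functor P W \<and> sem_pres P W \<and> sem_natural P W \<and> sem_supp_cond P W"

definition sem_WPO_dilator :: "'a set \<Rightarrow> 'a set \<Rightarrow> 'a set \<Rightarrow> bool" where
  "sem_WPO_dilator P E W \<longleftrightarrow> sem_dilator P W \<and>
     (\<forall>X\<in>S. sem_wpo X \<longrightarrow> sem_good (sem_elem P E W X) (sem_le P E W X))"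

lemma Fm_WPO_dilator [fm_intros]:
  assumes "St w P P'" "St w E E'" "St w W W'"
  shows "Fm w (WPO_dilator P E W) (sem_WPO_dilator P' E' W')"
  unfolding WPO_dilator_def sem_WPO_dilator_def PO_dilator_def sem_dilator_def using assms
  by - (assumption | rule fm_intros RlI | rule mono_rules, assumption)+

definition sem_monotone :: "'a set \<Rightarrow> 'a set \<Rightarrow> 'a set \<Rightarrow> bool" where
  "sem_monotone P E W \<longleftrightarrow> (\<forall>X\<in>S. \<forall>Y\<in>S. \<forall>f\<in>S. \<forall>g\<in>S.
     sem_po X \<and> sem_po Y \<and> sem_qe f X Y \<and> sem_qe g X Y \<and>
     (\<forall>x y z. pr x y \<in> f \<and> pr x z \<in> g \<longrightarrow> pr y z \<in> Y) \<longrightarrow>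
     (\<forall>p. p \<in> sem_elem P E W X \<longrightarrow>
        (\<exists>q r. sem_map P E W X Y f p q \<and> sem_map P E W X Y g p r \<and> sem_le P E W Y q r)))"

lemma Fm_monotone [fm_intros]:
  assumes "St w P P'" "St w E E'" "St w W W'"
  shows "Fm w (monotone_dilator P E W) (sem_monotone P' E' W')"
  unfolding monotone_dilator_def sem_monotone_def using assms
  by - (assumption | rule fm_intros | rule mono_rules, assumption | rule Fm_app)+

lemma valid_sentence:
  assumes "\<And>w. Fm w F P" and P
  shows "valid S (sentence F)"
  unfolding valid_def sentence_def
proof (intro allI impI)
  fix e r
  show "holds S e r (F 0 0)"
    using assms(1)[of "(0, 0, e, r)", unfolded Fm_def, rule_format, OF extends_refl] assms(2) by simp
qed

end

section \<open>Finite sets and functions inside a model\<close>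

context arithmetic
begin

lemma le_zero_iff [simp]: "x \<le> 0 \<longleftrightarrow> x = 0" for x :: 'a
  by (metis zero_le antisym order_refl)

lemma sigma1_rename:
  assumes "sigma1 S P"
  shows "sigma1 S (\<lambda>e. P (\<lambda>i. e (f i)))"
proof -
  obtain Q where Q: "delta0 S Q" "\<And>e. P e \<longleftrightarrow> (\<exists>x. Q (case_nat x e))"
    using assms unfolding sigma1_def by blast
  let ?f = "case_nat 0 (\<lambda>i. Suc (f i))"
  have "(\<lambda>i. case_nat x e (?f i)) = case_nat x (\<lambda>i. e (f i))" for x and e :: "nat \<Rightarrow> 'a"
    by (auto simp: fun_eq_iff split: nat.split)
  then show ?thesis unfolding sigma1_def
    by (intro exI[of _ "\<lambda>e. Q (\<lambda>i. e (?f i))"] conjI delta0_rename[OF Q(1)]) (simp add: Q(2))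
qed

lemma sigma1_rel2:
  assumes "sigma1 S (\<lambda>e. R (e 0) (e (Suc 0)))"
  shows "sigma1 S (\<lambda>e. R (e i) (e j))"
  using sigma1_rename[OF assms, of "case_nat i (\<lambda>_. j)"] by simp

text \<open>The complement is Sigma as well: t lies outside the graph if it is no pair, or if the
  function takes another value at its first component.\<close>

lemma graph_in_S:
  assumes R: "sigma1 S (\<lambda>e. R (e 0) (e (Suc 0)))" and func: "\<And>n. \<exists>!p. R n p"
  shows "{t. \<exists>n p. t = pr n p \<and> R n p} \<in> S"
proof (rule comprehension)
  show "sigma1 S (\<lambda>e. \<exists>n p. e 0 = pr n p \<and> R n p)"
    by (intro sigma1_ex sigma1_and sigma1_rel2[OF R] sigma1_delta0 def_intros)
  have "\<not> (\<exists>n p. t = pr n p \<and> R n p) \<longleftrightarrow>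
      (\<exists>n p p'. R n p' \<and> ((\<forall>n<t + 1. \<forall>p<t + 1. t \<noteq> pr n p) \<or> t = pr n p \<and> p' \<noteq> p))" for t
  proof
    assume *: "\<not> (\<exists>n p. t = pr n p \<and> R n p)"
    show "\<exists>n p p'. R n p' \<and> ((\<forall>n<t + 1. \<forall>p<t + 1. t \<noteq> pr n p) \<or> t = pr n p \<and> p' \<noteq> p)"
    proof (cases "\<exists>n p. t = pr n p")
      case True
      then obtain n p where t: "t = pr n p" by blast
      obtain p' where "R n p'" using func by blast
      with * t show ?thesis by blast
    next
      case False
      with func show ?thesis by blast
    qed
  next
    assume "\<exists>n p p'. R n p' \<and> ((\<forall>n<t + 1. \<forall>p<t + 1. t \<noteq> pr n p) \<or> t = pr n p \<and> p' \<noteq> p)"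
    then obtain n p p' where *: "R n p'" "(\<forall>n<t + 1. \<forall>p<t + 1. t \<noteq> pr n p) \<or> t = pr n p \<and> p' \<noteq> p"
      by blast
    have False if t: "t = pr n' q" and "R n' q" for n' q
    proof -
      have "n' < t + 1" "q < t + 1" unfolding t by (simp_all add: less_add_one_iff pr_le)
      with * t have "n' = n" "q = p" "p' \<noteq> p" by auto
      with *(1) \<open>R n' q\<close> func[of n] show False by blast
    qed
    then show "\<not> (\<exists>n p. t = pr n p \<and> R n p)" by blast
  qed
  then show "sigma1 S (\<lambda>e. \<not> (\<exists>n p. e 0 = pr n p \<and> R n p))"
    by (simp only:) (intro sigma1_ex sigma1_and sigma1_rel2[OF R] sigma1_delta0 def_intros)
qed

text \<open>Two sets that are bounded by terms can be compared by testing membership below the sum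
  of the bounds.\<close>

lemma delta0_code_eq:
  assumes "dterm c" "dterm b" "delta0 S (\<lambda>e. \<Phi> (e 0) (\<lambda>i. e (Suc i)))" and bound: "\<And>t e. \<Phi> t e \<Longrightarrow> t < b e"
  shows "delta0 S (\<lambda>e. code (c e) = {t. \<Phi> t e})"
proof -
  have less: "x < x + y + 1" "x < y + x + 1" for x y :: 'a
    unfolding less_add_one_iff by (simp_all add: add_increasing2 add_increasing)
  have "code (c e) = {t. \<Phi> t e} \<longleftrightarrow> (\<forall>t<c e + b e + 1. t \<in> code (c e) \<longleftrightarrow> \<Phi> t e)" for e
  proof
    assume *: "\<forall>t<c e + b e + 1. t \<in> code (c e) \<longleftrightarrow> \<Phi> t e"
    show "code (c e) = {t. \<Phi> t e}"
    proof (intro set_eqI)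
      fix t
      have "t < c e + b e + 1" if "t \<in> code (c e) \<or> \<Phi> t e"
        using that code_bound[of t "c e"] bound[of t e] less less_trans by blast
      with * show "t \<in> code (c e) \<longleftrightarrow> t \<in> {t. \<Phi> t e}" by auto
    qed
  qed auto
  then show ?thesis
    by (simp only:) (rule delta0_all, intro def_intros assms, rule delta0_iff,
      rule delta0_code, rule dterm_var, rule dterm_shift, rule assms, rule assms)
qed

text \<open>Sigma induction on j yields a bound for the arguments below j. The condition
  \<open>x < k\<close> inside the induction formula lets it run over all j.\<close>

lemma collection:
  assumes "delta0 S (\<lambda>e. R (e (Suc 0)) (e 0))" "\<And>x. x < k \<Longrightarrow> \<exists>y. R x y"
  shows "\<exists>b. \<forall>x<k. \<exists>y<b. R x y"
proof -
  have R: "delta0 S (\<lambda>e. R (e i) (e j))" for i j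
    using delta0_rename[OF assms(1), of "case_nat j (\<lambda>_. i)"] by simp
  have "\<exists>b. \<forall>x<k. x < k \<longrightarrow> (\<exists>y<b. R x y)"
  proof (rule sigma1_induct[where P = "\<lambda>j. \<exists>b. \<forall>x<j. x < k \<longrightarrow> (\<exists>y<b. R x y)"])
    show "sigma1 S (\<lambda>e. \<exists>b. \<forall>x<e 0. x < k \<longrightarrow> (\<exists>y<b. R x y))"
      by (rule sigma1_ex_delta0, intro def_intros R)
    show "\<exists>b. \<forall>x<0. x < k \<longrightarrow> (\<exists>y<b. R x y)" by (simp add: not_less_zero)
    fix j
    assume "\<exists>b. \<forall>x<j. x < k \<longrightarrow> (\<exists>y<b. R x y)"
    then obtain b where b: "\<forall>x<j. x < k \<longrightarrow> (\<exists>y<b. R x y)" by blast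
    obtain y where y: "j < k \<longrightarrow> R j y" using assms(2) by blast
    have "\<exists>z<max b (y + 1). R x z" if "x < j + 1" "x < k" for x
    proof (cases "x = j")
      case True
      moreover have "y < max b (y + 1)" by (simp add: less_max_iff_disj less_plus_one)
      ultimately show ?thesis using y that by blast
    next
      case False
      with that b show ?thesis by (auto simp: less_plus_one less_max_iff_disj)
    qed
    then show "\<exists>b. \<forall>x<j + 1. x < k \<longrightarrow> (\<exists>y<b. R x y)" by blast
  qed
  then show ?thesis by blast
qed

text \<open>F is a function of the logic, G its certificate inside the model. G may be arbitrary off
  A, so that a map on all of X can serve as a graph on a finite subset.\<close>

definition graph_on :: "'a set \<Rightarrow> 'a set \<Rightarrow> ('a \<Rightarrow> 'a) \<Rightarrow> bool" where
  "graph_on G A F \<longleftrightarrow> G \<in> S \<and> (\<forall>x\<in>A. \<forall>y. pr x y \<in> G \<longleftrightarrow> y = F x)"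

lemma graph_on_Id: "graph_on (sem_Id (code a)) (code a) (\<lambda>x. x)"
  unfolding graph_on_def
proof
  obtain c where "code c = {t. \<exists>x<a. t = pr x x \<and> x \<in> code a}"
  proof (rule ex_code_delta0)
    show "delta0 S (\<lambda>e. \<exists>x<a. e 0 = pr x x \<and> x \<in> code a)" by (intro def_intros)
    show "t < pr a a" if "\<exists>x<a. t = pr x x \<and> x \<in> code a" for t
      using that by (auto intro!: pr_less add_strict_mono)
  qed
  moreover have "{t. \<exists>x<a. t = pr x x \<and> x \<in> code a} = sem_Id (code a)"
    unfolding sem_Id_def using code_bound by blast
  ultimately have "code c = sem_Id (code a)" by simp
  then show "sem_Id (code a) \<in> S" using code_in_S[of c] by simp
qed (auto simp: sem_Id_def)

lemma graph_on_subset: "graph_on G A F \<Longrightarrow> B \<subseteq> A \<Longrightarrow> graph_on G B F"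
  unfolding graph_on_def by blast

text \<open>Collection bounds the values of F on the coded set, so the image is a bounded definable
  set.\<close>

lemma ex_code_image:
  assumes "graph_on G (code a) F"
  obtains b where "isfin b" "code b = F ` code a"
proof -
  have G: "G \<in> S" "\<And>x y. x \<in> code a \<Longrightarrow> pr x y \<in> G \<longleftrightarrow> y = F x"
    using assms unfolding graph_on_def by blast+
  have "\<exists>b. \<forall>x<a. \<exists>y<b. x \<in> code a \<longrightarrow> pr x y \<in> G"
  proof (rule collection)
    show "delta0 S (\<lambda>e. e (Suc 0) \<in> code a \<longrightarrow> pr (e (Suc 0)) (e 0) \<in> G)" by (intro def_intros G(1))
    show "\<exists>y. x \<in> code a \<longrightarrow> pr x y \<in> G" for x using G(2) by blast
  qed
  then obtain b where b: "\<forall>x<a. \<exists>y<b. x \<in> code a \<longrightarrow> pr x y \<in> G" by blast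
  have bound: "y < b" if "\<exists>x<a. x \<in> code a \<and> pr x y \<in> G" for y
  proof -
    from that obtain x where x: "x < a" "x \<in> code a" "pr x y \<in> G" by blast
    with b obtain y' where "y' < b" "pr x y' \<in> G" by blast
    with x G(2)[OF x(2)] show ?thesis by auto
  qed
  obtain c where "isfin c" "code c = {y. \<exists>x<a. x \<in> code a \<and> pr x y \<in> G}"
  proof (rule ex_code_delta0)
    show "delta0 S (\<lambda>e. \<exists>x<a. x \<in> code a \<and> pr x (e 0) \<in> G)" by (intro def_intros G(1))
    show "y < b" if "\<exists>x<a. x \<in> code a \<and> pr x y \<in> G" for y using that by (rule bound)
  qed
  moreover have "{y. \<exists>x<a. x \<in> code a \<and> pr x y \<in> G} = F ` code a"
  proof (intro set_eqI iffI)
    fix y assume "y \<in> F ` code a"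
    then obtain x where "x \<in> code a" "y = F x" by blast
    then show "y \<in> {y. \<exists>x<a. x \<in> code a \<and> pr x y \<in> G}" using G(2)[of x y] code_bound by blast
  qed (use G(2) in auto)
  ultimately show ?thesis using that by simp
qed

lemma ex_code_union:
  obtains c where "isfin c" "code c = code a \<union> code b"
proof (rule ex_code_delta0)
  show "delta0 S (\<lambda>e. e 0 \<in> code a \<or> e 0 \<in> code b)" by (intro def_intros)
  show "x < max a b" if "x \<in> code a \<or> x \<in> code b" for x
    using that by (auto dest: code_bound simp: less_max_iff_disj)
  fix c assume "isfin c" "code c = {x. x \<in> code a \<or> x \<in> code b}"
  with that show thesis by (auto simp: Un_def)
qed


subsection \<open>A well partial order\<close>

text \<open>
  The sum of the finite antichain on \<open>B\<close> and of one copy of the natural numbers for each element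
  of \<open>code a - B\<close>.
\<close>

definition chains :: "'a \<Rightarrow> 'a set \<Rightarrow> 'a set" where
  "chains a B = {t. \<exists>x i j. t = pr (pr x i) (pr x j) \<and> x \<in> code a \<and> i \<le> j \<and> (x \<in> B \<longrightarrow> j = 0)}"

lemma chains_iff: "pr (pr x i) (pr y j) \<in> chains a B \<longleftrightarrow> x = y \<and> x \<in> code a \<and> i \<le> j \<and> (x \<in> B \<longrightarrow> j = 0)"
  by (auto simp: chains_def)

lemma chains_in_S:
  assumes "B \<in> S"
  shows "chains a B \<in> S"
proof -
  have *: "t \<in> chains a B \<longleftrightarrow> (\<exists>x<t + 1. \<exists>i<t + 1. \<exists>j<t + 1.
      t = pr (pr x i) (pr x j) \<and> x \<in> code a \<and> i \<le> j \<and> (x \<in> B \<longrightarrow> j = 0))" for t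
  proof -
    have "x \<le> pr (pr x i) (pr x j)" "i \<le> pr (pr x i) (pr x j)" "j \<le> pr (pr x i) (pr x j)" for x i j
      by (rule order_trans[OF pr_le(1) pr_le(1)] order_trans[OF pr_le(2) pr_le(1)] order_trans[OF pr_le(2) pr_le(2)])+
    then show ?thesis unfolding less_add_one_iff chains_def by auto
  qed
  have d: "delta0 S (\<lambda>e. e 0 \<in> chains a B)"
    unfolding * by (intro def_intros assms)
  have "{t. t \<in> chains a B} \<in> S" by (intro comprehension sigma1_delta0 d delta0_not)
  then show ?thesis by simp
qed

lemma field_chains: "p \<in> sem_field (chains a B) \<longleftrightarrow> (\<exists>x i. p = pr x i \<and> x \<in> code a \<and> (x \<in> B \<longrightarrow> i = 0))"
  by (auto simp: sem_field_def chains_def)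

lemma po_chains: "sem_po (chains a B)"
  unfolding sem_po_def
proof (intro conjI allI impI)
  fix t assume "t \<in> chains a B"
  then obtain x i j where "t = pr (pr x i) (pr x j)" "x \<in> code a" "i \<le> j" "x \<in> B \<longrightarrow> j = 0"
    unfolding chains_def by blast
  then show "\<exists>p q. t = pr p q \<and> p \<in> sem_field (chains a B) \<and> q \<in> sem_field (chains a B)"
    unfolding field_chains by (metis zero_le antisym)
qed (auto simp: chains_def)

text \<open>Along a bad sequence the levels within one chain strictly decrease. First visits to
  chains end before some n0, so every later term lies below the first term of its chain. These first
  terms have a common bound, so the tail would inject an unbounded set of indices into a bounded
  set.\<close>

lemma wpo_chains:
  assumes "B \<in> S"
  shows "sem_wpo (chains a B)"
  unfolding sem_wpo_def sem_good_def
proof (intro conjI po_chains ballI impI)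
  fix s
  assume "s \<in> S" and s: "sem_function s UNIV (sem_field (chains a B))"
  show "\<exists>i j x y. i < j \<and> pr i x \<in> s \<and> pr j y \<in> s \<and> pr x y \<in> chains a B"
  proof (rule ccontr)
    assume "\<not> ?thesis"
    then have bad: "pr x y \<notin> chains a B" if "i < j" "pr i x \<in> s" "pr j y \<in> s" for i j x y
      using that by blast
    have total: "\<exists>x i. pr n (pr x i) \<in> s" for n
      using s unfolding sem_function_def field_chains by (metis UNIV_I pr_inject)
    have valD: "x \<in> code a" "x \<in> B \<longrightarrow> i = 0" if "pr n (pr x i) \<in> s" for n x i
      using s that unfolding sem_function_def field_chains by (metis pr_inject)+
    have functional: "p = q" if "pr n p \<in> s" "pr n q \<in> s" for n p q
      using s that unfolding sem_function_def by blast
    \<comment> \<open>On a chain of length one both levels are 0, so two visits already contradict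
      badness.\<close>
    have decrease: "i' < i" if "n < n'" "pr n (pr x i) \<in> s" "pr n' (pr x i') \<in> s" for n n' x i i'
      using bad[OF that] valD[OF that(2)] valD[OF that(3)] by (auto simp: chains_iff)
    \<comment> \<open>The chain visited at n is recorded in a set of its own, which makes first
      visits definable with bounded quantifiers.\<close>
    define X where "X = {t. \<exists>n x. t = pr n x \<and> (\<exists>i. pr n (pr x i) \<in> s)}"
    have "X \<in> S" unfolding X_def
    proof (rule graph_in_S)
      show "sigma1 S (\<lambda>e. \<exists>i. pr (e 0) (pr (e (Suc 0)) i) \<in> s)"
        by (rule sigma1_ex_delta0, intro def_intros \<open>s \<in> S\<close>)
      show "\<exists>!x. \<exists>i. pr n (pr x i) \<in> s" for n
        using total[of n] functional[of n] by (metis pr_inject)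
    qed
    have X: "pr n x \<in> X \<longleftrightarrow> (\<exists>i. pr n (pr x i) \<in> s)" for n x by (simp add: X_def)
    have X_functional: "x = y" if "pr n x \<in> X" "pr n y \<in> X" for n x y
      using that functional[of n] unfolding X by fastforce
    \<comment> \<open>The indices of first visits; they inject into the set of chains, whose names
      lie below a.\<close>
    define D where "D = {n. \<exists>x<a. pr n x \<in> X \<and> (\<forall>m<n. pr m x \<notin> X)}"
    have "D \<in> S" unfolding D_def
      by (intro comprehension sigma1_delta0 def_intros \<open>X \<in> S\<close>)
    have "\<exists>n0. \<forall>n\<in>D. n < n0"
    proof (rule ccontr)
      assume "\<not> ?thesis"
      then have "\<exists>n\<in>D. b \<le> n" for b by (meson not_less)
      then show False
      proof (rule pigeonhole[OF \<open>D \<in> S\<close> \<open>X \<in> S\<close>])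
        show "\<exists>x<a. pr n x \<in> X" if "n \<in> D" for n using that by (auto simp: D_def)
        have first: "pr m x \<notin> X" if "n \<in> D" "pr n x \<in> X" "m < n" for n m x
        proof -
          from that(1) obtain y where y: "pr n y \<in> X" "\<forall>m<n. pr m y \<notin> X" unfolding D_def by blast
          have "y = x" using X_functional[OF y(1) that(2)] .
          with y(2) that(3) show ?thesis by blast
        qed
        show "n = n'" if "n \<in> D" "n' \<in> D" "pr n x \<in> X" "pr n' x \<in> X" for n n' x
          using first[OF that(1,3)] first[OF that(2,4)] that by (metis linorder_neqE)
      qed
    qed
    then obtain n0 where n0: "\<forall>n\<in>D. n < n0" by blast
    \<comment> \<open>Collection bounds the terms before n0, among them the first term of every
      chain that occurs.\<close>
    have "\<exists>b. \<forall>n<n0. \<exists>p<b. pr n p \<in> s"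
    proof (rule collection)
      show "delta0 S (\<lambda>e. pr (e (Suc 0)) (e 0) \<in> s)" by (intro def_intros \<open>s \<in> S\<close>)
      show "\<exists>p. pr n p \<in> s" for n using total by blast
    qed
    then obtain b where b: "\<forall>n<n0. \<exists>p<b. pr n p \<in> s" by blast
    have tail: "\<exists>p<b. pr n p \<in> s" if "n0 \<le> n" for n
    proof -
      obtain x i where xi: "pr n (pr x i) \<in> s" using total by blast
      have "delta0 S (\<lambda>e. pr (e 0) x \<in> X)" by (intro def_intros \<open>X \<in> S\<close>)
      moreover have "pr n x \<in> X" using xi X by blast
      ultimately obtain m where m: "pr m x \<in> X" "\<And>y. y < m \<Longrightarrow> pr y x \<notin> X"
        by (rule least_delta0[of "\<lambda>m. pr m x \<in> X"]) (rule that, assumption+)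
      then have "m \<in> D" using valD(1)[OF xi] code_bound by (auto simp: D_def)
      then have "m < n0" using n0 by blast
      with b obtain p where p: "p < b" "pr m p \<in> s" by blast
      from m(1) obtain i' where i': "pr m (pr x i') \<in> s" using X by blast
      have "i < i'" using decrease[OF _ i' xi] \<open>m < n0\<close> that by simp
      \<comment> \<open>The code of a point grows with its level, so b also bounds the later
        point.\<close>
      then have "pr x i < pr x i'" by (intro pr_less add_strict_left_mono)
      with p functional[OF p(2) i'] xi show ?thesis by (metis less_trans)
    qed
    have "{n. n0 \<le> n} \<in> S" by (intro comprehension sigma1_delta0 def_intros)
    then show False
    proof (rule pigeonhole[OF _ \<open>s \<in> S\<close>])
      show "\<exists>n\<in>{n. n0 \<le> n}. c \<le> n" for c by (intro bexI[of _ "max c n0"]) auto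
      show "\<exists>p<b. pr n p \<in> s" if "n \<in> {n. n0 \<le> n}" for n using that tail by simp
      have neq: False if "n < n'" "pr n p \<in> s" "pr n' p \<in> s" for n n' p
      proof -
        have "p \<in> sem_field (chains a B)" using s that unfolding sem_function_def by (metis pr_inject)
        then show False using bad[OF that] by (simp add: sem_field_def)
      qed
      show "n = n'" if "pr n p \<in> s" "pr n' p \<in> s" for n n' p
        using neq that by (metis linorder_neqE)
    qed
  qed
qed

end

section \<open>Dilators inside a model\<close>

locale coded_dilator = arithmetic +
  fixes P E W :: "'a set"
  assumes E_in_S: "E \<in> S" and W_in_S: "W \<in> S"
    and reps: "sem_reps P E" and dilator: "sem_dilator P W"
begin

text \<open>\<open>h\<close> is an isomorphism from \<open>c \<in> P\<close> to the suborder of \<open>X\<close> on \<open>code a\<close>.\<close>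

definition chart :: "'a set \<Rightarrow> 'a \<Rightarrow> 'a \<Rightarrow> 'a \<Rightarrow> bool" where
  "chart X a c h \<longleftrightarrow> c \<in> P \<and>
     (\<forall>u x. pr u x \<in> code h \<longrightarrow> u \<in> sem_field (code c) \<and> x \<in> code a) \<and>
     (\<forall>u\<in>sem_field (code c). \<exists>x. pr u x \<in> code h) \<and>
     (\<forall>x\<in>code a. \<exists>u. pr u x \<in> code h) \<and>
     (\<forall>u x y. pr u x \<in> code h \<and> pr u y \<in> code h \<longrightarrow> x = y) \<and>
     (\<forall>u v x. pr u x \<in> code h \<and> pr v x \<in> code h \<longrightarrow> u = v) \<and>
     (\<forall>u v x y. pr u x \<in> code h \<and> pr v y \<in> code h \<longrightarrow> (pr u v \<in> code c \<longleftrightarrow> pr x y \<in> X))"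

lemma chartD:
  assumes "chart X a c h"
  shows "c \<in> P"
    and "pr u x \<in> code h \<Longrightarrow> u \<in> sem_field (code c)"
    and "pr u x \<in> code h \<Longrightarrow> x \<in> code a"
    and "u \<in> sem_field (code c) \<Longrightarrow> \<exists>x. pr u x \<in> code h"
    and "x \<in> code a \<Longrightarrow> \<exists>u. pr u x \<in> code h"
    and "pr u x \<in> code h \<Longrightarrow> pr u y \<in> code h \<Longrightarrow> x = y"
    and "pr u x \<in> code h \<Longrightarrow> pr v x \<in> code h \<Longrightarrow> u = v"
    and "pr u x \<in> code h \<Longrightarrow> pr v y \<in> code h \<Longrightarrow> pr u v \<in> code c \<longleftrightarrow> pr x y \<in> X"
  using assms unfolding chart_def by blast+

definition restr :: "'a set \<Rightarrow> 'a \<Rightarrow> 'a set" where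
  "restr X a = {t. \<exists>x y. t = pr x y \<and> x \<in> code a \<and> y \<in> code a \<and> pr x y \<in> X}"

lemma restr_po:
  assumes "sem_po X" "code a \<subseteq> sem_field X"
  shows "sem_field (restr X a) = code a" "sem_po (restr X a)"
proof -
  show fld: "sem_field (restr X a) = code a"
    using assms(2) by (auto simp: sem_field_def restr_def)
  have X: "x = y" if "pr x y \<in> X" "pr y x \<in> X" for x y
    using assms(1) that unfolding sem_po_def by blast
  have X': "pr x z \<in> X" if "pr x y \<in> X" "pr y z \<in> X" for x y z
    using assms(1) that unfolding sem_po_def by blast
  show "sem_po (restr X a)"
    unfolding sem_po_def fld unfolding restr_def by (auto intro: X X')
qed

text \<open>Turns the choice of representatives into pointwise facts. Injectivity holds because
  points with equal images are comparable both ways, which an isomorphism reflects.\<close>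

lemma enum_chart:
  assumes "sem_po X" "code a \<subseteq> sem_field X" "sem_enum E X a c h"
  shows "chart X a c h"
proof -
  obtain q where q: "isfin q" "code q = restr X a" "pr (pr q c) h \<in> E"
    using assms(3) unfolding sem_enum_def restr_def by blast
  have "sem_fpo q" using restr_po[OF assms(1,2)] q by (simp add: sem_fpo_def)
  then obtain c' h' where "c' \<in> P" "sem_iso (code h') (code c') (code q)"
    "\<And>c'' h''. pr (pr q c'') h'' \<in> E \<Longrightarrow> c'' = c' \<and> h'' = h'"
    using reps unfolding sem_reps_def by metis
  with q(3) have c: "c \<in> P" and iso: "sem_iso (code h) (code c) (code q)" by auto
  have fld: "sem_field (code q) = code a" using restr_po[OF assms(1,2)] q(2) by simp
  have po: "sem_po (code c)" using c reps unfolding sem_reps_def sem_fpo_def by blast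
  note iso_defs = sem_iso_def sem_emb_def sem_qe_def sem_function_def fld
  have reflX: "pr x x \<in> code q" if "x \<in> code a" for x using that fld unfolding sem_field_def by blast
  have 1: "u \<in> sem_field (code c)" "x \<in> code a" if "pr u x \<in> code h" for u x
    using iso that unfolding iso_defs by (metis pr_inject)+
  have 2: "pr u v \<in> code c \<longleftrightarrow> pr x y \<in> code q" if "pr u x \<in> code h" "pr v y \<in> code h" for u v x y
    using iso that unfolding iso_defs by blast
  have 3: "pr x y \<in> code q \<longleftrightarrow> pr x y \<in> X" if "x \<in> code a" "y \<in> code a" for x y
    using that unfolding q(2) restr_def by auto
  have 4: "u = v" if "pr u x \<in> code h" "pr v x \<in> code h" for u v x
    using 2[OF that] 2[OF that(2,1)] reflX[OF 1(2)[OF that(1)]] po unfolding sem_po_def by blast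
  have 5: "x = y" if "pr u x \<in> code h" "pr u y \<in> code h" for u x y
    using iso that unfolding iso_defs by blast
  have 6: "\<exists>x. pr u x \<in> code h" if "u \<in> sem_field (code c)" for u
    using iso that unfolding iso_defs by blast
  have 7: "\<exists>u. pr u x \<in> code h" if "x \<in> code a" for x
    using iso that unfolding iso_defs by blast
  show ?thesis unfolding chart_def using c 1 2 3 4 5 6 7 by meson
qed

lemma enum_ex:
  assumes "X \<in> S" "sem_po X" "code a \<subseteq> sem_field X"
  obtains c h where "sem_enum E X a c h"
proof -
  obtain q where q: "isfin q" "code q = {t. \<exists>x<a. \<exists>y<a. t = pr x y \<and> x \<in> code a \<and> y \<in> code a \<and> pr x y \<in> X}"
  proof (rule ex_code_delta0)
    show "delta0 S (\<lambda>e. \<exists>x<a. \<exists>y<a. e 0 = pr x y \<and> x \<in> code a \<and> y \<in> code a \<and> pr x y \<in> X)"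
      by (intro def_intros assms(1))
    show "t < pr a a" if "\<exists>x<a. \<exists>y<a. t = pr x y \<and> x \<in> code a \<and> y \<in> code a \<and> pr x y \<in> X" for t
      using that by (auto intro!: pr_less add_strict_mono)
  qed
  have eq: "code q = restr X a"
    unfolding q(2) restr_def using code_bound by blast
  have "sem_fpo q" using restr_po[OF assms(2,3)] q(1) eq by (simp add: sem_fpo_def)
  then obtain c h where "pr (pr q c) h \<in> E" using reps unfolding sem_reps_def by metis
  then show ?thesis using that q(1) eq unfolding sem_enum_def restr_def by blast
qed

text \<open>Codes of finite sets are least, so the suborder has a single code q, and
  \<open>E\<close> holds a single triple for it.\<close>

lemma enum_unique:
  assumes "sem_po X" "code a \<subseteq> sem_field X" "sem_enum E X a c h" "sem_enum E X a c' h'"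
  shows "c = c'" "h = h'"
proof -
  obtain q where q: "isfin q" "code q = restr X a" "pr (pr q c) h \<in> E"
    using assms(3) unfolding sem_enum_def restr_def by blast
  obtain q' where q': "isfin q'" "code q' = restr X a" "pr (pr q' c') h' \<in> E"
    using assms(4) unfolding sem_enum_def restr_def by blast
  have "q = q'" using isfin_inject[OF q(1) q'(1)] q(2) q'(2) by simp
  moreover have "sem_fpo q" using restr_po[OF assms(1,2)] q by (simp add: sem_fpo_def)
  ultimately show "c = c'" "h = h'" using reps q(3) q'(3) unfolding sem_reps_def by metis+
qed

text \<open>The counterpart of \<open>induced\<close> with a function of the logic in place of a
  graph: through the chart h, along F, and back through k.\<close>

definition ind :: "'a \<Rightarrow> ('a \<Rightarrow> 'a) \<Rightarrow> 'a \<Rightarrow> 'a set" where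
  "ind h F k = {t. \<exists>u v x. t = pr u v \<and> pr u x \<in> code h \<and> pr v (F x) \<in> code k}"

lemma ind_iff: "pr u v \<in> ind h F k \<longleftrightarrow> (\<exists>x. pr u x \<in> code h \<and> pr v (F x) \<in> code k)"
  by (simp add: ind_def)

lemma ind_cong:
  assumes "chart X a c h" "\<And>x. x \<in> code a \<Longrightarrow> F x = G x"
  shows "ind h F k = ind h G k"
proof -
  have "F x = G x" if "pr u x \<in> code h" for u x
    using assms(2) chartD(3)[OF assms(1) that] .
  then have "pr u x \<in> code h \<and> pr v (F x) \<in> code k \<longleftrightarrow> pr u x \<in> code h \<and> pr v (G x) \<in> code k" for u v x
    by auto
  then show ?thesis unfolding ind_def by simp
qed

lemma induced_iff:
  assumes "chart X a c h" "graph_on G (code a) F"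
  shows "sem_induced m h G k \<longleftrightarrow> isfin m \<and> code m = ind h F k"
proof -
  have "pr x y \<in> G \<longleftrightarrow> y = F x" if "pr u x \<in> code h" for u x y
    using assms chartD(3)[OF assms(1) that] unfolding graph_on_def by blast
  then have "pr u x \<in> code h \<and> pr x y \<in> G \<longleftrightarrow> pr u x \<in> code h \<and> y = F x" for u x y
    by auto
  then have "sem_comp (sem_converse (code k)) (sem_comp G (code h)) = ind h F k"
    unfolding sem_comp_def sem_converse_def ind_def by auto
  then show ?thesis unfolding sem_induced_def by simp
qed

definition reflects :: "'a set \<Rightarrow> 'a \<Rightarrow> ('a \<Rightarrow> 'a) \<Rightarrow> 'a set \<Rightarrow> bool" where
  "reflects X a F Y \<longleftrightarrow> (\<forall>x\<in>code a. \<forall>y\<in>code a. pr (F x) (F y) \<in> Y \<longrightarrow> pr x y \<in> X)"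

text \<open>Charts preserve and reflect the order, so the quasi embedding property of F on the
  finite set passes to the representatives.\<close>

lemma induced_morphism:
  assumes c: "chart X a c h" and d: "chart Y b d k"
    and F: "graph_on G (code a) F" "F ` code a \<subseteq> code b" "reflects X a F Y"
  obtains m where "isfin m" "code m = ind h F k" "sem_mor P m c d"
proof -
  have G: "G \<in> S" "\<And>x y. x \<in> code a \<Longrightarrow> pr x y \<in> G \<longleftrightarrow> y = F x"
    using F(1) unfolding graph_on_def by blast+
  have less: "u < j \<and> x < j" if "pr u x \<in> code j" for u x j
    using code_bound[OF that] pr_le[of u x] pr_le[of x u] pr_le(2)[of x u] by (meson le_less_trans pr_le)
  obtain m where m: "isfin m" "code m = {t. \<exists>u<h. \<exists>x<h. \<exists>v<k. \<exists>y<k. t = pr u v \<and>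
      pr u x \<in> code h \<and> pr x y \<in> G \<and> pr v y \<in> code k}"
  proof (rule ex_code_delta0)
    show "delta0 S (\<lambda>e. \<exists>u<h. \<exists>x<h. \<exists>v<k. \<exists>y<k. e 0 = pr u v \<and>
      pr u x \<in> code h \<and> pr x y \<in> G \<and> pr v y \<in> code k)"
      by (intro def_intros G(1))
    show "t < pr h k" if "\<exists>u<h. \<exists>x<h. \<exists>v<k. \<exists>y<k. t = pr u v \<and>
      pr u x \<in> code h \<and> pr x y \<in> G \<and> pr v y \<in> code k" for t
      using that by (auto intro!: pr_less add_strict_mono)
  qed
  have "code m = ind h F k"
  proof (intro set_eqI iffI)
    fix t assume "t \<in> code m"
    then obtain u x v y where *: "t = pr u v" "pr u x \<in> code h" "pr x y \<in> G" "pr v y \<in> code k"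
      unfolding m(2) by blast
    then have "y = F x" using G(2) chartD(3)[OF c] by blast
    with * show "t \<in> ind h F k" unfolding ind_def by blast
  next
    fix t assume "t \<in> ind h F k"
    then obtain u v x where "t = pr u v" "pr u x \<in> code h" "pr v (F x) \<in> code k"
      unfolding ind_def by blast
    then show "t \<in> code m" unfolding m(2) using G(2) chartD(3)[OF c] less by blast
  qed
  moreover have "sem_mor P m c d"
    unfolding sem_mor_def sem_qe_def sem_function_def \<open>code m = ind h F k\<close>
  proof (intro conjI allI impI chartD(1)[OF c] chartD(1)[OF d] m(1))
    fix t assume "t \<in> ind h F k"
    then show "\<exists>u v. t = pr u v \<and> u \<in> sem_field (code c) \<and> v \<in> sem_field (code d)"
      unfolding ind_def using chartD(2)[OF c] chartD(2)[OF d] by blast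
  next
    fix u assume "u \<in> sem_field (code c)"
    then obtain x where "pr u x \<in> code h" using chartD(4)[OF c] by blast
    moreover from this obtain v where "pr v (F x) \<in> code k"
      using chartD(3)[OF c] chartD(5)[OF d] F(2) by blast
    ultimately show "\<exists>v. pr u v \<in> ind h F k" unfolding ind_iff by blast
  next
    fix u v w assume "pr u v \<in> ind h F k \<and> pr u w \<in> ind h F k"
    then show "v = w" unfolding ind_iff using chartD(6)[OF c] chartD(7)[OF d] by metis
  next
    fix u u' v v'
    assume "pr u v \<in> ind h F k \<and> pr u' v' \<in> ind h F k \<and> pr v v' \<in> code d"
    then obtain x x' where *: "pr u x \<in> code h" "pr v (F x) \<in> code k" "pr u' x' \<in> code h" "pr v' (F x') \<in> code k"
      and "pr v v' \<in> code d" unfolding ind_iff by blast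
    then have "pr (F x) (F x') \<in> Y" using chartD(8)[OF d *(2,4)] by blast
    then have "pr x x' \<in> X" using F(3) chartD(3)[OF c] * unfolding reflects_def by blast
    then show "pr u u' \<in> code c" using chartD(8)[OF c *(1,3)] by blast
  qed
  ultimately show ?thesis using that m(1) by blast
qed

text \<open>The two passages through the middle chart k cancel, since k is single-valued and onto
  b.\<close>

lemma ind_comp:
  assumes d: "chart Y b d k" and "chart X a c h" "F ` code a \<subseteq> code b"
  shows "ind h (\<lambda>x. G (F x)) n = sem_comp (ind k G n) (ind h F k)"
proof (intro set_eqI iffI)
  fix t assume "t \<in> ind h (\<lambda>x. G (F x)) n"
  then obtain u w x where *: "t = pr u w" "pr u x \<in> code h" "pr w (G (F x)) \<in> code n"
    unfolding ind_def by blast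
  then obtain v where "pr v (F x) \<in> code k"
    using chartD(3)[OF assms(2)] chartD(5)[OF d] assms(3) by blast
  with * show "t \<in> sem_comp (ind k G n) (ind h F k)" unfolding sem_comp_def ind_def by auto
next
  fix t assume "t \<in> sem_comp (ind k G n) (ind h F k)"
  then obtain u v w x y where *: "t = pr u w" "pr u x \<in> code h" "pr v (F x) \<in> code k"
    "pr v y \<in> code k" "pr w (G y) \<in> code n"
    unfolding sem_comp_def ind_def by auto
  then have "y = F x" using chartD(6)[OF d] by blast
  with * show "t \<in> ind h (\<lambda>x. G (F x)) n" unfolding ind_def by blast
qed

section \<open>Values of the functor on induced morphisms\<close>

lemma Wmor_qe: "sem_mor P m c d \<Longrightarrow> sem_qe (sem_Wmor W m c d) (sem_ord W c) (sem_ord W d)"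
  using dilator unfolding sem_dilator_def sem_functor_def by blast

lemma Wmor_total:
  assumes "sem_mor P m c d" "\<sigma> \<in> sem_field (sem_ord W c)"
  obtains \<tau> where "pr \<sigma> \<tau> \<in> sem_Wmor W m c d"
  using Wmor_qe[OF assms(1)] assms(2) unfolding sem_qe_def sem_function_def by blast

lemma Wmor_functional:
  "sem_mor P m c d \<Longrightarrow> pr \<sigma> \<tau> \<in> sem_Wmor W m c d \<Longrightarrow> pr \<sigma> \<tau>' \<in> sem_Wmor W m c d \<Longrightarrow> \<tau> = \<tau>'"
  using Wmor_qe unfolding sem_qe_def sem_function_def by blast

lemma Wmor_field:
  "sem_mor P m c d \<Longrightarrow> pr \<sigma> \<tau> \<in> sem_Wmor W m c d \<Longrightarrow> \<tau> \<in> sem_field (sem_ord W d)"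
  using Wmor_qe unfolding sem_qe_def sem_function_def by (metis pr_inject)

lemma Wmor_reflects:
  "sem_mor P m c d \<Longrightarrow> pr \<sigma> \<tau> \<in> sem_Wmor W m c d \<Longrightarrow> pr \<sigma>' \<tau>' \<in> sem_Wmor W m c d \<Longrightarrow>
    pr \<tau> \<tau>' \<in> sem_ord W d \<Longrightarrow> pr \<sigma> \<sigma>' \<in> sem_ord W c"
  using Wmor_qe unfolding sem_qe_def by blast

text \<open>Functoriality for functions of the logic. K has to agree with the composite on the
  finite set only, which is all that the induced morphism sees.\<close>

lemma Wmor_comp:
  assumes c: "chart X a c h" and d: "chart Y b d k" and "F ` code a \<subseteq> code b"
    and "code m = ind h F k" "sem_mor P m c d"
    and "code m' = ind k G n" "sem_mor P m' d l"
    and "code m'' = ind h K n" "sem_mor P m'' c l"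
    and "\<And>x. x \<in> code a \<Longrightarrow> K x = G (F x)"
    and "pr \<sigma> \<tau> \<in> sem_Wmor W m c d" "pr \<tau> \<rho> \<in> sem_Wmor W m' d l"
  shows "pr \<sigma> \<rho> \<in> sem_Wmor W m'' c l"
proof -
  have "code m'' = sem_comp (code m') (code m)"
    using ind_cong[OF c, of K "\<lambda>x. G (F x)" n] ind_comp[OF d c assms(3), of G n] assms(4,6,8,10) by simp
  then have "sem_Wmor W m'' c l = sem_comp (sem_Wmor W m' d l) (sem_Wmor W m c d)"
    using dilator assms(5,7,9) unfolding sem_dilator_def sem_functor_def by blast
  then show ?thesis using assms(11,12) unfolding sem_comp_def by blast
qed

text \<open>By naturality the support of \<tau> is the image of the support of \<sigma>; the latter
  is full and the morphism is onto.\<close>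

lemma trace_onto:
  assumes "sem_mor P m c d" "pr \<sigma> \<tau> \<in> sem_Wmor W m c d" "sem_trace P W c \<sigma>"
    and onto: "sem_Image (code m) (sem_field (code c)) = sem_field (code d)"
  shows "sem_trace P W d \<tau>"
proof -
  have d: "d \<in> P" using assms(1) by (simp add: sem_mor_def)
  have \<tau>: "\<tau> \<in> sem_field (sem_ord W d)" using Wmor_field[OF assms(1,2)] .
  obtain a where a: "pr \<sigma> a \<in> sem_supp W c" "code a = sem_field (code c)"
    using assms(3) unfolding sem_trace_def by blast
  have nat: "sem_natural P W" using dilator unfolding sem_dilator_def by blast
  then obtain b where b: "pr \<tau> b \<in> sem_supp W d"
    using d \<tau> unfolding sem_natural_def sem_function_def by blast
  have "code b = sem_Image (code m) (code a)"
    using nat assms(1,2) a(1) b unfolding sem_natural_def by blast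
  then show ?thesis using d \<tau> a(2) b onto unfolding sem_trace_def by auto
qed

text \<open>
  The image of the element \<open>(a, \<sigma>)\<close> of the extension under \<open>F\<close>.
\<close>

definition pushes :: "'a \<Rightarrow> 'a \<Rightarrow> 'a \<Rightarrow> 'a \<Rightarrow> ('a \<Rightarrow> 'a) \<Rightarrow> 'a set \<Rightarrow> 'a \<Rightarrow> 'a \<Rightarrow> 'a \<Rightarrow> 'a \<Rightarrow> 'a \<Rightarrow> bool" where
  "pushes a \<sigma> c h F Y b \<tau> d k m \<longleftrightarrow> isfin b \<and> code b = F ` code a \<and> sem_enum E Y b d k \<and>
     isfin m \<and> code m = ind h F k \<and> pr \<sigma> \<tau> \<in> sem_Wmor W m c d"

lemma pushes_ex:
  assumes c: "chart X a c h" and \<sigma>: "sem_trace P W c \<sigma>" and "Y \<in> S" "sem_po Y"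
    and F: "graph_on G (code a) F" "F ` code a \<subseteq> sem_field Y" "reflects X a F Y"
  obtains b \<tau> d k m where "pushes a \<sigma> c h F Y b \<tau> d k m"
proof -
  obtain b where b: "isfin b" "code b = F ` code a" using ex_code_image[OF F(1)] .
  obtain d k where dk: "sem_enum E Y b d k" using enum_ex[OF assms(3,4)] F(2) b(2) by metis
  then have "chart Y b d k" using enum_chart[OF assms(4)] F(2) b(2) by metis
  then obtain m where m: "isfin m" "code m = ind h F k" "sem_mor P m c d"
    using induced_morphism[OF c _ F(1) _ F(3)] b(2) by (metis order_refl)
  obtain \<tau> where "pr \<sigma> \<tau> \<in> sem_Wmor W m c d"
    using Wmor_total[OF m(3)] \<sigma> unfolding sem_trace_def by blast
  then show ?thesis using that b dk m unfolding pushes_def by blast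
qed

text \<open>Since b is exactly the image, the induced morphism is onto and the support stays full;
  hence the result is an element of the extension.\<close>

lemma pushesD:
  assumes p: "pushes a \<sigma> c h F Y b \<tau> d k m"
    and c: "chart X a c h" and \<sigma>: "sem_trace P W c \<sigma>" and "sem_po Y"
    and F: "graph_on G (code a) F" "F ` code a \<subseteq> sem_field Y" "reflects X a F Y"
  shows "chart Y b d k" "sem_mor P m c d" "sem_trace P W d \<tau>" "pr b \<tau> \<in> sem_elem P E W Y"
proof -
  have p': "isfin b" "code b = F ` code a" "sem_enum E Y b d k" "isfin m" "code m = ind h F k"
    "pr \<sigma> \<tau> \<in> sem_Wmor W m c d"
    using p unfolding pushes_def by blast+
  show d: "chart Y b d k" using enum_chart[OF assms(4) _ p'(3)] F(2) p'(2) by metis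
  obtain m' where m': "isfin m'" "code m' = ind h F k" "sem_mor P m' c d"
    using induced_morphism[OF c d F(1) _ F(3)] p'(2) by (metis order_refl)
  \<comment> \<open>Least codes are unique, so the morphism built here is the one recorded in
    \<open>pushes\<close>.\<close>
  then have "m' = m" using isfin_inject p' by metis
  with m' show mor: "sem_mor P m c d" by simp
  have "sem_Image (code m) (sem_field (code c)) = sem_field (code d)"
  proof (intro set_eqI iffI)
    fix v assume "v \<in> sem_Image (code m) (sem_field (code c))"
    then show "v \<in> sem_field (code d)" unfolding sem_Image_def p'(5) ind_iff using chartD(2)[OF d] by blast
  next
    fix v assume "v \<in> sem_field (code d)"
    then obtain y where y: "pr v y \<in> code k" using chartD(4)[OF d] by blast
    then obtain x where x: "x \<in> code a" "y = F x" using chartD(3)[OF d] p'(2) by blast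
    then obtain u where "pr u x \<in> code h" using chartD(5)[OF c] by blast
    then show "v \<in> sem_Image (code m) (sem_field (code c))"
      unfolding sem_Image_def p'(5) ind_iff using x y chartD(2)[OF c] by blast
  qed
  then show \<tau>: "sem_trace P W d \<tau>" using trace_onto[OF mor p'(6) \<sigma>] by blast
  show "pr b \<tau> \<in> sem_elem P E W Y"
    unfolding sem_elem_def sem_Fin_def using p' F(2) \<tau> by blast
qed

text \<open>All data are determined by least codes and by \<open>E\<close>. This makes the images of
  one element along a sequence of maps a single-valued sequence.\<close>

lemma pushes_unique:
  assumes p: "pushes a \<sigma> c h F Y b \<tau> d k m" and p': "pushes a \<sigma> c h F Y b' \<tau>' d' k' m'"
    and c: "chart X a c h" and \<sigma>: "sem_trace P W c \<sigma>" and "sem_po Y"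
    and F: "graph_on G (code a) F" "F ` code a \<subseteq> sem_field Y" "reflects X a F Y"
  shows "b = b'" "\<tau> = \<tau>'" "d = d'" "k = k'"
proof -
  have q: "isfin b" "code b = F ` code a" "sem_enum E Y b d k" "isfin m" "code m = ind h F k"
    "pr \<sigma> \<tau> \<in> sem_Wmor W m c d"
    using p unfolding pushes_def by blast+
  have q': "isfin b'" "code b' = F ` code a" "sem_enum E Y b' d' k'" "isfin m'" "code m' = ind h F k'"
    "pr \<sigma> \<tau>' \<in> sem_Wmor W m' c d'"
    using p' unfolding pushes_def by blast+
  show b: "b = b'" using isfin_inject[OF q(1) q'(1)] q(2) q'(2) by simp
  have "code b \<subseteq> sem_field Y" using q(2) F(2) by simp
  from enum_unique[OF assms(5) this q(3)] q'(3) show dk: "d = d'" "k = k'" unfolding b by blast+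
  have "m = m'" using isfin_inject[OF q(4) q'(4)] q(5) q'(5) dk by simp
  then show "\<tau> = \<tau>'"
    using Wmor_functional[OF pushesD(2)[OF p c \<sigma> assms(5) F] q(6)] q'(6) dk by simp
qed

lemma elem_chartE:
  assumes "p \<in> sem_elem P E W X" "sem_po X"
  obtains a \<sigma> c h where "p = pr a \<sigma>" "isfin a" "code a \<subseteq> sem_field X" "sem_enum E X a c h"
    "chart X a c h" "sem_trace P W c \<sigma>"
  using assms enum_chart unfolding sem_elem_def sem_Fin_def by blast

lemma pushes_map:
  assumes "pr a \<sigma> \<in> sem_elem P E W X" "sem_enum E X a c h"
    and p: "pushes a \<sigma> c h F Y b \<tau> d k m" and c: "chart X a c h" and \<sigma>: "sem_trace P W c \<sigma>" and "sem_po Y"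
    and F: "graph_on f (code a) F" "F ` code a \<subseteq> sem_field Y" "reflects X a F Y"
  shows "sem_map P E W X Y f (pr a \<sigma>) (pr b \<tau>)"
proof -
  have p': "code b = F ` code a" "sem_enum E Y b d k" "isfin m" "code m = ind h F k"
    "pr \<sigma> \<tau> \<in> sem_Wmor W m c d"
    using p unfolding pushes_def by blast+
  have "code b = sem_Image f (code a)"
    using F(1) p'(1) unfolding graph_on_def sem_Image_def by auto
  moreover have "sem_induced m h f k" using induced_iff[OF c F(1)] p' by blast
  ultimately show ?thesis
    unfolding sem_map_def using assms(1,2) pushesD(4)[OF p c \<sigma> assms(6) F] p' by blast
qed

end

section \<open>Monotonicity\<close>

context arithmetic
begin

text \<open>The embeddings of a finite antichain into the sum of chains.\<close>

definition lev :: "'a set \<Rightarrow> 'a \<Rightarrow> 'a \<Rightarrow> 'a" where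
  "lev B n x = pr x (if x \<in> B then 0 else n)"

lemma lev_graph:
  assumes "B \<in> S"
  obtains G where "graph_on G (code a) (lev B n)"
proof -
  let ?P = "\<lambda>t. \<exists>x<a. x \<in> code a \<and> (x \<in> B \<and> t = pr x (pr x 0) \<or> x \<notin> B \<and> t = pr x (pr x n))"
  have "{t. ?P t} \<in> S" by (intro comprehension sigma1_delta0 def_intros assms)
  moreover have "pr x y \<in> {t. ?P t} \<longleftrightarrow> y = lev B n x" if "x \<in> code a" for x y
    using that code_bound[OF that] by (auto simp: lev_def)
  ultimately show ?thesis using that unfolding graph_on_def by blast
qed

lemma lev_field: "lev B n ` code a \<subseteq> sem_field (chains a B)"
  unfolding lev_def by (auto simp: field_chains)

text \<open>Image and induced morphism are definable uniformly in the level, which is read from the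
  environment; this is what makes the sequence over all levels a set of the model.\<close>

lemma delta0_lev:
  assumes "B \<in> S"
  shows "delta0 S (\<lambda>e. code (e 0) = lev B (e (Suc 0)) ` code a)"
    and "delta0 S (\<lambda>e. code (e 0) =
      {t. \<exists>u v x. t = pr u v \<and> pr u x \<in> code h \<and> pr v (lev B (e (Suc 0)) x) \<in> code (e (Suc (Suc 0)))})"
proof -
  have "lev B n ` code a = {z. \<exists>x<a. x \<in> code a \<and> (x \<in> B \<and> z = pr x 0 \<or> x \<notin> B \<and> z = pr x n)}" for n
    unfolding lev_def by (auto split: if_splits) (use code_bound in blast)+
  moreover have "delta0 S (\<lambda>e. code (e 0) =
      {z. \<exists>x<a. x \<in> code a \<and> (x \<in> B \<and> z = pr x 0 \<or> x \<notin> B \<and> z = pr x (e (Suc 0)))})"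
  proof (rule delta0_code_eq[where b = "\<lambda>e. pr a (e (Suc 0))"])
    show "z < pr a (e (Suc 0))"
      if "\<exists>x<a. x \<in> code a \<and> (x \<in> B \<and> z = pr x 0 \<or> x \<notin> B \<and> z = pr x (e (Suc 0)))" for z and e :: "nat \<Rightarrow> 'a"
      using that by (auto intro!: pr_less add_less_le_mono)
  qed (intro def_intros assms)+
  ultimately show "delta0 S (\<lambda>e. code (e 0) = lev B (e (Suc 0)) ` code a)" by simp
  have less: "u < j \<and> x < j" if "pr u x \<in> code j" for u x j
    using code_bound[OF that] by (meson le_less_trans pr_le)
  have "(\<exists>u v x. t = pr u v \<and> pr u x \<in> code h \<and> pr v (lev B n x) \<in> code k) \<longleftrightarrow>
      (\<exists>u<h. \<exists>x<h. \<exists>v<k. t = pr u v \<and> pr u x \<in> code h \<and>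
        (x \<in> B \<and> pr v (pr x 0) \<in> code k \<or> x \<notin> B \<and> pr v (pr x n) \<in> code k))" for t n k
    unfolding lev_def using less by (auto split: if_splits) blast+
  moreover have "delta0 S (\<lambda>e. code (e 0) =
      {t. \<exists>u<h. \<exists>x<h. \<exists>v<e (Suc (Suc 0)). t = pr u v \<and> pr u x \<in> code h \<and>
        (x \<in> B \<and> pr v (pr x 0) \<in> code (e (Suc (Suc 0))) \<or> x \<notin> B \<and> pr v (pr x (e (Suc 0))) \<in> code (e (Suc (Suc 0))))})"
  proof (rule delta0_code_eq[where b = "\<lambda>e. pr h (e (Suc (Suc 0)))"])
    show "t < pr h (e (Suc (Suc 0)))"
      if "\<exists>u<h. \<exists>x<h. \<exists>v<e (Suc (Suc 0)). t = pr u v \<and> pr u x \<in> code h \<and>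
        (x \<in> B \<and> pr v (pr x 0) \<in> code (e (Suc (Suc 0))) \<or> x \<notin> B \<and> pr v (pr x (e (Suc 0))) \<in> code (e (Suc (Suc 0))))"
      for t and e :: "nat \<Rightarrow> 'a"
      using that by (auto intro!: pr_less add_strict_mono)
  qed (intro def_intros assms)+
  ultimately show "delta0 S (\<lambda>e. code (e 0) =
      {t. \<exists>u v x. t = pr u v \<and> pr u x \<in> code h \<and> pr v (lev B (e (Suc 0)) x) \<in> code (e (Suc (Suc 0)))})"
    by simp
qed

lemma delta0_restr:
  assumes "X \<in> S"
  shows "delta0 S (\<lambda>e. code (e 0) =
    {t. \<exists>x y. t = pr x y \<and> x \<in> code (e (Suc 0)) \<and> y \<in> code (e (Suc 0)) \<and> pr x y \<in> X})"
proof -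
  have "(\<exists>x y. t = pr x y \<and> x \<in> code b \<and> y \<in> code b \<and> pr x y \<in> X) \<longleftrightarrow>
      (\<exists>x<b. \<exists>y<b. t = pr x y \<and> x \<in> code b \<and> y \<in> code b \<and> pr x y \<in> X)" for t b
    using code_bound by blast
  moreover have "delta0 S (\<lambda>e. code (e 0) = {t. \<exists>x<e (Suc 0). \<exists>y<e (Suc 0).
      t = pr x y \<and> x \<in> code (e (Suc 0)) \<and> y \<in> code (e (Suc 0)) \<and> pr x y \<in> X})"
  proof (rule delta0_code_eq[where b = "\<lambda>e. pr (e (Suc 0)) (e (Suc 0))"])
    show "t < pr (e (Suc 0)) (e (Suc 0))" if "\<exists>x<e (Suc 0). \<exists>y<e (Suc 0).
      t = pr x y \<and> x \<in> code (e (Suc 0)) \<and> y \<in> code (e (Suc 0)) \<and> pr x y \<in> X" for t and e :: "nat \<Rightarrow> 'a"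
      using that by (auto intro!: pr_less add_strict_mono)
  qed (intro def_intros assms)+
  ultimately show ?thesis by simp
qed

end

context coded_dilator
begin

text \<open>The map from n to the image of \<sigma> at level n is total, single-valued and
  Sigma-definable, hence an infinite sequence inside the model, to which goodness applies.\<close>

lemma good_pair:
  assumes X: "sem_po X" "code a \<subseteq> sem_field X" "chart X a c h" "sem_trace P W c \<sigma>" and "B \<in> S"
    and good: "sem_good (sem_elem P E W (chains a B)) (sem_le P E W (chains a B))"
  obtains i j b \<tau> d k m b' \<tau>' d' k' m' where "i < j"
    "pushes a \<sigma> c h (lev B i) (chains a B) b \<tau> d k m"
    "pushes a \<sigma> c h (lev B j) (chains a B) b' \<tau>' d' k' m'"
    "sem_le P E W (chains a B) (pr b \<tau>) (pr b' \<tau>')"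
proof -
  let ?Z = "chains a B"
  note Z = chains_in_S[OF \<open>B \<in> S\<close>, of a]
  \<comment> \<open>Only points over the same x are comparable in the chains, and x is below itself
    in X.\<close>
  have refl: "reflects X a (lev B n) ?Z" for n
    unfolding reflects_def lev_def chains_iff using X(2) by (auto simp: sem_field_def)
  define R where "R n p \<longleftrightarrow> (\<exists>b \<tau> d k m. p = pr b \<tau> \<and> pushes a \<sigma> c h (lev B n) ?Z b \<tau> d k m)" for n p
  have ex1: "\<exists>!p. R n p" for n
  proof -
    obtain G where G: "graph_on G (code a) (lev B n)" using lev_graph[OF \<open>B \<in> S\<close>] .
    obtain b \<tau> d k m where "pushes a \<sigma> c h (lev B n) ?Z b \<tau> d k m"
      using pushes_ex[OF X(3,4) Z po_chains G lev_field refl] .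
    then have "R n (pr b \<tau>)" unfolding R_def by blast
    moreover have "p = p'" if "R n p" "R n p'" for p p'
      using that pushes_unique(1,2)[OF _ _ X(3,4) po_chains G lev_field refl] unfolding R_def by blast
    ultimately show ?thesis by blast
  qed
  have elem: "p \<in> sem_elem P E W ?Z" if "R n p" for n p
  proof -
    obtain G where G: "graph_on G (code a) (lev B n)" using lev_graph[OF \<open>B \<in> S\<close>] .
    show ?thesis
      using that pushesD(4)[OF _ X(3,4) po_chains G lev_field refl] unfolding R_def by blast
  qed
  \<comment> \<open>All definitions are flattened to number quantifiers in front of a bounded
    matrix, the shape required of a Sigma predicate.\<close>
  have R_iff: "R n p \<longleftrightarrow> (\<exists>b \<tau> d k m q. p = pr b \<tau> \<and> isfin b \<and> code b = lev B n ` code a \<and>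
      isfin q \<and> code q = {t. \<exists>x y. t = pr x y \<and> x \<in> code b \<and> y \<in> code b \<and> pr x y \<in> ?Z} \<and> pr (pr q d) k \<in> E \<and>
      isfin m \<and> code m = {t. \<exists>u v x. t = pr u v \<and> pr u x \<in> code h \<and> pr v (lev B n x) \<in> code k} \<and>
      pr 1 (pr (pr (pr c d) m) (pr \<sigma> \<tau>)) \<in> W)" for n p
    unfolding R_def pushes_def sem_enum_def sem_Wmor_def ind_def mem_Collect_eq
    by (rule iffI; elim exE conjE; intro exI conjI; assumption)
  define s where "s = {t. \<exists>n p. t = pr n p \<and> R n p}"
  have "s \<in> S" unfolding s_def
  proof (rule graph_in_S[OF _ ex1])
    have 1: "delta0 S (\<lambda>e. code (e i) = lev B (e j) ` code a)" for i j
      using delta0_rename[OF delta0_lev(1)[OF \<open>B \<in> S\<close>], of "case_nat i (\<lambda>_. j)"] by simp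
    have 2: "delta0 S (\<lambda>e. code (e i) =
      {t. \<exists>u v x. t = pr u v \<and> pr u x \<in> code h \<and> pr v (lev B (e j) x) \<in> code (e k)})" for i j k
      using delta0_rename[OF delta0_lev(2)[OF \<open>B \<in> S\<close>], of "case_nat i (case_nat j (\<lambda>_. k))"] by simp
    have 3: "delta0 S (\<lambda>e. code (e i) =
      {t. \<exists>x y. t = pr x y \<and> x \<in> code (e j) \<and> y \<in> code (e j) \<and> pr x y \<in> ?Z})" for i j
      using delta0_rename[OF delta0_restr[OF Z], of "case_nat i (\<lambda>_. j)"] by simp
    show "sigma1 S (\<lambda>e. R (e 0) (e (Suc 0)))"
      unfolding R_iff
      by (intro sigma1_ex, rule sigma1_delta0) (intro 1 2 3 def_intros E_in_S W_in_S)
  qed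
  moreover have "sem_function s UNIV (sem_elem P E W ?Z)"
  proof -
    have "\<exists>p. R n p" for n using ex1[of n] by blast
    moreover have "p = q" if "R n p" "R n q" for n p q using ex1[of n] that by blast
    ultimately show ?thesis unfolding sem_function_def s_def using elem by auto
  qed
  ultimately obtain i j p q where "i < j" "pr i p \<in> s" "pr j q \<in> s" and le: "sem_le P E W ?Z p q"
    using good unfolding sem_good_def by blast
  then have "R i p" "R j q" by (auto simp: s_def)
  with le \<open>i < j\<close> show ?thesis using that unfolding R_def by blast
qed

text \<open>The image of \<sigma> under F, seen in W(l) for a chart n of a finite set that contains
  the values of F. In contrast to \<open>pushes\<close> this set may be larger, so that images under
  several maps can be compared in one order.\<close>

definition val :: "'a \<Rightarrow> 'a \<Rightarrow> 'a \<Rightarrow> ('a \<Rightarrow> 'a) \<Rightarrow> 'a \<Rightarrow> 'a \<Rightarrow> 'a \<Rightarrow> bool" where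
  "val c h \<sigma> F l n \<rho> \<longleftrightarrow>
     (\<exists>m. isfin m \<and> code m = ind h F n \<and> sem_mor P m c l \<and> pr \<sigma> \<rho> \<in> sem_Wmor W m c l)"

lemma val_ex:
  assumes c: "chart X a c h" and "sem_trace P W c \<sigma>" and e: "chart Y e l n"
    and F: "graph_on f (code a) F" "F ` code a \<subseteq> code e" "reflects X a F Y"
  obtains \<rho> where "val c h \<sigma> F l n \<rho>"
proof -
  obtain m where m: "isfin m" "code m = ind h F n" "sem_mor P m c l"
    using induced_morphism[OF c e F] .
  obtain \<rho> where "pr \<sigma> \<rho> \<in> sem_Wmor W m c l"
    using Wmor_total[OF m(3)] assms(2) unfolding sem_trace_def by blast
  with m that show ?thesis unfolding val_def by blast
qed

lemma val_unique: "val c h \<sigma> F l n \<rho> \<Longrightarrow> val c h \<sigma> F l n \<rho>' \<Longrightarrow> \<rho> = \<rho>'"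
  unfolding val_def using isfin_inject Wmor_functional by metis

lemma val_field: "val c h \<sigma> F l n \<rho> \<Longrightarrow> \<rho> \<in> sem_field (sem_ord W l)"
  unfolding val_def using Wmor_field by blast

text \<open>Functoriality in terms of values: applying the morphism induced by K to the value along
  F gives the value along the composite.\<close>

lemma val_push:
  assumes c: "chart X a c h" and e: "chart Y e l n" "F ` code a \<subseteq> code e" and F: "val c h \<sigma> F l n \<rho>"
    and K: "code mK = ind n K n'" "sem_mor P mK l l'" "pr \<rho> \<omega> \<in> sem_Wmor W mK l l'"
    and e': "chart Z e' l' n'" and H: "graph_on G (code a) H" "H ` code a \<subseteq> code e'" "reflects X a H Z"
    and eq: "\<And>x. x \<in> code a \<Longrightarrow> H x = K (F x)"
  shows "val c h \<sigma> H l' n' \<omega>"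
proof -
  obtain m where m: "code m = ind h F n" "sem_mor P m c l" "pr \<sigma> \<rho> \<in> sem_Wmor W m c l"
    using F unfolding val_def by blast
  obtain m' where m': "isfin m'" "code m' = ind h H n'" "sem_mor P m' c l'"
    using induced_morphism[OF c e' H] .
  have "pr \<sigma> \<omega> \<in> sem_Wmor W m' c l'"
    by (rule Wmor_comp[OF c e m(1,2) K(1,2) m'(2,3) eq m(3) K(3)])
  with m' show ?thesis unfolding val_def by blast
qed

lemma pushes_val:
  assumes p: "pushes a \<sigma> c h F Y b \<tau> d k m" and c: "chart X a c h" and \<sigma>: "sem_trace P W c \<sigma>" and Y: "sem_po Y"
    and F: "graph_on f (code a) F" "F ` code a \<subseteq> sem_field Y" "reflects X a F Y"
  shows "val c h \<sigma> F d k \<tau>"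
  using p pushesD(2)[OF p c \<sigma> Y F] unfolding pushes_def val_def by blast

lemma inclusion:
  assumes d: "chart Y b d k" and e: "chart Y e l n" and "code b \<subseteq> code e"
  obtains m where "isfin m" "code m = ind k (\<lambda>x. x) n" "sem_mor P m d l" "sem_emb (code m) (code d) (code l)"
proof -
  obtain m where m: "isfin m" "code m = ind k (\<lambda>x. x) n" "sem_mor P m d l"
    by (rule induced_morphism[OF d e graph_on_Id]) (use assms(3) in \<open>auto simp: reflects_def\<close>)
  have "pr v v' \<in> code l" if "pr u v \<in> code m" "pr u' v' \<in> code m" "pr u u' \<in> code d" for u u' v v'
    using that chartD(8)[OF d] chartD(8)[OF e] unfolding m(2) ind_iff by blast
  then have "sem_emb (code m) (code d) (code l)" using m(3) unfolding sem_emb_def sem_mor_def by blast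
  with m that show ?thesis by blast
qed

text \<open>The witnesses in \<open>sem_le\<close> are forced: the code of the union, the
  enumerations, the inclusions, and the images of \<tau> and \<tau>' under them. So the comparison
  made there is that of the two values.\<close>

lemma val_le_iff:
  assumes X: "sem_po X" "code a \<subseteq> sem_field X" "chart X a c h" "sem_trace P W c \<sigma>" and Y: "sem_po Y"
    and F: "graph_on f (code a) F" "F ` code a \<subseteq> sem_field Y" "reflects X a F Y"
    and G: "graph_on g (code a) G" "G ` code a \<subseteq> sem_field Y" "reflects X a G Y"
    and p: "pushes a \<sigma> c h F Y b \<tau> d k m" and q: "pushes a \<sigma> c h G Y b' \<tau>' d' k' m'"
    and e: "isfin e" "code e = code b \<union> code b'" "sem_enum E Y e l n" "chart Y e l n"
    and \<rho>: "val c h \<sigma> F l n \<rho>" "val c h \<sigma> G l n \<rho>'"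
  shows "sem_le P E W Y (pr b \<tau>) (pr b' \<tau>') \<longleftrightarrow> pr \<rho> \<rho>' \<in> sem_ord W l"
proof -
  note c = X(3) and \<sigma> = X(4)
  note d = pushesD[OF p c \<sigma> Y F] and d' = pushesD[OF q c \<sigma> Y G]
  have b: "code b = F ` code a" "code b' = G ` code a" "sem_enum E Y b d k" "sem_enum E Y b' d' k'"
    using p q unfolding pushes_def by blast+
  have sub: "code b \<subseteq> code e" "code b' \<subseteq> code e" using e(2) by auto
  have sub': "code b \<subseteq> sem_field Y" "code b' \<subseteq> sem_field Y" using b F(2) G(2) by simp_all
  obtain i where i: "isfin i" "code i = ind k (\<lambda>x. x) n" "sem_mor P i d l"
    using inclusion[OF d(1) e(4) sub(1)] .
  obtain i' where i': "isfin i'" "code i' = ind k' (\<lambda>x. x) n" "sem_mor P i' d' l"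
    using inclusion[OF d'(1) e(4) sub(2)] .
  note vp = pushes_val[OF p c \<sigma> Y F] and vq = pushes_val[OF q c \<sigma> Y G]
  have \<tau>: "\<omega> = \<rho>" if "pr \<tau> \<omega> \<in> sem_Wmor W i d l" for \<omega>
    by (rule val_unique[OF val_push[OF c d(1) _ vp i(2,3) that e(4) F(1) _ F(3)] \<rho>(1)]) (use b sub in auto)
  have \<tau>': "\<omega> = \<rho>'" if "pr \<tau>' \<omega> \<in> sem_Wmor W i' d' l" for \<omega>
    by (rule val_unique[OF val_push[OF c d'(1) _ vq i'(2,3) that e(4) G(1) _ G(3)] \<rho>(2)]) (use b sub in auto)
  have ex: "pr \<tau> \<rho> \<in> sem_Wmor W i d l" "pr \<tau>' \<rho>' \<in> sem_Wmor W i' d' l"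
    using Wmor_total[OF i(3) val_field[OF vp]] Wmor_total[OF i'(3) val_field[OF vq]] \<tau> \<tau>' by metis+
  have ind: "sem_induced j k (sem_Id (code b)) n \<longleftrightarrow> j = i" "sem_induced j k' (sem_Id (code b')) n \<longleftrightarrow> j = i'" for j
    using induced_iff[OF d(1) graph_on_Id] induced_iff[OF d'(1) graph_on_Id] i i' isfin_inject by metis+
  show ?thesis
  proof
    assume "pr \<rho> \<rho>' \<in> sem_ord W l"
    then show "sem_le P E W Y (pr b \<tau>) (pr b' \<tau>')"
      unfolding sem_le_def using d(4) d'(4) e(1,2,3) b(3,4) ind ex by blast
  next
    assume "sem_le P E W Y (pr b \<tau>) (pr b' \<tau>')"
    then obtain a0 \<sigma>0 b0 \<tau>0 e' c0 h0 d0 k0 l' n' j j' \<omega> \<omega>' where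
      *: "pr b \<tau> = pr a0 \<sigma>0" "pr b' \<tau>' = pr b0 \<tau>0" "isfin e'" "code e' = code a0 \<union> code b0"
      "sem_enum E Y a0 c0 h0" "sem_enum E Y b0 d0 k0" "sem_enum E Y e' l' n'"
      "sem_induced j h0 (sem_Id (code a0)) n'" "sem_induced j' k0 (sem_Id (code b0)) n'"
      "pr \<sigma>0 \<omega> \<in> sem_Wmor W j c0 l'" "pr \<tau>0 \<omega>' \<in> sem_Wmor W j' d0 l'" "pr \<omega> \<omega>' \<in> sem_ord W l'"
      unfolding sem_le_def by (elim exE conjE)
    have eqs: "a0 = b" "\<sigma>0 = \<tau>" "b0 = b'" "\<tau>0 = \<tau>'" using *(1,2) by simp_all
    have "e' = e" using isfin_inject[OF *(3) e(1)] *(4) e(2) eqs by simp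
    have "code e \<subseteq> sem_field Y" using sub' e(2) by simp
    then have "l' = l" "n' = n" using enum_unique[OF Y _ _ e(3)] *(7) \<open>e' = e\<close> by blast+
    moreover have "c0 = d" "h0 = k" using enum_unique[OF Y sub'(1) _ b(3)] *(5) eqs by blast+
    moreover have "d0 = d'" "k0 = k'" using enum_unique[OF Y sub'(2) _ b(4)] *(6) eqs by blast+
    ultimately show "pr \<rho> \<rho>' \<in> sem_ord W l" using * eqs ind \<tau> \<tau>' by auto
  qed
qed

text \<open>
  If \<open>F\<close> and \<open>G\<close> collide only where they agree, then \<open>F x \<mapsto> lev B i x\<close> and \<open>G x \<mapsto> lev B j x\<close>
  define a quasi embedding into the sum of chains, along which the inequality for \<open>lev\<close> is reflected.
\<close>

lemma val_le_separated:
  assumes X: "sem_po X" "code a \<subseteq> sem_field X" "chart X a c h" "sem_trace P W c \<sigma>"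
    and wpo: "\<And>Z. Z \<in> S \<Longrightarrow> sem_wpo Z \<Longrightarrow> sem_good (sem_elem P E W Z) (sem_le P E W Z)"
    and Y: "Y \<in> S" "sem_po Y"
    and F: "graph_on f (code a) F" "F ` code a \<subseteq> sem_field Y" "reflects X a F Y"
    and G: "graph_on g (code a) G" "G ` code a \<subseteq> sem_field Y" "reflects X a G Y"
    and le: "\<And>x. x \<in> code a \<Longrightarrow> pr (F x) (G x) \<in> Y"
    and sep: "\<And>x x'. x \<in> code a \<Longrightarrow> x' \<in> code a \<Longrightarrow> F x = G x' \<Longrightarrow> x = x'"
    and e: "chart Y e l n" "F ` code a \<subseteq> code e" "G ` code a \<subseteq> code e"
    and \<rho>: "val c h \<sigma> F l n \<rho>" "val c h \<sigma> G l n \<rho>'"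
  shows "pr \<rho> \<rho>' \<in> sem_ord W l"
proof -
  note c = X(3) and \<sigma> = X(4)
  have f: "pr x y \<in> f \<longleftrightarrow> y = F x" if "x \<in> code a" for x y
    using F(1) that unfolding graph_on_def by blast
  have g: "pr x y \<in> g \<longleftrightarrow> y = G x" if "x \<in> code a" for x y
    using G(1) that unfolding graph_on_def by blast
  have fg: "f \<in> S" "g \<in> S" using F(1) G(1) unfolding graph_on_def by blast+
  have X_antisym: "y = z" if "pr y z \<in> X" "pr z y \<in> X" for y z
    using X(1) that unfolding sem_po_def by blast
  have inj: "x = x'" if x: "x \<in> code a" "x' \<in> code a" and "K x = K x'"
    and K: "K ` code a \<subseteq> sem_field Y" "reflects X a K Y" for K x x'
  proof -
    have "pr (K x) (K x') \<in> Y" "pr (K x') (K x) \<in> Y"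
      using K(1) x \<open>K x = K x'\<close> by (auto simp: sem_field_def)
    then show ?thesis using K(2) x X_antisym unfolding reflects_def by blast
  qed
  obtain b1 where b1: "code b1 = F ` code a" using ex_code_image[OF F(1)] by blast
  obtain b2 where b2: "code b2 = G ` code a" using ex_code_image[OF G(1)] by blast
  \<comment> \<open>K below makes sense on the union of the two images only, while e may have
    further points. The comparison is carried out over e1 and moved to e at the end.\<close>
  obtain e1 where "code e1 = code b1 \<union> code b2" using ex_code_union by blast
  then have e1: "code e1 = F ` code a \<union> G ` code a" using b1 b2 by simp
  then have "code e1 \<subseteq> sem_field Y" using F(2) G(2) by simp
  then obtain l1 n1 where "sem_enum E Y e1 l1 n1" using enum_ex[OF Y] by blast
  then have ch1: "chart Y e1 l1 n1" by (rule enum_chart[OF Y(2) \<open>code e1 \<subseteq> sem_field Y\<close>])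
  have sub1: "F ` code a \<subseteq> code e1" "G ` code a \<subseteq> code e1" "code e1 \<subseteq> code e" using e1 e(2,3) by auto
  obtain \<rho>1 where \<rho>1: "val c h \<sigma> F l1 n1 \<rho>1" using val_ex[OF c \<sigma> ch1 F(1) sub1(1) F(3)] .
  obtain \<rho>1' where \<rho>1': "val c h \<sigma> G l1 n1 \<rho>1'" using val_ex[OF c \<sigma> ch1 G(1) sub1(2) G(3)] .

  \<comment> \<open>For these x the single point \<open>F x = G x\<close> must go to levels i and j
    at once, so the chain over x gets one level only.\<close>
  define B where "B = {x. \<exists>y<e1. pr x y \<in> f \<and> pr x y \<in> g}"
  have "B \<in> S" unfolding B_def by (intro comprehension sigma1_delta0 def_intros fg)
  have B: "x \<in> B \<longleftrightarrow> F x = G x" if "x \<in> code a" for x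
  proof -
    have "F x < e1" using sub1(1) that code_bound by blast
    then show ?thesis unfolding B_def using f[OF that] g[OF that] by auto
  qed
  let ?Z = "chains a B"
  note Z = chains_in_S[OF \<open>B \<in> S\<close>, of a]
  have refl: "reflects X a (lev B i) ?Z" for i
    unfolding reflects_def lev_def chains_iff using X(2) by (auto simp: sem_field_def)
  obtain i j b \<tau> d k m b' \<tau>' d' k' m' where "i < j"
    and p: "pushes a \<sigma> c h (lev B i) ?Z b \<tau> d k m" and q: "pushes a \<sigma> c h (lev B j) ?Z b' \<tau>' d' k' m'"
    and le_Z: "sem_le P E W ?Z (pr b \<tau>) (pr b' \<tau>')"
    using good_pair[OF X \<open>B \<in> S\<close> wpo[OF Z wpo_chains[OF \<open>B \<in> S\<close>]]] .
  have bb: "code b = lev B i ` code a" "code b' = lev B j ` code a"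
    using p q unfolding pushes_def by blast+
  obtain Gi where Gi: "graph_on Gi (code a) (lev B i)" using lev_graph[OF \<open>B \<in> S\<close>] .
  obtain Gj where Gj: "graph_on Gj (code a) (lev B j)" using lev_graph[OF \<open>B \<in> S\<close>] .
  obtain e' where e': "isfin e'" "code e' = code b \<union> code b'" using ex_code_union .
  have "code e' \<subseteq> sem_field ?Z" using e'(2) bb lev_field by auto
  then obtain l' n' where en': "sem_enum E ?Z e' l' n'" using enum_ex[OF Z po_chains] by blast
  then have ch': "chart ?Z e' l' n'" by (rule enum_chart[OF po_chains \<open>code e' \<subseteq> sem_field ?Z\<close>])
  have sub': "lev B i ` code a \<subseteq> code e'" "lev B j ` code a \<subseteq> code e'" using e'(2) bb by auto
  obtain \<omega> where \<omega>: "val c h \<sigma> (lev B i) l' n' \<omega>" using val_ex[OF c \<sigma> ch' Gi sub'(1) refl] .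
  obtain \<omega>' where \<omega>': "val c h \<sigma> (lev B j) l' n' \<omega>'" using val_ex[OF c \<sigma> ch' Gj sub'(2) refl] .
  have \<omega>_le: "pr \<omega> \<omega>' \<in> sem_ord W l'"
    using val_le_iff[OF X po_chains Gi lev_field refl Gj lev_field refl p q e' en' ch' \<omega> \<omega>'] le_Z by blast

  \<comment> \<open>Where the two images overlap the first case wins; separation and the choice of B
    make both cases agree there.\<close>
  define K where "K y = (if y \<in> F ` code a then lev B i (inv_into (code a) F y) else lev B j (inv_into (code a) G y))" for y
  have inj_F: "inj_on F (code a)" and inj_G: "inj_on G (code a)"
    using inj[OF _ _ _ F(2,3)] inj[OF _ _ _ G(2,3)] by (auto intro: inj_onI)
  have KF: "K (F x) = lev B i x" if "x \<in> code a" for x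
    using that inj_F by (simp add: K_def)
  have KG: "K (G x) = lev B j x" if "x \<in> code a" for x
  proof (cases "G x \<in> F ` code a")
    case True
    then obtain x' where "x' \<in> code a" "F x' = G x" by auto
    with sep that have "F x = G x" by blast
    then have "K (G x) = lev B i x" using KF[OF that] by simp
    also have "\<dots> = lev B j x" using B[OF that] \<open>F x = G x\<close> by (simp add: lev_def)
    finally show ?thesis .
  next
    case False
    with that inj_G show ?thesis by (simp add: K_def)
  qed
  have K_cases: "\<exists>x\<in>code a. y = F x \<and> K y = lev B i x \<or> y = G x \<and> K y = lev B j x" if "y \<in> code e1" for y
    using that KF KG unfolding e1 by blast
  \<comment> \<open>K is built from inverse functions of the logic. Its graph inside the model is
    obtained by letting x run through the coded set.\<close>
  define Gk where "Gk = {t. \<exists>y<t + 1. \<exists>z<t + 1. t = pr y z \<and>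
    (\<exists>x<a. x \<in> code a \<and> (pr x y \<in> f \<and> pr x z \<in> Gi \<or> pr x y \<in> g \<and> pr x z \<in> Gj))}"
  have "Gi \<in> S" "Gj \<in> S" using Gi Gj unfolding graph_on_def by blast+
  then have "Gk \<in> S" unfolding Gk_def by (intro comprehension sigma1_delta0 def_intros fg)
  have Gk_iff: "pr y z \<in> Gk \<longleftrightarrow> (\<exists>x\<in>code a. y = F x \<and> z = lev B i x \<or> y = G x \<and> z = lev B j x)" for y z
  proof -
    have "y < pr y z + 1" "z < pr y z + 1" by (simp_all add: less_add_one_iff pr_le)
    then have "pr y z \<in> Gk \<longleftrightarrow> (\<exists>x<a. x \<in> code a \<and> (pr x y \<in> f \<and> pr x z \<in> Gi \<or> pr x y \<in> g \<and> pr x z \<in> Gj))"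
      unfolding Gk_def by auto
    also have "\<dots> \<longleftrightarrow> (\<exists>x\<in>code a. pr x y \<in> f \<and> pr x z \<in> Gi \<or> pr x y \<in> g \<and> pr x z \<in> Gj)"
      using code_bound by blast
    also have "\<dots> \<longleftrightarrow> (\<exists>x\<in>code a. y = F x \<and> z = lev B i x \<or> y = G x \<and> z = lev B j x)"
      using f g Gi Gj unfolding graph_on_def by (intro bex_cong) simp_all
    finally show ?thesis .
  qed
  have Gk: "graph_on Gk (code e1) K"
    unfolding graph_on_def
  proof (intro conjI \<open>Gk \<in> S\<close> ballI allI)
    fix y z assume y: "y \<in> code e1"
    show "pr y z \<in> Gk \<longleftrightarrow> z = K y"
      unfolding Gk_iff using K_cases[OF y] KF KG by auto
  qed
  have K_sub: "K ` code e1 \<subseteq> code e'"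
  proof (rule image_subsetI)
    fix y assume "y \<in> code e1"
    then obtain x where "x \<in> code a" "K y = lev B i x \<or> K y = lev B j x" using K_cases by blast
    then show "K y \<in> code e'" using sub' by auto
  qed
  have K_refl: "reflects Y e1 K ?Z"
    unfolding reflects_def
  proof (intro ballI impI)
    fix y y' assume y: "y \<in> code e1" "y' \<in> code e1" and K: "pr (K y) (K y') \<in> ?Z"
    obtain x where x: "x \<in> code a" "y = F x \<and> K y = lev B i x \<or> y = G x \<and> K y = lev B j x"
      using K_cases[OF y(1)] by blast
    obtain x' where x': "x' \<in> code a" "y' = F x' \<and> K y' = lev B i x' \<or> y' = G x' \<and> K y' = lev B j x'"
      using K_cases[OF y(2)] by blast
    \<comment> \<open>A form common to both cases: the first component names the chain, so
      comparability forces \<open>x = x'\<close>.\<close>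
    have lev: "K y = pr x (if x \<in> B then 0 else if K y = lev B i x then i else j)"
      using x by (auto simp: lev_def)
    have lev': "K y' = pr x' (if x' \<in> B then 0 else if K y' = lev B i x' then i else j)"
      using x' by (auto simp: lev_def)
    from K have "x = x'" by (subst (asm) lev, subst (asm) lev') (simp add: chains_iff)
    have FG_refl: "pr (F x) (F x) \<in> Y" "pr (G x) (G x) \<in> Y"
      using F(2) G(2) x(1) by (auto simp: sem_field_def)
    \<comment> \<open>The critical case: a value of G, at level j, cannot lie below a value of F, at
      the smaller level i, unless the chain over x has length one.\<close>
    have "F x = G x" if "K y = lev B j x" "K y' = lev B i x"
    proof (rule ccontr)
      assume "F x \<noteq> G x"
      then have "x \<notin> B" using B[OF x(1)] by simp
      with K that have "j \<le> i" by (simp add: lev_def chains_iff)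
      with \<open>i < j\<close> show False by simp
    qed
    then show "pr y y' \<in> Y"
      using x(2) x'(2) FG_refl le[OF x(1)] unfolding \<open>x = x'\<close>[symmetric] by auto
  qed
  obtain mK where mK: "code mK = ind n1 K n'" "sem_mor P mK l1 l'"
    using induced_morphism[OF ch1 ch' Gk K_sub K_refl] .
  obtain \<omega>1 where \<omega>1: "pr \<rho>1 \<omega>1 \<in> sem_Wmor W mK l1 l'" using Wmor_total[OF mK(2) val_field[OF \<rho>1]] .
  have "\<omega>1 = \<omega>"
    by (rule val_unique[OF val_push[OF c ch1 sub1(1) \<rho>1 mK \<omega>1 ch' Gi sub'(1) refl] \<omega>]) (simp add: KF)
  obtain \<omega>2 where \<omega>2: "pr \<rho>1' \<omega>2 \<in> sem_Wmor W mK l1 l'" using Wmor_total[OF mK(2) val_field[OF \<rho>1']] .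
  have "\<omega>2 = \<omega>'"
    by (rule val_unique[OF val_push[OF c ch1 sub1(2) \<rho>1' mK \<omega>2 ch' Gj sub'(2) refl] \<omega>']) (simp add: KG)
  \<comment> \<open>W turns the quasi embedding K into a quasi embedding, which reflects the
    inequality between the two levels.\<close>
  have \<rho>1_le: "pr \<rho>1 \<rho>1' \<in> sem_ord W l1"
    using Wmor_reflects[OF mK(2) \<omega>1 \<omega>2] \<omega>_le \<open>\<omega>1 = \<omega>\<close> \<open>\<omega>2 = \<omega>'\<close> by simp

  \<comment> \<open>From e1 to the larger set e the inequality has to be preserved, not reflected,
    so preservation of embeddings is used.\<close>
  obtain mI where mI: "code mI = ind n1 (\<lambda>x. x) n" "sem_mor P mI l1 l" "sem_emb (code mI) (code l1) (code l)"
    using inclusion[OF ch1 e(1) sub1(3)] .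
  then have emb: "sem_emb (sem_Wmor W mI l1 l) (sem_ord W l1) (sem_ord W l)"
    using dilator unfolding sem_dilator_def sem_pres_def by blast
  obtain \<rho>2 where \<rho>2: "pr \<rho>1 \<rho>2 \<in> sem_Wmor W mI l1 l" using Wmor_total[OF mI(2) val_field[OF \<rho>1]] .
  have "\<rho>2 = \<rho>"
    by (rule val_unique[OF val_push[OF c ch1 sub1(1) \<rho>1 mI(1,2) \<rho>2 e(1) F(1) e(2) F(3)] \<rho>(1)]) simp
  obtain \<rho>2' where \<rho>2': "pr \<rho>1' \<rho>2' \<in> sem_Wmor W mI l1 l" using Wmor_total[OF mI(2) val_field[OF \<rho>1']] .
  have "\<rho>2' = \<rho>'"
    by (rule val_unique[OF val_push[OF c ch1 sub1(2) \<rho>1' mI(1,2) \<rho>2' e(1) G(1) e(3) G(3)] \<rho>(2)]) simp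
  show ?thesis
    using emb \<rho>2 \<rho>2' \<rho>1_le \<open>\<rho>2 = \<rho>\<close> \<open>\<rho>2' = \<rho>'\<close> unfolding sem_emb_def by blast
qed

end

context arithmetic
begin

text \<open>
  A new point \<open>pr 1 x\<close> for each \<open>x \<in> A\<close> is added to (a copy of) \<open>Y\<close> strictly between the values
  \<open>F x\<close> and \<open>G x\<close>, with the least possible order.
\<close>

definition interp :: "'a set \<Rightarrow> 'a set \<Rightarrow> ('a \<Rightarrow> 'a) \<Rightarrow> ('a \<Rightarrow> 'a) \<Rightarrow> 'a set" where
  "interp Y A F G = {t.
     (\<exists>y z. t = pr (pr 0 y) (pr 0 z) \<and> pr y z \<in> Y) \<or>
     (\<exists>y x. t = pr (pr 0 y) (pr 1 x) \<and> x \<in> A \<and> pr y (F x) \<in> Y) \<or>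
     (\<exists>x y. t = pr (pr 1 x) (pr 0 y) \<and> x \<in> A \<and> pr (G x) y \<in> Y) \<or>
     (\<exists>x x'. t = pr (pr 1 x) (pr 1 x') \<and> x \<in> A \<and> x' \<in> A \<and> (x = x' \<or> pr (G x) (F x') \<in> Y))}"

lemma interp_iff:
  "pr (pr 0 y) (pr 0 z) \<in> interp Y A F G \<longleftrightarrow> pr y z \<in> Y"
  "pr (pr 0 y) (pr 1 x) \<in> interp Y A F G \<longleftrightarrow> x \<in> A \<and> pr y (F x) \<in> Y"
  "pr (pr 1 x) (pr 0 y) \<in> interp Y A F G \<longleftrightarrow> x \<in> A \<and> pr (G x) y \<in> Y"
  "pr (pr 1 x) (pr 1 x') \<in> interp Y A F G \<longleftrightarrow> x \<in> A \<and> x' \<in> A \<and> (x = x' \<or> pr (G x) (F x') \<in> Y)"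
  by (auto simp: interp_def)

text \<open>The values of F and G stay below b, so conditions on them become bounded quantifiers
  over the graphs.\<close>

lemma interp_in_S:
  assumes "Y \<in> S" "A \<in> S" and F: "graph_on f A F" and G: "graph_on g A G"
    and bound: "\<And>x. x \<in> A \<Longrightarrow> F x < b \<and> G x < b"
  shows "interp Y A F G \<in> S"
proof -
  have f: "f \<in> S" "\<And>x y. x \<in> A \<Longrightarrow> pr x y \<in> f \<longleftrightarrow> y = F x" and g: "g \<in> S" "\<And>x y. x \<in> A \<Longrightarrow> pr x y \<in> g \<longleftrightarrow> y = G x"
    using F G unfolding graph_on_def by blast+
  define Q where "Q t \<longleftrightarrow> (\<exists>y<t + 1. \<exists>z<t + 1. t = pr (pr 0 y) (pr 0 z) \<and> pr y z \<in> Y \<or>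
     t = pr (pr 0 y) (pr 1 z) \<and> z \<in> A \<and> (\<exists>v<b. pr z v \<in> f \<and> pr y v \<in> Y) \<or>
     t = pr (pr 1 y) (pr 0 z) \<and> y \<in> A \<and> (\<exists>v<b. pr y v \<in> g \<and> pr v z \<in> Y) \<or>
     t = pr (pr 1 y) (pr 1 z) \<and> y \<in> A \<and> z \<in> A \<and>
       (y = z \<or> (\<exists>v<b. \<exists>w<b. pr y v \<in> g \<and> pr z w \<in> f \<and> pr v w \<in> Y)))" for t
  have Ff: "(\<exists>v<b. pr x v \<in> f \<and> R v) \<longleftrightarrow> R (F x)" and Gg: "(\<exists>v<b. pr x v \<in> g \<and> R v) \<longleftrightarrow> R (G x)"
    if "x \<in> A" for x R
    using f(2)[OF that] g(2)[OF that] bound[OF that] by auto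
  have GF: "(\<exists>v<b. \<exists>w<b. pr y v \<in> g \<and> pr z w \<in> f \<and> pr v w \<in> Y) \<longleftrightarrow> pr (G y) (F z) \<in> Y"
    if "y \<in> A" "z \<in> A" for y z
    using f(2)[OF that(2)] g(2)[OF that(1)] bound[OF that(1)] bound[OF that(2)] by auto
  have "y < pr (pr i y) (pr j z) + 1" "z < pr (pr i y) (pr j z) + 1" for i j y z
    unfolding less_add_one_iff by (rule order_trans[OF pr_le(2) pr_le(1)] order_trans[OF pr_le(2) pr_le(2)])+
  note lt = this
  define D where "D t y z \<longleftrightarrow> t = pr (pr 0 y) (pr 0 z) \<and> pr y z \<in> Y \<or>
     t = pr (pr 0 y) (pr 1 z) \<and> z \<in> A \<and> pr y (F z) \<in> Y \<or>
     t = pr (pr 1 y) (pr 0 z) \<and> y \<in> A \<and> pr (G y) z \<in> Y \<or>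
     t = pr (pr 1 y) (pr 1 z) \<and> y \<in> A \<and> z \<in> A \<and> (y = z \<or> pr (G y) (F z) \<in> Y)" for t y z
  have 1: "t \<in> interp Y A F G \<longleftrightarrow> (\<exists>y z. D t y z)" for t
    unfolding interp_def D_def mem_Collect_eq by blast
  have 2: "Q t \<longleftrightarrow> (\<exists>y<t + 1. \<exists>z<t + 1. D t y z)" for t
    unfolding Q_def D_def by (simp add: Ff Gg GF cong: conj_cong)
  have 3: "y < t + 1 \<and> z < t + 1" if "D t y z" for t y z
    using that lt unfolding D_def by (elim disjE conjE) simp_all
  have "interp Y A F G = {t. Q t}"
    unfolding set_eq_iff mem_Collect_eq 1 2 using 3 by blast
  moreover have "{t. Q t} \<in> S" unfolding Q_def
    by (intro comprehension sigma1_delta0 def_intros assms(1,2) f(1) g(1))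
  ultimately show ?thesis by simp
qed

lemma field_interp: "p \<in> sem_field (interp Y A F G) \<longleftrightarrow> (\<exists>y. p = pr 0 y \<and> y \<in> sem_field Y) \<or> (\<exists>x. p = pr 1 x \<and> x \<in> A)"
  unfolding sem_field_def interp_def by auto

text \<open>Transitivity through a new point inserts the inequality between \<open>F x\<close> and
  \<open>G x\<close>. A failure of antisymmetry would put \<open>G x\<close> below
  \<open>F x\<close> for some x in A, which the strict inequality there excludes.\<close>

lemma po_interp:
  assumes Y: "sem_po Y" and F: "\<And>x. x \<in> A \<Longrightarrow> F x \<in> sem_field Y \<and> G x \<in> sem_field Y"
    and FG: "\<And>x. x \<in> A \<Longrightarrow> pr (F x) (G x) \<in> Y" "\<And>x. x \<in> A \<Longrightarrow> F x \<noteq> G x"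
  shows "sem_po (interp Y A F G)"
proof -
  have antisym: "y = z" if "pr y z \<in> Y" "pr z y \<in> Y" for y z
    using Y that unfolding sem_po_def by blast
  have trans: "pr x z \<in> Y" if "pr x y \<in> Y" "pr y z \<in> Y" for x y z
    using Y that unfolding sem_po_def by blast
  have fld: "y \<in> sem_field Y" "z \<in> sem_field Y" if "pr y z \<in> Y" for y z
    using Y that unfolding sem_po_def by (metis pr_inject)+
  have cases: "(\<exists>y. p = pr 0 y \<and> y \<in> sem_field Y) \<or> (\<exists>x. p = pr 1 x \<and> x \<in> A)"
    "(\<exists>y. q = pr 0 y \<and> y \<in> sem_field Y) \<or> (\<exists>x. q = pr 1 x \<and> x \<in> A)"
    if "pr p q \<in> interp Y A F G" for p q
    using that fld unfolding interp_def by auto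
  have not_GF: "pr (G x) (F x) \<notin> Y" if "x \<in> A" for x
    using antisym[OF FG(1)[OF that]] FG(2)[OF that] by blast
  have GG: "pr (G x) (G x') \<in> Y" "pr (F x) (F x') \<in> Y" if "x \<in> A" "x' \<in> A" "pr (G x) (F x') \<in> Y" for x x'
    using that trans FG(1) by blast+
  show ?thesis unfolding sem_po_def
  proof (intro conjI allI impI)
    fix t assume "t \<in> interp Y A F G"
    moreover from this obtain p q where t: "t = pr p q" unfolding interp_def by blast
    ultimately have "p \<in> sem_field (interp Y A F G)" "q \<in> sem_field (interp Y A F G)"
      using cases[of p q] unfolding field_interp by simp_all
    with t show "\<exists>p q. t = pr p q \<and> p \<in> sem_field (interp Y A F G) \<and> q \<in> sem_field (interp Y A F G)"
      by blast
  next
    fix p q assume *: "pr p q \<in> interp Y A F G \<and> pr q p \<in> interp Y A F G"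
    have "x = x'" if "x \<in> A" "x' \<in> A" "pr (G x) (F x') \<in> Y" "pr (G x') (F x) \<in> Y" for x x'
      using trans[OF GG(1)[OF that(1-3)] that(4)] not_GF[OF that(1)] by blast
    moreover have False if "x \<in> A" "pr (G x) y \<in> Y" "pr y (F x) \<in> Y" for x y
      using trans[OF that(2,3)] not_GF[OF that(1)] by blast
    ultimately show "p = q"
      using * cases(1)[of p q] cases(2)[of p q] antisym by (elim disjE exE conjE) (auto simp: interp_iff)
  next
    fix p q r assume *: "pr p q \<in> interp Y A F G \<and> pr q r \<in> interp Y A F G"
    have 1: "pr y (F x') \<in> Y" if "x \<in> A" "x' \<in> A" "pr y (F x) \<in> Y" "pr (G x) (F x') \<in> Y" for x x' y
      using trans[OF that(3) trans[OF FG(1)[OF that(1)] that(4)]] .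
    have 2: "pr (G x) y \<in> Y" if "x \<in> A" "x' \<in> A" "pr (G x) (F x') \<in> Y" "pr (G x') y \<in> Y" for x x' y
      using trans[OF trans[OF that(3) FG(1)[OF that(2)]] that(4)] .
    have 3: "pr y z \<in> Y" if "x \<in> A" "pr y (F x) \<in> Y" "pr (G x) z \<in> Y" for x y z
      using trans[OF trans[OF that(2) FG(1)[OF that(1)]] that(3)] .
    show "pr p r \<in> interp Y A F G"
      using * cases(1)[of p q] cases(2)[of p q] cases(2)[of q r]
      by (elim disjE exE conjE; auto simp: interp_iff; blast intro: trans 1 2 3)
  qed
qed

end

context coded_dilator
begin

lemma val_le:
  assumes X: "sem_po X" "code a \<subseteq> sem_field X" "chart X a c h" "sem_trace P W c \<sigma>"
    and wpo: "\<And>Z. Z \<in> S \<Longrightarrow> sem_wpo Z \<Longrightarrow> sem_good (sem_elem P E W Z) (sem_le P E W Z)"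
    and Y: "Y \<in> S" "sem_po Y"
    and F: "graph_on f (code a) F" "F ` code a \<subseteq> sem_field Y" "reflects X a F Y"
    and G: "graph_on g (code a) G" "G ` code a \<subseteq> sem_field Y" "reflects X a G Y"
    and le: "\<And>x. x \<in> code a \<Longrightarrow> pr (F x) (G x) \<in> Y"
    and e: "chart Y e l n" "code e = F ` code a \<union> G ` code a"
    and \<rho>: "val c h \<sigma> F l n \<rho>" "val c h \<sigma> G l n \<rho>'"
  shows "pr \<rho> \<rho>' \<in> sem_ord W l"
proof -
  note c = X(3) and \<sigma> = X(4)
  have f: "pr x y \<in> f \<longleftrightarrow> y = F x" if "x \<in> code a" for x y
    using F(1) that unfolding graph_on_def by blast
  have g: "pr x y \<in> g \<longleftrightarrow> y = G x" if "x \<in> code a" for x y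
    using G(1) that unfolding graph_on_def by blast
  have fg: "f \<in> S" "g \<in> S" using F(1) G(1) unfolding graph_on_def by blast+
  have Fl: "F x \<in> sem_field Y" "G x \<in> sem_field Y" if "x \<in> code a" for x
    using F(2) G(2) that by blast+
  have refl: "pr (F x) (F x) \<in> Y" "pr (G x) (G x) \<in> Y" if "x \<in> code a" for x
    using Fl[OF that] unfolding sem_field_def by blast+
  have X_refl: "pr x x \<in> X" if "x \<in> code a" for x using X(2) that by (auto simp: sem_field_def)
  have X_antisym: "y = z" if "pr y z \<in> X" "pr z y \<in> X" for y z
    using X(1) that unfolding sem_po_def by blast
  have Y_trans: "pr x z \<in> Y" if "pr x y \<in> Y" "pr y z \<in> Y" for x y z
    using Y(2) that unfolding sem_po_def by blast
  have F_inj: "x = x'" if "x \<in> code a" "x' \<in> code a" "F x = F x'" for x x'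
    using that F(3) refl(1)[of x] X_antisym unfolding reflects_def by metis
  have G_inj: "x = x'" if "x \<in> code a" "x' \<in> code a" "G x = G x'" for x x'
    using that G(3) refl(2)[of x] X_antisym unfolding reflects_def by metis
  have bound: "F x < e \<and> G x < e" if "x \<in> code a" for x
    using that code_bound[of _ e] unfolding e(2) by blast
  define A where "A = {x. x \<in> code a \<and> (\<exists>y<e. pr x y \<in> f \<and> pr x y \<notin> g)}"
  have "A \<in> S" unfolding A_def by (intro comprehension sigma1_delta0 def_intros fg)
  have A_iff: "x \<in> A \<longleftrightarrow> F x \<noteq> G x" if "x \<in> code a" for x
    using f[OF that] g[OF that] bound[OF that] that unfolding A_def by auto
  have A_sub: "A \<subseteq> code a" unfolding A_def by blast
  let ?Y = "interp Y A F G"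
  have Y': "?Y \<in> S" "sem_po ?Y"
    using interp_in_S[OF Y(1) \<open>A \<in> S\<close> graph_on_subset[OF F(1) A_sub] graph_on_subset[OF G(1) A_sub], of e] bound A_sub
    by (blast, intro po_interp[OF Y(2)]) (use A_sub A_iff Fl le in auto)
  \<comment> \<open>Where \<open>F x = G x\<close> there is no room strictly in between, and M keeps
    the common value.\<close>
  define M where "M x = (if x \<in> A then pr 1 x else pr 0 (F x))" for x
  define F' where "F' x = pr 0 (F x)" for x
  define G' where "G' x = pr 0 (G x)" for x
  have tag: "\<exists>r'. graph_on r' (code a) (\<lambda>x. pr 0 (H x))" if H: "graph_on r (code a) H" for r H
  proof -
    let ?r = "{t. \<exists>x<t + 1. \<exists>y<t + 1. t = pr x (pr 0 y) \<and> pr x y \<in> r}"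
    have "r \<in> S" using H unfolding graph_on_def by blast
    then have "?r \<in> S" by (intro comprehension sigma1_delta0 def_intros)
    moreover have "pr x z \<in> ?r \<longleftrightarrow> z = pr 0 (H x)" if "x \<in> code a" for x z
    proof -
      have "x < pr x (pr 0 y) + 1" "y < pr x (pr 0 y) + 1" for y
        unfolding less_add_one_iff by (rule pr_le(1), rule order_trans[OF pr_le(2) pr_le(2)])
      then have "pr x z \<in> ?r \<longleftrightarrow> (\<exists>y. z = pr 0 y \<and> pr x y \<in> r)" by auto
      then show ?thesis using H that unfolding graph_on_def by auto
    qed
    ultimately show ?thesis unfolding graph_on_def by blast
  qed
  obtain rF where rF: "graph_on rF (code a) F'" using tag[OF F(1)] unfolding F'_def by blast
  obtain rG where rG: "graph_on rG (code a) G'" using tag[OF G(1)] unfolding G'_def by blast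
  have "\<exists>r. graph_on r (code a) M"
  proof -
    let ?r = "{t. \<exists>x<t + 1. x \<in> A \<and> t = pr x (pr 1 x) \<or> x \<notin> A \<and> (\<exists>z<t + 1. t = pr x z \<and> pr x z \<in> rF)}"
    have "rF \<in> S" using rF unfolding graph_on_def by blast
    then have "?r \<in> S" by (intro comprehension sigma1_delta0 def_intros \<open>A \<in> S\<close>)
    moreover have "pr x z \<in> ?r \<longleftrightarrow> z = M x" if "x \<in> code a" for x z
    proof -
      have "x < pr x z + 1" "z < pr x z + 1" for z unfolding less_add_one_iff by (rule pr_le)+
      then have "pr x z \<in> ?r \<longleftrightarrow> x \<in> A \<and> z = pr 1 x \<or> x \<notin> A \<and> pr x z \<in> rF" by auto
      then show ?thesis using rF that unfolding graph_on_def M_def F'_def by auto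
    qed
    ultimately show ?thesis unfolding graph_on_def by blast
  qed
  then obtain rM where rM: "graph_on rM (code a) M" by blast
  have FF: "F' ` code a \<subseteq> sem_field ?Y" "reflects X a F' ?Y"
    using F(2,3) unfolding F'_def reflects_def interp_iff by (auto simp: field_interp)
  have GG: "G' ` code a \<subseteq> sem_field ?Y" "reflects X a G' ?Y"
    using G(2,3) unfolding G'_def reflects_def interp_iff by (auto simp: field_interp)
  \<comment> \<open>Needed for M to reflect the order between new points: if \<open>G x\<close> is
    below \<open>F y\<close> then so is \<open>F x\<close>, and F reflects.\<close>
  have GF: "pr x y \<in> X" if "x \<in> code a" "y \<in> code a" "pr (G x) (F y) \<in> Y" for x y
    using F(3) that Y_trans[OF le[OF that(1)] that(3)] unfolding reflects_def by blast
  have MM: "M ` code a \<subseteq> sem_field ?Y" "reflects X a M ?Y"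
    using F(2,3) X_refl GF unfolding M_def reflects_def by (auto simp: field_interp interp_iff)
  have FM: "pr (F' x) (M x) \<in> ?Y" and MG: "pr (M x) (G' x) \<in> ?Y" if "x \<in> code a" for x
    using refl[OF that] le[OF that] A_iff[OF that] unfolding F'_def G'_def M_def by (auto simp: interp_iff)
  \<comment> \<open>New points are no values of \<open>F'\<close>, so \<open>M x'\<close> is the
    copy of \<open>F x'\<close> and injectivity of F applies.\<close>
  have sepF: "x = x'" if "x \<in> code a" "x' \<in> code a" "F' x = M x'" for x x'
    using that F_inj unfolding F'_def M_def by (auto split: if_splits)
  \<comment> \<open>An old value of M comes from some x with \<open>F x = G x\<close>, so
    injectivity of G applies.\<close>
  have sepG: "x = x'" if "x \<in> code a" "x' \<in> code a" "M x = G' x'" for x x'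
    using that G_inj A_iff[of x] unfolding G'_def M_def by (auto split: if_splits)
  obtain b1 where b1: "code b1 = F' ` code a" using ex_code_image[OF rF] by blast
  obtain b2 where b2: "code b2 = M ` code a" using ex_code_image[OF rM] by blast
  obtain b3 where b3: "code b3 = G' ` code a" using ex_code_image[OF rG] by blast
  obtain b4 where b4: "code b4 = code b1 \<union> code b2" using ex_code_union by blast
  obtain e' where "code e' = code b4 \<union> code b3" using ex_code_union by blast
  then have e': "code e' = F' ` code a \<union> M ` code a \<union> G' ` code a" using b1 b2 b3 b4 by simp
  then have "code e' \<subseteq> sem_field ?Y" using FF(1) MM(1) GG(1) by simp
  moreover from this obtain l' n' where "sem_enum E ?Y e' l' n'" using enum_ex[OF Y'] by blast
  ultimately have ch': "chart ?Y e' l' n'" by (rule enum_chart[OF Y'(2)])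
  have sub: "F' ` code a \<subseteq> code e'" "M ` code a \<subseteq> code e'" "G' ` code a \<subseteq> code e'" using e' by auto
  obtain \<alpha> where \<alpha>: "val c h \<sigma> F' l' n' \<alpha>" using val_ex[OF c \<sigma> ch' rF sub(1) FF(2)] .
  obtain \<beta> where \<beta>: "val c h \<sigma> M l' n' \<beta>" using val_ex[OF c \<sigma> ch' rM sub(2) MM(2)] .
  obtain \<gamma> where \<gamma>: "val c h \<sigma> G' l' n' \<gamma>" using val_ex[OF c \<sigma> ch' rG sub(3) GG(2)] .
  have "pr \<alpha> \<beta> \<in> sem_ord W l'"
    by (rule val_le_separated[OF X wpo Y' rF FF rM MM FM sepF ch' sub(1,2) \<alpha> \<beta>])
  moreover have "pr \<beta> \<gamma> \<in> sem_ord W l'"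
    by (rule val_le_separated[OF X wpo Y' rM MM rG GG MG sepG ch' sub(2,3) \<beta> \<gamma>])
  moreover have "sem_po (sem_ord W l')"
    using dilator chartD(1)[OF ch'] unfolding sem_dilator_def sem_functor_def by blast
  ultimately have le': "pr \<alpha> \<gamma> \<in> sem_ord W l'" unfolding sem_po_def by blast

  \<comment> \<open>The tagging of Y by 0 reflects the order; along it the inequality is brought
    back from the extended order to Y.\<close>
  let ?r = "{t. \<exists>y<t + 1. t = pr y (pr 0 y)}"
  have "?r \<in> S" by (intro comprehension sigma1_delta0 def_intros)
  moreover have "pr y z \<in> ?r \<longleftrightarrow> z = pr 0 y" for y z
    using pr_le(1)[of y "pr 0 y"] by (auto simp: less_add_one_iff)
  ultimately have K: "graph_on ?r (code e) (pr 0)" unfolding graph_on_def by blast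
  have K_sub: "pr 0 ` code e \<subseteq> code e'" unfolding e(2) e' F'_def G'_def by auto
  have K_refl: "reflects Y e (pr 0) ?Y" unfolding reflects_def by (simp add: interp_iff)
  obtain m where m: "code m = ind n (pr 0) n'" "sem_mor P m l l'"
    using induced_morphism[OF e(1) ch' K K_sub K_refl] .
  have sub': "F ` code a \<subseteq> code e" "G ` code a \<subseteq> code e" using e(2) by auto
  obtain \<alpha>' where \<alpha>': "pr \<rho> \<alpha>' \<in> sem_Wmor W m l l'" using Wmor_total[OF m(2) val_field[OF \<rho>(1)]] .
  have "\<alpha>' = \<alpha>"
    by (rule val_unique[OF val_push[OF c e(1) sub'(1) \<rho>(1) m \<alpha>' ch' rF sub(1) FF(2)] \<alpha>]) (simp add: F'_def)
  obtain \<gamma>' where \<gamma>': "pr \<rho>' \<gamma>' \<in> sem_Wmor W m l l'" using Wmor_total[OF m(2) val_field[OF \<rho>(2)]] .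
  have "\<gamma>' = \<gamma>"
    by (rule val_unique[OF val_push[OF c e(1) sub'(2) \<rho>(2) m \<gamma>' ch' rG sub(3) GG(2)] \<gamma>]) (simp add: G'_def)
  show ?thesis
    using Wmor_reflects[OF m(2) \<alpha>' \<gamma>'] le' \<open>\<alpha>' = \<alpha>\<close> \<open>\<gamma>' = \<gamma>\<close> by simp
qed

lemma monotone:
  assumes wpo: "\<And>Z. Z \<in> S \<Longrightarrow> sem_wpo Z \<Longrightarrow> sem_good (sem_elem P E W Z) (sem_le P E W Z)"
  shows "sem_monotone P E W"
  unfolding sem_monotone_def
proof (intro ballI allI impI, elim conjE)
  fix X Y f g p
  assume S: "X \<in> S" "Y \<in> S" "f \<in> S" "g \<in> S" and X: "sem_po X" and Y: "sem_po Y"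
    and f: "sem_qe f X Y" and g: "sem_qe g X Y"
    and fg: "\<forall>x y z. pr x y \<in> f \<and> pr x z \<in> g \<longrightarrow> pr y z \<in> Y"
    and p: "p \<in> sem_elem P E W X"
  obtain a \<sigma> c h where a: "p = pr a \<sigma>" "isfin a" "code a \<subseteq> sem_field X" "sem_enum E X a c h"
    "chart X a c h" "sem_trace P W c \<sigma>"
    using elem_chartE[OF p X] .
  note c = a(5) and \<sigma> = a(6)
  have map: "\<exists>F. graph_on r (code a) F \<and> F ` code a \<subseteq> sem_field Y \<and> reflects X a F Y"
    if "r \<in> S" "sem_qe r X Y" for r
  proof -
    \<comment> \<open>A function of the logic is read off from the graph; its values off the field
      of X are irrelevant because \<open>code a\<close> lies inside the field.\<close>
    define F where "F x = (THE y. pr x y \<in> r)" for x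
    have F: "pr x y \<in> r \<longleftrightarrow> y = F x" if "x \<in> code a" for x y
    proof -
      have "\<exists>!y. pr x y \<in> r"
        using \<open>sem_qe r X Y\<close> that a(3) unfolding sem_qe_def sem_function_def by blast
      then show ?thesis unfolding F_def using theI'[of "\<lambda>y. pr x y \<in> r"] by blast
    qed
    have "F x \<in> sem_field Y" if "x \<in> code a" for x
    proof -
      have "pr x (F x) \<in> r" using F that by blast
      then show ?thesis using \<open>sem_qe r X Y\<close> unfolding sem_qe_def sem_function_def by (metis pr_inject)
    qed
    moreover have "reflects X a F Y"
      using \<open>sem_qe r X Y\<close> F unfolding sem_qe_def reflects_def by blast
    ultimately show ?thesis using F \<open>r \<in> S\<close> unfolding graph_on_def by blast
  qed
  obtain F where F: "graph_on f (code a) F" "F ` code a \<subseteq> sem_field Y" "reflects X a F Y"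
    using map[OF S(3) f] by blast
  obtain G where G: "graph_on g (code a) G" "G ` code a \<subseteq> sem_field Y" "reflects X a G Y"
    using map[OF S(4) g] by blast
  have FG: "pr (F x) (G x) \<in> Y" if "x \<in> code a" for x
    using fg F(1) G(1) that unfolding graph_on_def by blast
  obtain b \<tau> d k m where push: "pushes a \<sigma> c h F Y b \<tau> d k m" using pushes_ex[OF c \<sigma> S(2) Y F] .
  obtain b' \<tau>' d' k' m' where push': "pushes a \<sigma> c h G Y b' \<tau>' d' k' m'" using pushes_ex[OF c \<sigma> S(2) Y G] .
  have b: "code b = F ` code a" "code b' = G ` code a" using push push' unfolding pushes_def by blast+
  obtain e where e: "isfin e" "code e = code b \<union> code b'" using ex_code_union .
  have e_sub: "code e \<subseteq> sem_field Y" using e(2) b F(2) G(2) by simp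
  then obtain l n where en: "sem_enum E Y e l n" using enum_ex[OF S(2) Y] by blast
  then have ch: "chart Y e l n" by (rule enum_chart[OF Y e_sub])
  have e_eq: "code e = F ` code a \<union> G ` code a" using e(2) unfolding b .
  then have sub: "F ` code a \<subseteq> code e" "G ` code a \<subseteq> code e" by auto
  obtain \<rho> where \<rho>: "val c h \<sigma> F l n \<rho>" using val_ex[OF c \<sigma> ch F(1) sub(1) F(3)] .
  obtain \<rho>' where \<rho>': "val c h \<sigma> G l n \<rho>'" using val_ex[OF c \<sigma> ch G(1) sub(2) G(3)] .
  have "pr \<rho> \<rho>' \<in> sem_ord W l"
    by (rule val_le[OF X a(3) c \<sigma> wpo S(2) Y F G FG ch e_eq \<rho> \<rho>'])
  then have "sem_le P E W Y (pr b \<tau>) (pr b' \<tau>')"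
    using val_le_iff[OF X a(3) c \<sigma> Y F G push push' e en ch \<rho> \<rho>'] by blast
  moreover have "sem_map P E W X Y f p (pr b \<tau>)" "sem_map P E W X Y g p (pr b' \<tau>')"
    using pushes_map[OF p[unfolded a(1)] a(4) push c \<sigma> Y F] pushes_map[OF p[unfolded a(1)] a(4) push' c \<sigma> Y G] a(1)
    by simp_all
  ultimately show "\<exists>q r. sem_map P E W X Y f p q \<and> sem_map P E W X Y g p r \<and> sem_le P E W Y q r"
    by blast
qed

end

theorem (in arithmetic) valid_goal: "valid S goal"
  unfolding goal_def
proof (rule valid_sentence)
  show "Fm w (\<^bold>\<forall>\<^sub>S P. \<^bold>\<forall>\<^sub>S E. representatives P E \<^bold>\<longrightarrow>
      (\<^bold>\<forall>\<^sub>S W. WPO_dilator P E W \<^bold>\<longrightarrow> monotone_dilator P E W))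
    (\<forall>P\<in>S. \<forall>E\<in>S. sem_reps P E \<longrightarrow> (\<forall>W\<in>S. sem_WPO_dilator P E W \<longrightarrow> sem_monotone P E W))" for w
    by (assumption | rule fm_intros | rule mono_rules, assumption)+
  show "\<forall>P\<in>S. \<forall>E\<in>S. sem_reps P E \<longrightarrow> (\<forall>W\<in>S. sem_WPO_dilator P E W \<longrightarrow> sem_monotone P E W)"
  proof (intro ballI impI)
    fix P E W
    assume "P \<in> S" "E \<in> S" "W \<in> S" "sem_reps P E" and W: "sem_WPO_dilator P E W"
    then interpret coded_dilator S P E W
      by unfold_locales (simp_all add: sem_WPO_dilator_def)
    show "sem_monotone P E W" using W by (intro monotone) (simp add: sem_WPO_dilator_def)
  qed
qed

theorem proposition2p1:
  shows "RCA0 \<turnstile> sentence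
    (\<^bold>\<forall>\<^sub>S P. \<^bold>\<forall>\<^sub>S E. representatives P E \<^bold>\<longrightarrow>
       (\<^bold>\<forall>\<^sub>S W. WPO_dilator P E W \<^bold>\<longrightarrow> monotone_dilator P E W))"
proof -
  \<comment> \<open>The type \<open>elt\<close> is an ordered semiring by now, so results about
    \<open>arithmetic\<close> models apply to the term model.\<close>
  interpret arithmetic "range ext" ..
  show ?thesis using derives_goal[OF valid_goal] unfolding goal_def .
qed

end
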